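(* Let $u\in\mathcal{D}$ and assume there exists a measurable map $V:\mathbb{W}\to\mathbb{W}$ such that $V\circ W^u=I_{\mathbb{W}}$ $\nu$-a.s. Put $v=-u\circ V$. Then $W^u\circ V=I_{\mathbb{W}}$ $\nu$-a.s., $v\in\mathcal{D}$, and $V=W^v$ $\nu$-a.s. Moreover, $$\frac{dW^u\nu}{d\nu}=\rho(-\delta_\beta v),\qquad \frac{dW^v\nu}{d\nu}=\rho(-\delta_\beta u).$$
   Context: Notation. Let $n\ge 1$, $\mathbb{W}=C([0,1],\mathbb{R}^n)$, $H=\{\int_0^\cdot\dot h(s)ds:\dot h\in L^2([0,1],\mathbb{R}^n)\}$ with $|h|_H^2=\int_0^1|\dot h(s)|^2ds$. $W=(W(t))_{t\in[0,1]}$ is the coordinate process on $\mathbb{W}$ (so, as a map, $W=I_{\mathbb{W}}$, the identity). $\nu$ is a probability measure on $\mathbb{W}$; all filtrations are completed with respect to $\nu$, and $(\mathcal{F}_t)$ is the filtration of $W$. For $p\ge 0$, $L^p_a(\nu,H)$ is the set of $u\in L^p(\nu,H)$ whose density $\dot u$ is $(\mathcal{F}_t)$-adapted ($L^0$: all measurable maps). $\mathcal{D}=\{u\in L^0_a(\nu,H):\dot u \text{ is } d\nu\times dt\text{-a.s. bounded}\}$. For a $\nu$-Brownian motion $\beta$, $\delta_\beta u=\int_0^1\dot u(s)d\beta(s)$ and $\rho(-\delta_\beta u)=\exp\left(-\int_0^1\dot u(s)d\beta(s)-\frac12\int_0^1|\dot u(s)|^2ds\right)$. $U\nu$ denotes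 the image measure of $\nu$ under $U$. Standing assumption. There are an $\mathbb{R}^n$-valued $\nu$-Brownian motion $\beta$ defined on $\mathbb{W}$ and a family $(W^u)_{u\in\mathcal{D}}$ of continuous processes on $\mathbb{W}$ (i.e. measurable maps $W^u:\mathbb{W}\to\mathbb{W}$) such that: (i) the canonical (completed) filtration of $\beta$ equals that of $W$; (ii) $W^0=W$; (iii) for every $u\in\mathcal{D}$, the law of $W^u$ under $\tilde\nu^u$, where $\frac{d\tilde\nu^u}{d\nu}=\rho(-\delta_\beta u)$, equals the law of $W$ under $\nu$; (iv) for every $u\in\mathcal{D}$, $\beta\circ W^u=\beta+u$ $\nu$-a.s.; (v) for all $u,v\in\mathcal{D}$, $W^u\circ W^v=W^{v+u\circ W^v}$ $\nu$-a.s. (These imply $W^u\nu\sim\nu$ for $u\in\mathcal{D}$.) *)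

theory Defs
  imports "HOL-Probability.Probability"
begin

text \<open>
  The path space \<open>C([0,1], \<real>\<^sup>n)\<close>, where \<open>n = CARD('n)\<close>. Paths are represented by functions on the
  whole real line that vanish off \<open>[0,1]\<close>; thus two paths are equal iff they agree on \<open>[0,1]\<close>,
  and the pointwise operations preserve the representation.
\<close>

typedef 'n cpath = "{f :: real \<Rightarrow> real ^ 'n::finite. continuous_on {0..1} f \<and> (\<forall>t. t \<notin> {0..1} \<longrightarrow> f t = 0)}"
  morphisms path_val Cpath
  by (intro exI[of _ "\<lambda>_. 0"]) auto

setup_lifting type_definition_cpath

instantiation cpath :: (finite) ab_group_add
begin

lift_definition zero_cpath :: "'a cpath" is "\<lambda>_. 0"
  by auto

lift_definition plus_cpath :: "'a cpath \<Rightarrow> 'a cpath \<Rightarrow> 'a cpath" is "\<lambda>f g t. f t + g t"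
  by (auto intro: continuous_intros)

lift_definition minus_cpath :: "'a cpath \<Rightarrow> 'a cpath \<Rightarrow> 'a cpath" is "\<lambda>f g t. f t - g t"
  by (auto intro: continuous_intros)

lift_definition uminus_cpath :: "'a cpath \<Rightarrow> 'a cpath" is "\<lambda>f t. - f t"
  by (auto intro: continuous_intros)

instance
  by standard (transfer; simp add: algebra_simps)+

end

text \<open>
  The sigma-algebra generated by the coordinate maps. It coincides with the Borel sigma-algebra of
  the uniform norm, and a measurable map into it is the same thing as a continuous process.
\<close>

definition path_borel :: "'n::finite cpath measure" where
  "path_borel = sigma UNIV {(\<lambda>w. path_val w t) -` A | t A. t \<in> {0..1} \<and> A \<in> sets borel}"

definition unit_time :: "real measure" where
  "unit_time = restrict_space lborel {0..1}"

text \<open>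
  In all that follows \<open>\<nu>\<close> is meant to be a complete measure, so that \<open>null_sets \<nu>\<close> is closed under
  subsets and the filtration below is the completed one.
\<close>

definition natural_filtration ::
    "'n::finite cpath measure \<Rightarrow> ('n cpath \<Rightarrow> 'n cpath) \<Rightarrow> real \<Rightarrow> 'n cpath measure" where
  "natural_filtration \<nu> X t = sigma (space \<nu>)
     ({(\<lambda>w. path_val (X w) s) -` A \<inter> space \<nu> | s A. s \<in> {0..t} \<and> A \<in> sets borel} \<union> null_sets \<nu>)"

abbreviation coord_filtration :: "'n::finite cpath measure \<Rightarrow> real \<Rightarrow> 'n cpath measure" where
  "coord_filtration \<nu> \<equiv> natural_filtration \<nu> (\<lambda>w. w)"

definition brownian_motion :: "'n::finite cpath measure \<Rightarrow> ('n cpath \<Rightarrow> 'n cpath) \<Rightarrow> bool" where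
  "brownian_motion \<nu> B \<longleftrightarrow>
     B \<in> \<nu> \<rightarrow>\<^sub>M path_borel \<and>
     (AE w in \<nu>. path_val (B w) 0 = 0) \<and>
     (\<forall>s t. 0 \<le> s \<and> s < t \<and> t \<le> 1 \<longrightarrow>
        distributed \<nu> lborel (\<lambda>w. path_val (B w) t - path_val (B w) s)
          (\<lambda>x. ennreal (\<Prod>i\<in>UNIV. normal_density 0 (sqrt (t - s)) (x $ i))) \<and>
        prob_space.indep_set \<nu> (sets (natural_filtration \<nu> B s))
          (sets (vimage_algebra (space \<nu>) (\<lambda>w. path_val (B w) t - path_val (B w) s) borel)))"

definition has_cm_density :: "'n::finite cpath \<Rightarrow> (real \<Rightarrow> real ^ 'n) \<Rightarrow> bool" where
  "has_cm_density h g \<longleftrightarrow>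
     g \<in> borel_measurable unit_time \<and>
     integrable unit_time (\<lambda>s. (norm (g s))\<^sup>2) \<and>
     (\<forall>t\<in>{0..1}. path_val h t = (LINT s:{0..t}|lborel. g s))"

definition cameron_martin :: "'n::finite cpath set" where
  "cameron_martin = {h. \<exists>g. has_cm_density h g}"

text \<open>
  The density of a random element of the Cameron-Martin space is determined only up to
  \<open>d\<nu> \<times> dt\<close>-null sets; it is called adapted if it has an adapted, jointly measurable version.
\<close>

definition adapted_density ::
    "'n::finite cpath measure \<Rightarrow> ('n cpath \<Rightarrow> 'n cpath) \<Rightarrow> ('n cpath \<Rightarrow> real \<Rightarrow> real ^ 'n) \<Rightarrow> bool" where
  "adapted_density \<nu> u g \<longleftrightarrow>
     (\<lambda>(w, t). g w t) \<in> borel_measurable (\<nu> \<Otimes>\<^sub>M unit_time) \<and>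
     (\<forall>t\<in>{0..1}. (\<lambda>w. g w t) \<in> borel_measurable (coord_filtration \<nu> t)) \<and>
     (AE w in \<nu>. has_cm_density (u w) (g w))"

definition L0_adapted :: "'n::finite cpath measure \<Rightarrow> ('n cpath \<Rightarrow> 'n cpath) set" where
  "L0_adapted \<nu> = {u \<in> \<nu> \<rightarrow>\<^sub>M path_borel. (\<forall>w. u w \<in> cameron_martin) \<and> (\<exists>g. adapted_density \<nu> u g)}"

definition cm_dot ::
    "'n::finite cpath measure \<Rightarrow> ('n cpath \<Rightarrow> 'n cpath) \<Rightarrow> 'n cpath \<Rightarrow> real \<Rightarrow> real ^ 'n" where
  "cm_dot \<nu> u = (SOME g. adapted_density \<nu> u g)"

definition bounded_drifts :: "'n::finite cpath measure \<Rightarrow> ('n cpath \<Rightarrow> 'n cpath) set" where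
  "bounded_drifts \<nu> =
     {u \<in> L0_adapted \<nu>. \<exists>C. AE (w, t) in \<nu> \<Otimes>\<^sub>M unit_time. norm (cm_dot \<nu> u w t) \<le> C}"

text \<open>
  The Ito integral over \<open>[0,1]\<close> of a square-integrable adapted integrand, as the \<open>L\<^sup>2(\<nu>)\<close>-limit of
  the integrals of simple processes converging to the integrand in \<open>L\<^sup>2(\<nu> \<times> dt)\<close>. The integral is
  scalar: integrand and increments are paired by the inner product. The triple \<open>(k, \<tau>, \<xi>)\<close> encodes
  the simple process equal to \<open>\<xi> i\<close> on \<open>(\<tau> i, \<tau> (i + 1)]\<close> for \<open>i < k\<close>.
\<close>

definition simple_process ::
    "(real \<Rightarrow> 'n::finite cpath measure) \<Rightarrow> nat \<Rightarrow> (nat \<Rightarrow> real) \<Rightarrow> (nat \<Rightarrow> 'n cpath \<Rightarrow> real ^ 'n) \<Rightarrow> bool" where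
  "simple_process F k \<tau> \<xi> \<longleftrightarrow>
     (\<forall>i\<le>k. \<tau> i \<in> {0..1}) \<and> (\<forall>i<k. \<tau> i \<le> \<tau> (Suc i)) \<and>
     (\<forall>i<k. \<xi> i \<in> borel_measurable (F (\<tau> i)) \<and> bounded (range (\<xi> i)))"

definition simple_value ::
    "nat \<Rightarrow> (nat \<Rightarrow> real) \<Rightarrow> (nat \<Rightarrow> 'n::finite cpath \<Rightarrow> real ^ 'n) \<Rightarrow> 'n cpath \<Rightarrow> real \<Rightarrow> real ^ 'n" where
  "simple_value k \<tau> \<xi> w t = (\<Sum>i<k. indicator {\<tau> i<..\<tau> (Suc i)} t *\<^sub>R \<xi> i w)"

definition simple_integral ::
    "('n cpath \<Rightarrow> 'n cpath) \<Rightarrow> nat \<Rightarrow> (nat \<Rightarrow> real) \<Rightarrow> (nat \<Rightarrow> 'n::finite cpath \<Rightarrow> real ^ 'n) \<Rightarrow> 'n cpath \<Rightarrow> real" where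
  "simple_integral B k \<tau> \<xi> w = (\<Sum>i<k. \<xi> i w \<bullet> (path_val (B w) (\<tau> (Suc i)) - path_val (B w) (\<tau> i)))"

definition has_ito_integral ::
    "'n::finite cpath measure \<Rightarrow> (real \<Rightarrow> 'n cpath measure) \<Rightarrow> ('n cpath \<Rightarrow> 'n cpath) \<Rightarrow>
     ('n cpath \<Rightarrow> real \<Rightarrow> real ^ 'n) \<Rightarrow> ('n cpath \<Rightarrow> real) \<Rightarrow> bool" where
  "has_ito_integral \<nu> F B g I \<longleftrightarrow>
     I \<in> borel_measurable \<nu> \<and>
     (\<exists>k \<tau> \<xi>. (\<forall>m. simple_process F (k m) (\<tau> m) (\<xi> m)) \<and>
        (\<lambda>m. \<integral>\<^sup>+ (w, t). ennreal ((norm (simple_value (k m) (\<tau> m) (\<xi> m) w t - g w t))\<^sup>2)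
               \<partial>(\<nu> \<Otimes>\<^sub>M unit_time)) \<longlonglongrightarrow> 0 \<and>
        (\<lambda>m. \<integral>\<^sup>+ w. ennreal ((simple_integral B (k m) (\<tau> m) (\<xi> m) w - I w)\<^sup>2) \<partial>\<nu>) \<longlonglongrightarrow> 0)"

text \<open>\<open>divergence \<nu> B u\<close> is \<open>\<delta>\<^sub>B u\<close>; it is determined up to \<open>\<nu>\<close>-null sets.\<close>

definition divergence ::
    "'n::finite cpath measure \<Rightarrow> ('n cpath \<Rightarrow> 'n cpath) \<Rightarrow> ('n cpath \<Rightarrow> 'n cpath) \<Rightarrow> 'n cpath \<Rightarrow> real" where
  "divergence \<nu> B u = (SOME I. has_ito_integral \<nu> (coord_filtration \<nu>) B (cm_dot \<nu> u) I)"

text \<open>\<open>girsanov_weight \<nu> B u\<close> is \<open>\<rho>(-\<delta>\<^sub>B u)\<close>.\<close>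

definition girsanov_weight ::
    "'n::finite cpath measure \<Rightarrow> ('n cpath \<Rightarrow> 'n cpath) \<Rightarrow> ('n cpath \<Rightarrow> 'n cpath) \<Rightarrow> 'n cpath \<Rightarrow> real" where
  "girsanov_weight \<nu> B u w =
     exp (- divergence \<nu> B u w - 1 / 2 * (\<integral>s. (norm (cm_dot \<nu> u w s))\<^sup>2 \<partial>unit_time))"

end

theory Submission
  imports Defs
begin

text \<open>
  Write \<open>B = \<beta> \<circ> W u = \<beta> + u\<close> and \<open>Q = \<rho>(-\<delta>\<^sub>\<beta> u) \<nu>\<close>. Since the image of \<open>\<nu>\<close> under \<open>W u\<close> is equivalent to \<open>\<nu>\<close>, the left
  inverse \<open>V\<close> is a right inverse too, and \<open>\<beta> \<circ> V = \<beta> + v\<close>. As \<open>\<beta>\<close> generates the sigma-algebra, this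
  gives \<open>V = W v\<close>, and the two densities follow from the law of \<open>W u\<close> and \<open>W v\<close>, as soon as \<open>v\<close> is
  known to be adapted, that is, \<open>V\<close> preserves each \<open>\<F>\<^sub>t\<close>.

  For the latter, \<open>B\<close> is a Brownian motion under \<open>Q\<close> with respect to \<open>(\<F>\<^sub>t)\<close>. Instead of proving
  Girsanov's theorem, one compares, for \<open>A \<in> \<F>\<^sub>s\<close>, the assumed laws for the drift \<open>u\<close> and for the drift
  \<open>u + 1\<^sub>A \<integral>\<^sub>0 1\<^bsub>(s,r]\<^esub> a dt\<close>: they say that the law of \<open>B\<^sub>r - B\<^sub>s\<close> under \<open>Q\<close> restricted to \<open>A\<close> has the
  Cameron-Martin quasi-invariance of the Gaussian law, hence is a multiple of it. By left invertibility
  \<open>B\<close> generates \<open>\<F>\<^sub>1\<close>, and independence of its increments then shows that it generates each \<open>\<F>\<^sub>t\<close>.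
\<close>

subsection \<open>Paths and Gaussian vectors\<close>

text \<open>Membership of \<open>v\<close> in \<open>bounded_drifts \<nu>\<close> is the costly
  conclusion, since a measurable left inverse carries no information about adaptedness by itself.
  Both \<open>cm_dot\<close> and \<open>divergence\<close> are choices, so a Girsanov weight can be
  computed with only after Ito integrals of bounded adapted densities are known to exist and to be
  almost surely unique. Only quotients of weights are needed, however. The modified drift adds an
  elementary adapted density to that of \<open>u\<close>, so its stochastic integral differs from
  that of \<open>u\<close> by an explicit term, and the quotient of the two weights is a function of
  \<open>A\<close> and of the increment of \<open>\<beta> + u\<close> alone. Hence the isometry and
  an approximation by simple processes suffice, without an Ito formula. The remaining steps
  transport almost sure statements along \<open>W u\<close> and \<open>V\<close>: the assumed law
  and the positivity of the weight let null sets pass in both directions.\<close>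

lemma space_path_borel [simp]: "space path_borel = UNIV"
  by (simp add: path_borel_def space_measure_of_conv)

lemma path_val_outside: "t \<notin> {0..1} \<Longrightarrow> path_val w t = 0"
  using path_val[of w] by auto

lemma path_val_measurable [measurable]:
  "(\<lambda>w. path_val (w :: 'n::finite cpath) t) \<in> borel_measurable path_borel"
proof (cases "t \<in> {0..1}")
  case True
  show ?thesis
  proof (rule measurableI)
    fix A :: "(real ^ 'n) set" assume "A \<in> sets borel"
    then show "(\<lambda>w. path_val w t) -` A \<inter> space path_borel \<in> sets path_borel"
      using True unfolding path_borel_def by (subst sets_measure_of) (auto intro!: sigma_sets.Basic)
  qed simp
qed (simp add: path_val_outside)

lemma measurable_into_path_borel:
  assumes "\<And>t. t \<in> {0..1} \<Longrightarrow> (\<lambda>x. path_val (X x) t) \<in> borel_measurable M"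
  shows "X \<in> M \<rightarrow>\<^sub>M (path_borel :: 'n::finite cpath measure)"
  unfolding path_borel_def
proof (rule measurable_measure_of)
  fix E assume "E \<in> {(\<lambda>w. path_val (w :: 'n cpath) t) -` A |t A. t \<in> {0..1} \<and> A \<in> sets borel}"
  then obtain t A where "E = (\<lambda>w. path_val w t) -` A" "t \<in> {0..1}" "A \<in> sets borel" by blast
  then show "X -` E \<inter> space M \<in> sets M"
    using measurable_sets[OF assms, of t A] by (simp add: vimage_def)
qed auto

lemma cpath_eqI: "(\<And>t. t \<in> {0..1} \<Longrightarrow> path_val x t = path_val y t) \<Longrightarrow> x = y"
  by (metis path_val_outside path_val_inject ext)

lemma plus_cpath_measurable [measurable]:
  fixes X Y :: "'a \<Rightarrow> 'n::finite cpath"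
  assumes [measurable]: "X \<in> M \<rightarrow>\<^sub>M path_borel" "Y \<in> M \<rightarrow>\<^sub>M path_borel"
  shows "(\<lambda>w. X w + Y w) \<in> M \<rightarrow>\<^sub>M path_borel"
  by (rule measurable_into_path_borel) (simp add: plus_cpath.rep_eq)

lemma uminus_cpath_measurable [measurable]:
  fixes X :: "'a \<Rightarrow> 'n::finite cpath"
  assumes [measurable]: "X \<in> M \<rightarrow>\<^sub>M path_borel"
  shows "(\<lambda>w. - X w) \<in> M \<rightarrow>\<^sub>M path_borel"
  by (rule measurable_into_path_borel) (simp add: uminus_cpath.rep_eq)

text \<open>The exceptional null set in the hypothesis depends on \<open>E\<close>. Countably many
  events decide the path, namely those given by basic open sets at rational times, and continuity
  does the rest. In this form, agreement of two random paths can be checked event by event.\<close>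

lemma AE_cpath_eqI:
  fixes X Y :: "'a \<Rightarrow> 'n::finite cpath"
  assumes ev: "\<And>E. E \<in> sets path_borel \<Longrightarrow> AE w in M. X w \<in> E \<longleftrightarrow> Y w \<in> E"
  shows "AE w in M. X w = Y w"
proof -
  obtain \<B> :: "(real ^ 'n) set set" where \<B>: "countable \<B>" "topological_basis \<B>"
    using ex_countable_basis by blast
  have op: "open S" if "S \<in> \<B>" for S using \<B>(2) that by (rule topological_basis_open)
  have "AE w in M. \<forall>t\<in>\<rat> \<inter> {0..1}. \<forall>S\<in>\<B>. X w \<in> (\<lambda>w. path_val w t) -` S \<longleftrightarrow> Y w \<in> (\<lambda>w. path_val w t) -` S"
  proof (subst AE_ball_countable)
    show "countable (\<rat> \<inter> {0..1::real})" by (simp add: countable_rat)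
    show "\<forall>t\<in>\<rat> \<inter> {0..1}. AE w in M. \<forall>S\<in>\<B>. X w \<in> (\<lambda>w. path_val w t) -` S \<longleftrightarrow> Y w \<in> (\<lambda>w. path_val w t) -` S"
    proof
      fix t :: real
      show "AE w in M. \<forall>S\<in>\<B>. X w \<in> (\<lambda>w. path_val w t) -` S \<longleftrightarrow> Y w \<in> (\<lambda>w. path_val w t) -` S"
      proof (subst AE_ball_countable[OF \<B>(1)], intro ballI ev)
        fix S assume "S \<in> \<B>"
        then have "S \<in> sets borel" using op borel_open by blast
        from measurable_sets[OF path_val_measurable this]
        show "(\<lambda>w. path_val w t) -` S \<in> sets path_borel" by simp
      qed
    qed
  qed
  then show ?thesis
  proof eventually_elim
    case (elim w)
    have rat: "path_val (X w) t = path_val (Y w) t" if "t \<in> \<rat> \<inter> {0..1}" for t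
    proof (rule ccontr)
      assume "path_val (X w) t \<noteq> path_val (Y w) t"
      then obtain U where U: "open U" "path_val (X w) t \<in> U" "path_val (Y w) t \<notin> U"
        by (meson t1_space)
      from topological_basisE[OF \<B>(2) U(1,2)] obtain S where "S \<in> \<B>" "path_val (X w) t \<in> S" "S \<subseteq> U" by blast
      with elim that U show False by blast
    qed
    have cont: "continuous_on {0..1} (path_val z)" for z :: "'n cpath" using path_val[of z] by auto
    have cl: "closure (\<rat> \<inter> {0..1}) = {0..1::real}"
    proof -
      \<comment> \<open>Density of the rationals passes to open subsets, hence the detour through
        the open interval.\<close>
      have "closure (\<rat> \<inter> {0<..<1::real}) = closure {0<..<1}"
      proof -
        have "closure ({0<..<1::real} \<inter> \<rat>) = closure {0<..<1}"
          by (rule closure_open_Int_superset) (auto simp: Rats_closure_real)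
        then show ?thesis by (simp add: Int_commute)
      qed
      then have "{0..1} \<subseteq> closure (\<rat> \<inter> {0..1::real})"
        using closure_mono[of "\<rat> \<inter> {0<..<1::real}" "\<rat> \<inter> {0..1}"] by (simp add: Int_mono subset_eq)
      moreover have "closure (\<rat> \<inter> {0..1::real}) \<subseteq> {0..1}" by (rule closure_minimal) auto
      ultimately show ?thesis by blast
    qed
    show ?case
    proof (rule cpath_eqI)
      fix t :: real assume "t \<in> {0..1}"
      have "path_val (X w) t - path_val (Y w) t = 0"
        using continuous_constant_on_closure[of "\<rat> \<inter> {0..1}" "\<lambda>t. path_val (X w) t - path_val (Y w) t" 0 t]
          cl \<open>t \<in> {0..1}\<close> rat cont by (auto intro!: continuous_intros)
      then show "path_val (X w) t = path_val (Y w) t" by simp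
    qed
  qed
qed

section \<open>Centred Gaussian vectors with independent components\<close>

definition gauss_vec :: "real \<Rightarrow> (real ^ 'n::finite) measure" where
  "gauss_vec \<delta> = density lborel (\<lambda>x. ennreal (\<Prod>i\<in>UNIV. normal_density 0 (sqrt \<delta>) (x $ i)))"

lemma sets_gauss_vec [measurable_cong, simp]: "sets (gauss_vec \<delta>) = sets borel"
  and space_gauss_vec [simp]: "space (gauss_vec \<delta>) = UNIV"
  by (simp_all add: gauss_vec_def)

lemma nn_integral_lborel_prod_vec:
  fixes f :: "'n::finite \<Rightarrow> real \<Rightarrow> ennreal"
  assumes [measurable]: "\<And>i. f i \<in> borel_measurable borel"
  shows "(\<integral>\<^sup>+x. (\<Prod>i\<in>UNIV. f i (x $ i)) \<partial>(lborel :: (real ^ 'n) measure)) = (\<Prod>i\<in>UNIV. \<integral>\<^sup>+x. f i x \<partial>lborel)"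
proof -
  have inj: "inj (\<lambda>i. axis i (1::real) :: real ^ 'n)" by (auto simp: inj_def axis_eq_axis)
  have B: "(Basis :: (real ^ 'n) set) = range (\<lambda>i. axis i 1)" by (auto simp: Basis_vec_def)
  \<comment> \<open>The product formula for \<open>lborel\<close> is indexed by basis vectors;
    \<open>g\<close> recovers the coordinate to which a basis vector belongs.\<close>
  define g where "g b = f (THE i. b = axis i 1)" for b :: "real ^ 'n"
  have g: "g (axis i 1) = f i" for i
    using inj unfolding g_def by (auto simp: axis_eq_axis)
  have "(\<integral>\<^sup>+x. (\<Prod>b\<in>Basis. g b (x \<bullet> b)) \<partial>(lborel :: (real ^ 'n) measure)) = (\<Prod>b\<in>Basis. (\<integral>\<^sup>+x. g b x \<partial>lborel))"
    by (rule nn_integral_lborel_prod) (auto simp: B g)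
  then show ?thesis
    by (simp add: B prod.reindex[OF inj] o_def g inner_axis)
qed

lemma nn_integral_gauss_vec_prod:
  fixes f :: "'n::finite \<Rightarrow> real \<Rightarrow> ennreal"
  assumes [measurable]: "\<And>i. f i \<in> borel_measurable borel"
  shows "(\<integral>\<^sup>+x. (\<Prod>i\<in>UNIV. f i (x $ i)) \<partial>gauss_vec \<delta>)
    = (\<Prod>i\<in>UNIV. \<integral>\<^sup>+x. ennreal (normal_density 0 (sqrt \<delta>) x) * f i x \<partial>lborel)"
  unfolding gauss_vec_def
  by (subst nn_integral_density, simp, simp)
     (simp add: prod_ennreal[symmetric] prod.distrib[symmetric]
        nn_integral_lborel_prod_vec[of "\<lambda>i x. ennreal (normal_density 0 (sqrt \<delta>) x) * f i x"])

lemma nn_integral_normal_density: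
  "\<delta> > 0 \<Longrightarrow> (\<integral>\<^sup>+x. ennreal (normal_density 0 (sqrt \<delta>) x) \<partial>lborel) = 1"
  by (subst nn_integral_eq_integral) auto

lemma prob_space_gauss_vec:
  assumes "\<delta> > 0" shows "prob_space (gauss_vec \<delta> :: (real ^ 'n::finite) measure)"
proof
  have "emeasure (gauss_vec \<delta> :: (real ^ 'n) measure) UNIV = (\<integral>\<^sup>+x. (\<Prod>i\<in>UNIV. (\<lambda>_ _. 1) i (x $ i)) \<partial>(gauss_vec \<delta> :: (real ^ 'n) measure))"
    by simp
  also have "\<dots> = 1"
    using assms by (subst nn_integral_gauss_vec_prod) (auto simp: nn_integral_normal_density)
  finally show "emeasure (gauss_vec \<delta> :: (real ^ 'n) measure) (space (gauss_vec \<delta>)) = 1" by simp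
qed

text \<open>Everything follows from the mass of boxes: a single coordinate gives the normal
  marginal, hence mean and variance, and two coordinates give independence, hence the vanishing
  covariance.\<close>

lemma gauss_vec_moments:
  fixes i j :: "'n::finite"
  assumes \<delta>: "\<delta> > 0"
  shows "integrable (gauss_vec \<delta>) (\<lambda>x. x $ i)" "(\<integral>x. x $ i \<partial>gauss_vec \<delta>) = 0"
    "integrable (gauss_vec \<delta>) (\<lambda>x. x $ i * x $ j)"
    "(\<integral>x. x $ i * x $ j \<partial>gauss_vec \<delta>) = (if i = j then \<delta> else 0)"
proof -
  interpret prob_space "gauss_vec \<delta> :: (real ^ 'n) measure" using \<delta> by (rule prob_space_gauss_vec)
  let ?N = "\<lambda>x. ennreal (normal_density 0 (sqrt \<delta>) x)"
  \<comment> \<open>Coordinates outside \<open>K\<close> are left free and contribute total mass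
    1.\<close>
  have box: "emeasure (gauss_vec \<delta>) {x. \<forall>k\<in>K. x $ k \<in> A k} = (\<Prod>k\<in>K. \<integral>\<^sup>+x. ?N x * indicator (A k) x \<partial>lborel)"
    if [measurable]: "\<And>k. A k \<in> sets borel" for A and K :: "'n set"
  proof -
    have "emeasure (gauss_vec \<delta>) {x. \<forall>k\<in>K. x $ k \<in> A k}
      = (\<integral>\<^sup>+x. (\<Prod>k\<in>UNIV. (\<lambda>k y. if k \<in> K then indicator (A k) y else 1) k (x $ k)) \<partial>gauss_vec \<delta>)"
    proof (subst nn_integral_indicator[symmetric])
      show "{x. \<forall>k\<in>K. x $ k \<in> A k} \<in> sets (gauss_vec \<delta>)" by measurable
      show "(\<integral>\<^sup>+ x. indicator {x. \<forall>k\<in>K. x $ k \<in> A k} x \<partial>gauss_vec \<delta>) =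
        (\<integral>\<^sup>+ x. (\<Prod>k\<in>UNIV. (if k \<in> K then indicator (A k) (x $ k) else 1)) \<partial>gauss_vec \<delta>)"
        by (intro nn_integral_cong) (auto simp: indicator_def prod.If_cases prod_zero_iff)
    qed
    also have "\<dots> = (\<Prod>k\<in>UNIV. \<integral>\<^sup>+x. ?N x * (if k \<in> K then indicator (A k) x else 1) \<partial>lborel)"
      by (subst nn_integral_gauss_vec_prod) (auto simp: indicator_def)
    also have "\<dots> = (\<Prod>k\<in>UNIV. if k \<in> K then \<integral>\<^sup>+x. ?N x * indicator (A k) x \<partial>lborel else 1)"
      by (intro prod.cong) (auto simp: nn_integral_normal_density \<delta>)
    also have "\<dots> = (\<Prod>k\<in>K. \<integral>\<^sup>+x. ?N x * indicator (A k) x \<partial>lborel)"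
      by (simp add: prod.If_cases)
    finally show ?thesis .
  qed
  have one: "emeasure (gauss_vec \<delta>) {x. x $ k \<in> A} = (\<integral>\<^sup>+x. ?N x * indicator A x \<partial>lborel)"
    if "A \<in> sets borel" for A and k :: 'n
    using box[of "\<lambda>_. A" "{k}"] that by simp
  have dist: "distributed (gauss_vec \<delta>) lborel (\<lambda>x. x $ k) ?N" for k :: 'n
    unfolding distributed_def
  proof (intro conjI measure_eqI)
    fix A assume "A \<in> sets (distr (gauss_vec \<delta>) lborel (\<lambda>x. x $ k))"
    then have [measurable]: "A \<in> sets borel" by simp
    show "emeasure (distr (gauss_vec \<delta>) lborel (\<lambda>x. x $ k)) A = emeasure (density lborel ?N) A"
      using one[of A k] by (subst emeasure_distr; simp add: emeasure_density vimage_def)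
  qed auto
  show int1: "integrable (gauss_vec \<delta>) (\<lambda>x. x $ i)" for i :: 'n
    using dist[of i] normal_distributed_expectation[of "sqrt \<delta>" "\<lambda>x. x $ i" 0] \<delta>
    by (simp add: distributed_integrable[of "gauss_vec \<delta>" lborel "\<lambda>x. x $ i" "normal_density 0 (sqrt \<delta>)" "\<lambda>x. x", symmetric] integrable_normal_moment_nz_1)
  show ex0: "(\<integral>x. x $ i \<partial>gauss_vec \<delta>) = 0" for i :: 'n
    using dist[of i] normal_distributed_expectation[of "sqrt \<delta>" "\<lambda>x. x $ i" 0] \<delta> by simp
  have sq: "integrable (gauss_vec \<delta>) (\<lambda>x. (x $ i)\<^sup>2)" for i :: 'n
    using dist[of i] integrable_normal_moment[of "sqrt \<delta>" 0 2] \<delta>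
    by (subst distributed_integrable[of "gauss_vec \<delta>" lborel "\<lambda>x. x $ i" "normal_density 0 (sqrt \<delta>)" "\<lambda>x. x\<^sup>2", symmetric]) auto
  have ex2: "(\<integral>x. (x $ i)\<^sup>2 \<partial>gauss_vec \<delta>) = \<delta>" for i :: 'n
    using normal_distributed_variance[OF _ dist[of i]] \<delta> ex0[of i] by simp
  have "integrable (gauss_vec \<delta>) (\<lambda>x. x $ i * x $ j) \<and> (\<integral>x. x $ i * x $ j \<partial>gauss_vec \<delta>) = 0" if "i \<noteq> j"
  proof -
    have "indep_var borel (\<lambda>x. x $ i) borel (\<lambda>x. x $ j)"
      unfolding indep_var_distribution_eq
    proof (intro conjI pair_measure_eqI)
      show "sigma_finite_measure (distr (gauss_vec \<delta>) borel (\<lambda>x. x $ i))" "sigma_finite_measure (distr (gauss_vec \<delta>) borel (\<lambda>x. x $ j))"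
        by (auto intro!: prob_space_imp_sigma_finite prob_space_distr)
    next
      fix A B assume "A \<in> sets (distr (gauss_vec \<delta>) borel (\<lambda>x. x $ i))" "B \<in> sets (distr (gauss_vec \<delta>) borel (\<lambda>x. x $ j))"
      then have [measurable]: "A \<in> sets borel" "B \<in> sets borel" by auto
      show "emeasure (distr (gauss_vec \<delta>) borel (\<lambda>x. x $ i)) A * emeasure (distr (gauss_vec \<delta>) borel (\<lambda>x. x $ j)) B
        = emeasure (distr (gauss_vec \<delta>) (borel \<Otimes>\<^sub>M borel) (\<lambda>x. (x $ i, x $ j))) (A \<times> B)"
        using box[of "\<lambda>k. if k = j then B else A" "{i, j}"] one[of A i] one[of B j] that
        by (simp add: emeasure_distr vimage_def mem_Times_iff del: Times_eq_image_sum)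
    qed simp_all
    from indep_var_integrable[OF this int1 int1] indep_var_lebesgue_integral[OF this int1 int1]
    show ?thesis by (simp add: ex0)
  qed
  with sq[of i] ex2[of i] show "integrable (gauss_vec \<delta>) (\<lambda>x. x $ i * x $ j)"
    "(\<integral>x. x $ i * x $ j \<partial>gauss_vec \<delta>) = (if i = j then \<delta> else 0)"
    by (cases "i = j"; simp add: power2_eq_square)+
qed

subsection \<open>The Ito isometry\<close>

lemma prob_space_unit_time: "prob_space unit_time"
  by standard (simp add: unit_time_def emeasure_restrict_space)

interpretation unit_time: prob_space unit_time
  by (rule prob_space_unit_time)

lemma space_unit_time [simp]: "space unit_time = {0..1}"
  by (simp add: unit_time_def space_restrict_space)

lemma sets_unit_time [measurable_cong]: "sets unit_time = sets (restrict_space borel {0..1})"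
  by (simp add: unit_time_def sets_restrict_space)

lemma measurable_unit_time_borel: "f \<in> borel \<rightarrow>\<^sub>M N \<Longrightarrow> f \<in> unit_time \<rightarrow>\<^sub>M N"
  by (auto simp: unit_time_def intro: measurable_restrict_space1)

lemma borel_measurable_vec_nth [measurable (raw)]:
  fixes f :: "'a \<Rightarrow> real ^ 'n::finite"
  assumes "f \<in> borel_measurable M" shows "(\<lambda>x. f x $ i) \<in> borel_measurable M"
  by (rule measurable_compose[OF assms borel_measurable_continuous_onI]) (intro continuous_intros)

lemma indicator_measurable_unit_time [measurable]:
  "S \<in> sets borel \<Longrightarrow> (indicator S :: real \<Rightarrow> real) \<in> borel_measurable unit_time"
  by (rule measurable_unit_time_borel) simp

lemma integral_indicator_unit_time:
  assumes "0 \<le> a" "a \<le> b" "b \<le> 1"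
  shows "(\<integral>t. indicator {a<..b} t \<partial>unit_time) = b - a"
proof -
  have ab: "{a<..b} \<inter> {0..1} = {a<..b}" using assms by auto
  then have "{a<..b} \<in> sets unit_time" by (auto simp: sets_unit_time sets_restrict_space intro!: image_eqI)
  then have "(\<integral>t. indicator {a<..b} t \<partial>unit_time) = measure unit_time {a<..b}" using ab by simp
  also have "\<dots> = b - a"
    using assms ab by (subst unit_time_def, subst measure_restrict_space) auto
  finally show ?thesis .
qed

text \<open>Simple processes live on intervals that are open on the left and so miss time 0, which
  has to be discarded before they are compared with a density.\<close>

lemma AE_unit_time_pos: "AE t in unit_time. 0 < t \<and> t \<le> 1"
proof -
  have "AE t in lborel. t \<noteq> (0 :: real)" by (rule AE_lborel_singleton)
  then have "AE t in unit_time. t \<noteq> 0" unfolding unit_time_def by (auto simp: AE_restrict_space_iff)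
  then show ?thesis using AE_space by eventually_elim auto
qed

text \<open>The measure and the process are parameters because two instances with the same
  filtration are needed: \<open>\<beta>\<close> under \<open>\<nu>\<close>, and
  \<open>\<beta> + u\<close> under the Girsanov measure of \<open>u\<close>. The axiom
  \<open>incr\<close> says at once that increments are Gaussian and independent of the past.\<close>

locale gauss_increments = prob_space M for M :: "'a measure" +
  fixes F :: "real \<Rightarrow> 'a measure" and B :: "real \<Rightarrow> 'a \<Rightarrow> real ^ 'n::finite"
  assumes sub: "t \<in> {0..1} \<Longrightarrow> subalgebra M (F t)"
    and mono: "0 \<le> s \<Longrightarrow> s \<le> t \<Longrightarrow> t \<le> 1 \<Longrightarrow> sets (F s) \<subseteq> sets (F t)"
    and adapted: "t \<in> {0..1} \<Longrightarrow> B t \<in> borel_measurable (F t)"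
    and incr: "0 \<le> s \<Longrightarrow> s < t \<Longrightarrow> t \<le> 1 \<Longrightarrow> A \<in> sets (F s) \<Longrightarrow> D \<in> sets borel \<Longrightarrow>
      emeasure M (A \<inter> {w \<in> space M. B t w - B s w \<in> D}) = emeasure M A * emeasure (gauss_vec (t - s)) D"
begin

lemma measurable_F_mono:
  "0 \<le> s \<Longrightarrow> s \<le> t \<Longrightarrow> t \<le> 1 \<Longrightarrow> f \<in> F s \<rightarrow>\<^sub>M N \<Longrightarrow> f \<in> F t \<rightarrow>\<^sub>M N"
  using mono[of s t] sub[of s] sub[of t] by (auto simp: measurable_def subalgebra_def)

lemma measurable_F_M: "t \<in> {0..1} \<Longrightarrow> f \<in> F t \<rightarrow>\<^sub>M N \<Longrightarrow> f \<in> M \<rightarrow>\<^sub>M N"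
  using sub[of t] by (auto simp: measurable_def subalgebra_def)

lemma incr_measurable: "s \<in> {0..1} \<Longrightarrow> t \<in> {0..1} \<Longrightarrow> (\<lambda>w. B t w - B s w) \<in> borel_measurable M"
  using measurable_F_M[OF _ adapted, of s] measurable_F_M[OF _ adapted, of t] by simp

text \<open>The identity is regarded as a random variable with values in \<open>F s\<close>, so that
  this product law covers every functional depending jointly on the past and on the
  increment.\<close>

lemma distr_incr:
  assumes st: "0 \<le> s" "s < t" "t \<le> 1"
  shows "restr_to_subalg M (F s) \<Otimes>\<^sub>M gauss_vec (t - s) = distr M (F s \<Otimes>\<^sub>M borel) (\<lambda>w. (w, B t w - B s w))"
proof (rule pair_measure_eqI)
  have S: "subalgebra M (F s)" and sp: "space (F s) = space M" using st sub by (auto simp: subalgebra_def)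
  note S[measurable]
  have [measurable]: "(\<lambda>w. w) \<in> M \<rightarrow>\<^sub>M F s" by (rule measurable_from_subalg[OF S]) simp
  have [measurable]: "(\<lambda>w. B t w - B s w) \<in> borel_measurable M" using st by (intro incr_measurable) auto
  show "sigma_finite_measure (restr_to_subalg M (F s))"
    by (rule prob_space_imp_sigma_finite[OF prob_space_restr_to_subalg[OF S]]) (rule prob_space_axioms)
  show "sigma_finite_measure (gauss_vec (t - s) :: (real ^ 'n) measure)"
    using st by (intro prob_space_imp_sigma_finite prob_space_gauss_vec) simp
  show "sets (restr_to_subalg M (F s) \<Otimes>\<^sub>M gauss_vec (t - s)) = sets (distr M (F s \<Otimes>\<^sub>M borel) (\<lambda>w. (w, B t w - B s w)))"
    by (simp cong: sets_pair_measure_cong add: sets_restr_to_subalg[OF S])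
  fix A :: "'a set" and D :: "(real ^ 'n) set"
  assume "A \<in> sets (restr_to_subalg M (F s))" "D \<in> sets (gauss_vec (t - s))"
  then have AD: "A \<in> sets (F s)" "D \<in> sets borel" by (auto simp: sets_restr_to_subalg[OF S])
  then have "emeasure (distr M (F s \<Otimes>\<^sub>M borel) (\<lambda>w. (w, B t w - B s w))) (A \<times> D)
    = emeasure M (A \<inter> {w \<in> space M. B t w - B s w \<in> D})"
    using sets.sets_into_space[OF AD(1)] sp by (subst emeasure_distr) (auto intro!: arg_cong[where f="emeasure M"])
  then show "emeasure (restr_to_subalg M (F s)) A * emeasure (gauss_vec (t - s)) D
    = emeasure (distr M (F s \<Otimes>\<^sub>M borel) (\<lambda>w. (w, B t w - B s w))) (A \<times> D)"
    using AD incr[OF st AD] by (simp add: emeasure_restr_to_subalg[OF S])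
qed

text \<open>Freezing: by the product law, the past may be held fixed while the increment is
  integrated out.\<close>

lemma nn_integral_incr:
  assumes st: "0 \<le> s" "s < t" "t \<le> 1"
    and \<phi> [measurable]: "(\<lambda>(w, y). \<phi> w y) \<in> borel_measurable (F s \<Otimes>\<^sub>M borel)"
  shows "(\<integral>\<^sup>+w. \<phi> w (B t w - B s w) \<partial>M) = (\<integral>\<^sup>+w. \<integral>\<^sup>+y. \<phi> w y \<partial>gauss_vec (t - s) \<partial>M)"
proof -
  have S: "subalgebra M (F s)" using st sub by auto
  have [measurable]: "(\<lambda>w. w) \<in> M \<rightarrow>\<^sub>M F s" by (rule measurable_from_subalg[OF S]) simp
  have [measurable]: "(\<lambda>w. B t w - B s w) \<in> borel_measurable M" using st by (intro incr_measurable) auto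
  interpret G: prob_space "gauss_vec (t - s) :: (real ^ 'n) measure" using st by (intro prob_space_gauss_vec) simp
  have "(\<integral>\<^sup>+w. \<phi> w (B t w - B s w) \<partial>M) = (\<integral>\<^sup>+(w, y). \<phi> w y \<partial>distr M (F s \<Otimes>\<^sub>M borel) (\<lambda>w. (w, B t w - B s w)))"
    by (subst nn_integral_distr) auto
  also have "\<dots> = (\<integral>\<^sup>+(w, y). \<phi> w y \<partial>(restr_to_subalg M (F s) \<Otimes>\<^sub>M gauss_vec (t - s)))"
    by (simp add: distr_incr[OF st])
  also have "\<dots> = (\<integral>\<^sup>+w. \<integral>\<^sup>+y. \<phi> w y \<partial>gauss_vec (t - s) \<partial>restr_to_subalg M (F s))"
    by (subst G.nn_integral_fst[symmetric]) (auto simp: sets_restr_to_subalg[OF S] cong: measurable_cong_sets)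
  also have "\<dots> = (\<integral>\<^sup>+w. \<integral>\<^sup>+y. \<phi> w y \<partial>gauss_vec (t - s) \<partial>M)"
    by (rule nn_integral_subalgebra2[OF S]) measurable
  finally show ?thesis .
qed

text \<open>Signed counterpart for products, which the covariance computations behind the isometry
  require; integrability comes out of independence.\<close>

lemma expectation_incr:
  fixes h :: "real ^ 'n \<Rightarrow> real"
  assumes st: "0 \<le> s" "s < t" "t \<le> 1"
    and X [measurable]: "X \<in> borel_measurable (F s)" "integrable M X"
    and h: "integrable (gauss_vec (t - s)) h"
  shows "integrable M (\<lambda>w. X w * h (B t w - B s w))"
    "(\<integral>w. X w * h (B t w - B s w) \<partial>M) = (\<integral>w. X w \<partial>M) * (\<integral>y. h y \<partial>gauss_vec (t - s))"
proof -
  have S: "subalgebra M (F s)" using st sub by auto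
  have [measurable]: "(\<lambda>w. w) \<in> M \<rightarrow>\<^sub>M F s" by (rule measurable_from_subalg[OF S]) simp
  have [measurable]: "(\<lambda>w. B t w - B s w) \<in> borel_measurable M" using st by (intro incr_measurable) auto
  have [measurable]: "h \<in> borel_measurable borel" using h by (auto dest: borel_measurable_integrable)
  interpret G: prob_space "gauss_vec (t - s) :: (real ^ 'n) measure" using st by (intro prob_space_gauss_vec) simp
  have d: "distr M borel (\<lambda>w. B t w - B s w) = gauss_vec (t - s)"
  proof (rule measure_eqI)
    fix D assume "D \<in> sets (distr M borel (\<lambda>w. B t w - B s w))"
    moreover have "space M \<in> sets (F s)" using S by (metis sets.top subalgebra_def)
    moreover have "(\<lambda>w. B t w - B s w) -` D \<inter> space M = space M \<inter> {w \<in> space M. B t w - B s w \<in> D}" by auto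
    ultimately show "emeasure (distr M borel (\<lambda>w. B t w - B s w)) D = emeasure (gauss_vec (t - s)) D"
      using incr[OF st, of "space M" D] by (simp add: emeasure_distr emeasure_space_1)
  qed simp
  have XM [measurable]: "X \<in> borel_measurable M" using X(2) by auto
  have i: "indep_var borel X borel (\<lambda>w. h (B t w - B s w))"
    unfolding indep_var_distribution_eq
  proof (intro conjI pair_measure_eqI)
    show "sigma_finite_measure (distr M borel X)" "sigma_finite_measure (distr M borel (\<lambda>w. h (B t w - B s w)))"
      by (auto intro!: prob_space_imp_sigma_finite prob_space_distr)
    fix A D assume "A \<in> sets (distr M borel X)" "D \<in> sets (distr M borel (\<lambda>w. h (B t w - B s w)))"
    then have AD [measurable]: "A \<in> sets borel" "D \<in> sets borel" by auto
    have sp: "space (F s) = space M" using S by (simp add: subalgebra_def)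
    let ?A = "X -` A \<inter> space M" and ?D = "h -` D"
    have AF: "?A \<in> sets (F s)" using measurable_sets[OF X(1) AD(1)] sp by simp
    have DB: "?D \<in> sets borel" using measurable_sets[OF _ AD(2), of h borel] by simp
    have eX: "emeasure (distr M borel X) A = emeasure M ?A" by (simp add: emeasure_distr)
    have eh: "emeasure (distr M borel (\<lambda>w. h (B t w - B s w))) D = emeasure (gauss_vec (t - s)) ?D"
      using DB by (simp add: d[symmetric] emeasure_distr vimage_def)
    have eXh: "emeasure (distr M (borel \<Otimes>\<^sub>M borel) (\<lambda>x. (X x, h (B t x - B s x)))) (A \<times> D)
      = emeasure M (?A \<inter> {w \<in> space M. B t w - B s w \<in> ?D})"
      by (subst emeasure_distr) (auto intro!: arg_cong[where f="emeasure M"])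
    show "emeasure (distr M borel X) A * emeasure (distr M borel (\<lambda>w. h (B t w - B s w))) D
      = emeasure (distr M (borel \<Otimes>\<^sub>M borel) (\<lambda>x. (X x, h (B t x - B s x)))) (A \<times> D)"
      using incr[OF st AF DB] by (simp add: eX eh eXh)
  qed simp_all
  have hi: "integrable M (\<lambda>w. h (B t w - B s w))" "(\<integral>w. h (B t w - B s w) \<partial>M) = (\<integral>y. h y \<partial>gauss_vec (t - s))"
    using h by (auto simp: d[symmetric] integrable_distr_eq integral_distr)
  show "integrable M (\<lambda>w. X w * h (B t w - B s w))" by (rule indep_var_integrable[OF i X(2) hi(1)])
  show "(\<integral>w. X w * h (B t w - B s w) \<partial>M) = (\<integral>w. X w \<partial>M) * (\<integral>y. h y \<partial>gauss_vec (t - s))"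
    using indep_var_lebesgue_integral[OF i X(2) hi(1)] hi(2) by simp
qed

text \<open>The polarised Ito isometry for one pair of integrands with candidate integrals.
  Integrability is part of the relation, so that it is closed under sums in each argument with no
  side conditions.\<close>

definition pairing :: "('a \<Rightarrow> real \<Rightarrow> real ^ 'n) \<Rightarrow> ('a \<Rightarrow> real) \<Rightarrow> ('a \<Rightarrow> real \<Rightarrow> real ^ 'n) \<Rightarrow> ('a \<Rightarrow> real) \<Rightarrow> bool" where
  "pairing X J Y K \<longleftrightarrow> integrable M (\<lambda>w. J w * K w) \<and>
     integrable (M \<Otimes>\<^sub>M unit_time) (\<lambda>(w, t). X w t \<bullet> Y w t) \<and>
     (\<integral>w. J w * K w \<partial>M) = (\<integral>(w, t). X w t \<bullet> Y w t \<partial>(M \<Otimes>\<^sub>M unit_time))"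

lemma pairing_sym: "pairing X J Y K \<Longrightarrow> pairing Y K X J"
  unfolding pairing_def by (simp add: inner_commute mult.commute)

lemma pairing_add:
  "pairing X J Y K \<Longrightarrow> pairing X' J' Y K \<Longrightarrow> pairing (\<lambda>w t. X w t + X' w t) (\<lambda>w. J w + J' w) Y K"
  unfolding pairing_def case_prod_beta by (simp add: inner_add_left distrib_right)

definition step_process :: "real \<Rightarrow> real \<Rightarrow> ('a \<Rightarrow> real ^ 'n) \<Rightarrow> 'a \<Rightarrow> real \<Rightarrow> real ^ 'n" where
  "step_process a b \<xi> w t = indicator {a<..b} t *\<^sub>R \<xi> w"
definition step_integral :: "real \<Rightarrow> real \<Rightarrow> ('a \<Rightarrow> real ^ 'n) \<Rightarrow> 'a \<Rightarrow> real" where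
  "step_integral a b \<xi> w = \<xi> w \<bullet> (B b w - B a w)"

lemma step_split:
  assumes "a \<le> c" "c \<le> b"
  shows "step_process a b \<xi> = (\<lambda>w t. step_process a c \<xi> w t + step_process c b \<xi> w t)"
    "step_integral a b \<xi> = (\<lambda>w. step_integral a c \<xi> w + step_integral c b \<xi> w)"
  using assms by (auto simp: step_process_def step_integral_def fun_eq_iff indicator_def inner_diff_right)

lemma bounded_integrable:
  assumes "\<xi> \<in> borel_measurable M" "bounded (range \<xi>)" shows "integrable M (\<xi> :: 'a \<Rightarrow> 'c::{banach, second_countable_topology})"
proof -
  obtain C where "\<And>w. norm (\<xi> w) \<le> C" using assms(2) by (auto simp: bounded_iff)
  then show ?thesis using assms(1) by (intro integrable_const_bound[where B=C]) auto
qed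

lemma step_integral_sum: "step_integral a b \<xi> w = (\<Sum>i\<in>UNIV. \<xi> w $ i * (B b w - B a w) $ i)"
  by (simp add: step_integral_def inner_vec_def)

lemma integrable_step_integral:
  assumes ab: "0 \<le> a" "a \<le> b" "b \<le> 1" and \<xi>: "\<xi> \<in> borel_measurable (F a)" "bounded (range \<xi>)"
  shows "integrable M (step_integral a b \<xi>)"
proof (cases "a = b")
  case False
  have [measurable]: "\<xi> \<in> borel_measurable (F a)" "\<xi> \<in> borel_measurable M"
    using \<xi> measurable_F_M[of a] ab by auto
  have "bounded (range (\<lambda>w. \<xi> w $ i))" for i
    using bounded_linear_image[OF \<xi>(2) bounded_linear_vec_nth[of i]] by (simp add: image_image)
  then have "integrable M (\<lambda>w. \<xi> w $ i * (B b w - B a w) $ i)" for i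
    using ab False
    by (intro expectation_incr bounded_integrable gauss_vec_moments) auto
  then show ?thesis unfolding step_integral_sum[abs_def] by (intro Bochner_Integration.integrable_sum) auto
qed (simp add: step_integral_def[abs_def])

text \<open>The integrands never overlap, and the later increment has mean zero and is independent
  of everything known at its left end \<open>c\<close>, the earlier integral included; both sides
  vanish.\<close>

lemma pairing_disjoint:
  assumes ab: "0 \<le> a" "a \<le> b" "b \<le> c" "c \<le> d" "d \<le> 1"
    and \<xi>: "\<xi> \<in> borel_measurable (F a)" "bounded (range \<xi>)"
    and \<eta>: "\<eta> \<in> borel_measurable (F c)" "bounded (range \<eta>)"
  shows "pairing (step_process a b \<xi>) (step_integral a b \<xi>) (step_process c d \<eta>) (step_integral c d \<eta>)"
proof -
  have X: "step_process a b \<xi> w t \<bullet> step_process c d \<eta> w t = 0" for w t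
    using ab by (auto simp: step_process_def indicator_def)
  have "integrable M (\<lambda>w. step_integral a b \<xi> w * step_integral c d \<eta> w) \<and> (\<integral>w. step_integral a b \<xi> w * step_integral c d \<eta> w \<partial>M) = 0"
  proof (cases "c = d")
    case False
    have [measurable]: "\<xi> \<in> borel_measurable (F c)" "B a \<in> borel_measurable (F c)" "B b \<in> borel_measurable (F c)" "\<eta> \<in> borel_measurable (F c)"
      using ab \<xi> \<eta> measurable_F_mono[OF _ _ _ \<xi>(1), of c] measurable_F_mono[OF _ _ _ adapted, of a c] measurable_F_mono[OF _ _ _ adapted, of b c] by auto
    obtain C where C: "\<And>w. norm (\<eta> w) \<le> C" using \<eta>(2) by (auto simp: bounded_iff)
    have J[measurable]: "step_integral a b \<xi> \<in> borel_measurable (F c)" unfolding step_integral_def by measurable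
    have [measurable]: "step_integral a b \<xi> \<in> borel_measurable M" "\<eta> \<in> borel_measurable M"
      using ab by (auto intro: measurable_F_M[of c])
    have m: "(\<lambda>w. step_integral a b \<xi> w * \<eta> w $ j) \<in> borel_measurable (F c)" for j by measurable
    have mM: "(\<lambda>w. step_integral a b \<xi> w * \<eta> w $ j) \<in> borel_measurable M" for j
      using ab m by (auto intro: measurable_F_M[of c])
    have int: "integrable M (\<lambda>w. step_integral a b \<xi> w * \<eta> w $ j)" for j
    proof (rule Bochner_Integration.integrable_bound)
      show "integrable M (\<lambda>w. step_integral a b \<xi> w * C)" using integrable_step_integral[OF ab(1,2) _ \<xi>] ab by simp
      show "AE w in M. norm (step_integral a b \<xi> w * \<eta> w $ j) \<le> norm (step_integral a b \<xi> w * C)"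
        using order_trans[OF order_trans[OF component_le_norm_cart C] abs_ge_self] by (auto simp: abs_mult intro!: mult_left_mono)
    qed (rule mM)
    have s: "step_integral a b \<xi> w * step_integral c d \<eta> w = (\<Sum>j\<in>UNIV. (step_integral a b \<xi> w * \<eta> w $ j) * (B d w - B c w) $ j)" for w
      unfolding step_integral_sum[of c] by (simp add: sum_distrib_left mult.assoc)
    have "0 \<le> c" "c < d" "d \<le> 1" using ab False by auto
    note ex = expectation_incr[OF this m int]
    have "0 < d - c" using ab False by simp
    note mo = gauss_vec_moments[OF this]
    have 1: "integrable M (\<lambda>w. (step_integral a b \<xi> w * \<eta> w $ j) * (B d w - B c w) $ j)" for j
      by (rule ex(1)[OF mo(1)])
    have 2: "(\<integral>w. (step_integral a b \<xi> w * \<eta> w $ j) * (B d w - B c w) $ j \<partial>M) = 0" for j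
      using ex(2)[OF mo(1), of j j] mo(2)[of j] by simp
    show ?thesis unfolding s using 1 2
      by (simp add: Bochner_Integration.integral_sum del: vector_minus_component)
  qed (simp add: step_integral_def)
  then show ?thesis unfolding pairing_def case_prod_beta by (simp add: X)
qed

text \<open>Both sides reduce to the expectation of \<open>\<xi> w \<bullet> \<eta> w\<close> times
  \<open>b - a\<close>: the components of the increment are uncorrelated with variance
  \<open>b - a\<close>, and the increment is independent of \<open>F a\<close>.\<close>

lemma pairing_same:
  assumes ab: "0 \<le> a" "a \<le> b" "b \<le> 1"
    and \<xi>: "\<xi> \<in> borel_measurable (F a)" "bounded (range \<xi>)"
    and \<eta>: "\<eta> \<in> borel_measurable (F a)" "bounded (range \<eta>)"
  shows "pairing (step_process a b \<xi>) (step_integral a b \<xi>) (step_process a b \<eta>) (step_integral a b \<eta>)"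
proof (cases "a = b")
  case True then show ?thesis unfolding pairing_def case_prod_beta by (simp add: step_process_def step_integral_def)
next
  case False
  then have ab': "0 \<le> a" "a < b" "b \<le> 1" using ab by auto
  have [measurable]: "\<xi> \<in> borel_measurable M" "\<eta> \<in> borel_measurable M"
    using measurable_F_M[of a] ab \<xi> \<eta> by auto
  note \<xi>(1)[measurable] \<eta>(1)[measurable]
  obtain C D where C: "\<And>w. norm (\<xi> w) \<le> C" and D: "\<And>w. norm (\<eta> w) \<le> D" using \<xi>(2) \<eta>(2) by (auto simp: bounded_iff)
  have C0: "0 \<le> C" using order_trans[OF norm_ge_zero C] by blast
  have int: "integrable M (\<lambda>w. \<xi> w $ i * \<eta> w $ j)" for i j
    using order_trans[OF component_le_norm_cart C] order_trans[OF component_le_norm_cart D] C0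
    by (intro integrable_const_bound[where B="C * D"]) (auto simp: abs_mult intro!: mult_mono)
  have inti: "integrable M (\<lambda>w. \<xi> w \<bullet> \<eta> w)" unfolding inner_vec_def using int by simp
  have m: "(\<lambda>w. \<xi> w $ i * \<eta> w $ j) \<in> borel_measurable (F a)" for i j by measurable
  note ex = expectation_incr[OF ab' m int]
  have s: "step_integral a b \<xi> w * step_integral a b \<eta> w
      = (\<Sum>i\<in>UNIV. \<Sum>j\<in>UNIV. (\<xi> w $ i * \<eta> w $ j) * ((B b w - B a w) $ i * (B b w - B a w) $ j))" for w
    unfolding step_integral_sum sum_product by (simp only: mult_ac)
  have "0 < b - a" using ab' by simp
  note mo = gauss_vec_moments[OF this]
  have exI: "integrable M (\<lambda>w. (\<xi> w $ i * \<eta> w $ j) * ((B b w - B a w) $ i * (B b w - B a w) $ j))" for i j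
    by (rule ex(1)[OF mo(3)])
  have exE: "(\<integral>w. (\<xi> w $ i * \<eta> w $ j) * ((B b w - B a w) $ i * (B b w - B a w) $ j) \<partial>M)
    = (\<integral>w. \<xi> w $ i * \<eta> w $ j \<partial>M) * (if i = j then b - a else 0)" for i j
    using ex(2)[OF mo(3), of i j i j] mo(4)[of i j] by (simp del: vector_minus_component)
  have J: "integrable M (\<lambda>w. step_integral a b \<xi> w * step_integral a b \<eta> w)"
    unfolding s by (intro Bochner_Integration.integrable_sum exI)
  have "(\<integral>w. step_integral a b \<xi> w * step_integral a b \<eta> w \<partial>M)
    = (\<Sum>i\<in>UNIV. \<Sum>j\<in>UNIV. (\<integral>w. \<xi> w $ i * \<eta> w $ j \<partial>M) * (if i = j then b - a else 0))"
    unfolding s using exI exE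
    by (simp add: Bochner_Integration.integral_sum del: vector_minus_component)
  also have "\<dots> = (\<integral>w. \<xi> w \<bullet> \<eta> w \<partial>M) * (b - a)"
    unfolding inner_vec_def inner_real_def
    by (subst Bochner_Integration.integral_sum) (auto simp: int sum_distrib_right if_distrib cong: if_cong)
  finally have Je: "(\<integral>w. step_integral a b \<xi> w * step_integral a b \<eta> w \<partial>M) = (\<integral>w. \<xi> w \<bullet> \<eta> w \<partial>M) * (b - a)" .
  interpret MT: pair_prob_space M unit_time ..
  have e: "(\<lambda>(w, t). step_process a b \<xi> w t \<bullet> step_process a b \<eta> w t) = (\<lambda>(w, t). (\<xi> w \<bullet> \<eta> w) * indicator {a<..b} t)"
    by (auto simp: step_process_def fun_eq_iff indicator_def)
  have I: "integrable (M \<Otimes>\<^sub>M unit_time) (\<lambda>(w, t). (\<xi> w \<bullet> \<eta> w) * indicator {a<..b} t)"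
  proof (rule MT.integrable_const_bound[where B="C * D"])
    have "norm (\<xi> w \<bullet> \<eta> w) \<le> C * D" for w
      using Cauchy_Schwarz_ineq2[of "\<xi> w" "\<eta> w"] mult_mono[OF C[of w] D[of w] C0 norm_ge_zero] by simp
    moreover have "0 \<le> C * D" using C0 order_trans[OF norm_ge_zero D] by simp
    ultimately show "AE x in M \<Otimes>\<^sub>M unit_time. norm (case x of (w, t) \<Rightarrow> (\<xi> w \<bullet> \<eta> w) * indicator {a<..b} t) \<le> C * D"
      by (auto simp: indicator_def)
  qed measurable
  have "(\<integral>(w, t). (\<xi> w \<bullet> \<eta> w) * indicator {a<..b} t \<partial>(M \<Otimes>\<^sub>M unit_time))
    = (\<integral>w. \<integral>t. (\<xi> w \<bullet> \<eta> w) * indicator {a<..b} t \<partial>unit_time \<partial>M)"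
    using MT.integral_fst'[OF I] by simp
  also have "\<dots> = (\<integral>w. \<xi> w \<bullet> \<eta> w \<partial>M) * (b - a)"
    by (simp add: integral_indicator_unit_time[OF ab] del: Bochner_Integration.integral_indicator)
  finally show ?thesis unfolding pairing_def e using I J Je by simp
qed

lemma pairing_step_start:
  assumes ab: "0 \<le> a" "a \<le> b" "b \<le> 1" "a \<le> d" "d \<le> 1"
    and \<xi>: "\<xi> \<in> borel_measurable (F a)" "bounded (range \<xi>)"
    and \<eta>: "\<eta> \<in> borel_measurable (F a)" "bounded (range \<eta>)"
  shows "pairing (step_process a b \<xi>) (step_integral a b \<xi>) (step_process a d \<eta>) (step_integral a d \<eta>)"
proof -
  have *: "pairing (step_process a b \<xi>) (step_integral a b \<xi>) (step_process a d \<eta>) (step_integral a d \<eta>)"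
    if "0 \<le> a" "a \<le> b" "b \<le> d" "d \<le> 1"
      "\<xi> \<in> borel_measurable (F a)" "bounded (range \<xi>)" "\<eta> \<in> borel_measurable (F a)" "bounded (range \<eta>)"
    for \<xi> \<eta> :: "'a \<Rightarrow> real ^ 'n" and b d
    unfolding step_split[OF that(2,3)] using that
    by (intro pairing_sym[OF pairing_add] pairing_sym[OF pairing_disjoint] pairing_same)
      (auto intro: measurable_F_mono[of a b])
  show ?thesis
  proof (cases "b \<le> d")
    case True then show ?thesis using assms by (intro *)
  next
    case False then show ?thesis using assms by (intro pairing_sym[OF *]) auto
  qed
qed

text \<open>Up to symmetry \<open>a \<le> c\<close>. If the intervals overlap, the first one is cut
  at \<open>c\<close>: the piece before \<open>c\<close> is disjoint from the second interval, and
  the piece after \<open>c\<close> has the same left end as the second, with \<open>\<xi>\<close>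
  still measurable at that later time.\<close>

lemma pairing_step:
  assumes ab: "0 \<le> a" "a \<le> b" "b \<le> 1" "0 \<le> c" "c \<le> d" "d \<le> 1"
    and \<xi>: "\<xi> \<in> borel_measurable (F a)" "bounded (range \<xi>)"
    and \<eta>: "\<eta> \<in> borel_measurable (F c)" "bounded (range \<eta>)"
  shows "pairing (step_process a b \<xi>) (step_integral a b \<xi>) (step_process c d \<eta>) (step_integral c d \<eta>)"
proof -
  have *: "pairing (step_process a b \<xi>) (step_integral a b \<xi>) (step_process c d \<eta>) (step_integral c d \<eta>)"
    if h: "0 \<le> a" "a \<le> b" "b \<le> 1" "a \<le> c" "c \<le> d" "d \<le> 1"
      "\<xi> \<in> borel_measurable (F a)" "bounded (range \<xi>)" "\<eta> \<in> borel_measurable (F c)" "bounded (range \<eta>)"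
    for \<xi> \<eta> :: "'a \<Rightarrow> real ^ 'n" and a b c d
  proof (cases "b \<le> c")
    case True then show ?thesis using h by (intro pairing_disjoint) auto
  next
    case False
    then have s: "a \<le> c" "c \<le> b" using h by auto
    show ?thesis unfolding step_split[OF s] using h s
      by (intro pairing_add pairing_disjoint pairing_step_start) (auto intro: measurable_F_mono[of a c])
  qed
  show ?thesis
  proof (cases "a \<le> c")
    case True then show ?thesis using assms by (intro *)
  next
    case False then show ?thesis using assms by (intro pairing_sym[OF *]) auto
  qed
qed

text \<open>A relation between integrand and integral rather than a function of the integrand: no
  independence of the representation has to be shown, and sums over different partitions need no
  common refinement.\<close>

inductive pre_ito :: "('a \<Rightarrow> real \<Rightarrow> real ^ 'n) \<Rightarrow> ('a \<Rightarrow> real) \<Rightarrow> bool" where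
  elem: "0 \<le> a \<Longrightarrow> a \<le> b \<Longrightarrow> b \<le> 1 \<Longrightarrow> \<xi> \<in> borel_measurable (F a) \<Longrightarrow> bounded (range \<xi>) \<Longrightarrow>
    pre_ito (step_process a b \<xi>) (step_integral a b \<xi>)"
| add: "pre_ito X J \<Longrightarrow> pre_ito Y K \<Longrightarrow> pre_ito (\<lambda>w t. X w t + Y w t) (\<lambda>w. J w + K w)"

lemma pre_ito_pairing:
  assumes "pre_ito X J" "pre_ito Y K"
  shows "pairing X J Y K"
  using assms
proof (induction)
  case (elem a b \<xi>)
  note e = elem(1-5)
  from \<open>pre_ito Y K\<close> show ?case
  proof (induction)
    case (elem c d \<eta>) then show ?case using e by (intro pairing_step)
  next
    case (add X J Y K)
    then show ?case using pairing_sym[OF pairing_add[OF pairing_sym pairing_sym]] by blast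
  qed
qed (intro pairing_add)

lemma pre_ito_uminus: "pre_ito X J \<Longrightarrow> pre_ito (\<lambda>w t. - X w t) (\<lambda>w. - J w)"
proof (induction rule: pre_ito.induct)
  case (elem a b \<xi>)
  have "pre_ito (step_process a b (\<lambda>w. - \<xi> w)) (step_integral a b (\<lambda>w. - \<xi> w))"
    using elem by (intro pre_ito.elem) (auto simp: bounded_iff)
  then show ?case by (simp add: step_process_def[abs_def] step_integral_def[abs_def])
next
  case (add X J Y K) then show ?case using pre_ito.add[of "\<lambda>w t. - X w t" "\<lambda>w. - J w" "\<lambda>w t. - Y w t" "\<lambda>w. - K w"] by simp
qed

lemma pre_ito_diff: "pre_ito X J \<Longrightarrow> pre_ito Y K \<Longrightarrow> pre_ito (\<lambda>w t. X w t - Y w t) (\<lambda>w. J w - K w)"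
  using pre_ito.add[OF _ pre_ito_uminus, of X J Y K] by simp

lemma pre_ito_zero: "pre_ito (\<lambda>w t. 0) (\<lambda>w. 0)"
  using pre_ito.elem[of 0 0 "\<lambda>_. 0"] by (simp add: step_process_def[abs_def] step_integral_def[abs_def])

lemma pre_ito_measurable:
  assumes "pre_ito X J"
  shows "J \<in> borel_measurable M" "(\<lambda>(w, t). X w t) \<in> borel_measurable (M \<Otimes>\<^sub>M unit_time)"
proof -
  have "J \<in> borel_measurable M \<and> (\<lambda>(w, t). X w t) \<in> borel_measurable (M \<Otimes>\<^sub>M unit_time)"
    using assms
  proof (induction)
    case (elem a b \<xi>)
    have [measurable]: "\<xi> \<in> borel_measurable M"
      using measurable_F_M[OF _ elem(4)] elem(1-3) by auto
    show ?case
      using borel_measurable_integrable[OF integrable_step_integral[OF elem]] unfolding step_process_def by simp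
  next
    case (add X J Y K)
    then have [measurable]: "J \<in> borel_measurable M" "K \<in> borel_measurable M"
      "(\<lambda>(w, t). X w t) \<in> borel_measurable (M \<Otimes>\<^sub>M unit_time)"
      "(\<lambda>(w, t). Y w t) \<in> borel_measurable (M \<Otimes>\<^sub>M unit_time)" by auto
    show ?case by simp
  qed
  then show "J \<in> borel_measurable M" "(\<lambda>(w, t). X w t) \<in> borel_measurable (M \<Otimes>\<^sub>M unit_time)" by auto
qed

text \<open>The diagonal case of the pairing. Since \<open>pre_ito\<close> is closed under
  differences, the isometry also measures the distance between two elementary integrals.\<close>

lemma ito_isometry:
  assumes "pre_ito X J"
  shows "(\<integral>\<^sup>+w. ennreal ((J w)\<^sup>2) \<partial>M) = (\<integral>\<^sup>+(w, t). ennreal ((norm (X w t))\<^sup>2) \<partial>(M \<Otimes>\<^sub>M unit_time))"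
  using pre_ito_pairing[OF assms assms] unfolding pairing_def case_prod_beta
  by (simp add: nn_integral_eq_integral power2_eq_square[symmetric] power2_norm_eq_inner)

lemma pre_ito_simple:
  assumes "\<And>i. i \<le> k \<Longrightarrow> \<tau> i \<in> {0..1}" "\<And>i. i < k \<Longrightarrow> \<tau> i \<le> \<tau> (Suc i)"
    and "\<And>i. i < k \<Longrightarrow> \<xi> i \<in> borel_measurable (F (\<tau> i)) \<and> bounded (range (\<xi> i))"
  shows "pre_ito (\<lambda>w t. \<Sum>i<k. indicator {\<tau> i<..\<tau> (Suc i)} t *\<^sub>R \<xi> i w)
    (\<lambda>w. \<Sum>i<k. \<xi> i w \<bullet> (B (\<tau> (Suc i)) w - B (\<tau> i) w))"
  using assms
proof (induction k)
  case 0 then show ?case by (simp add: pre_ito_zero)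
next
  case (Suc k)
  have "pre_ito (step_process (\<tau> k) (\<tau> (Suc k)) (\<xi> k)) (step_integral (\<tau> k) (\<tau> (Suc k)) (\<xi> k))"
    using Suc.prems(1)[of k] Suc.prems(1)[of "Suc k"] Suc.prems(2,3)[of k] by (intro pre_ito.elem) auto
  from pre_ito.add[OF Suc.IH this] Suc.prems show ?case by (simp add: step_process_def step_integral_def)
qed

end

subsection \<open>Approximation by lagged averages\<close>

text \<open>If \<open>U\<close> is a primitive of \<open>f\<close>, the value on the cell
  \<open>((k - 1) / m, k / m]\<close> is the average of \<open>f\<close> over the preceding cell,
  hence known at the left end of the current one; this lag is what keeps adaptedness. The first cell
  has no predecessor and receives 0.\<close>

definition lag_avg :: "nat \<Rightarrow> (real \<Rightarrow> real) \<Rightarrow> real \<Rightarrow> real" where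
  "lag_avg m U t = (if \<lceil>t * m\<rceil> \<le> 1 then 0
     else m * (U ((of_int \<lceil>t * m\<rceil> - 1) / m) - U ((of_int \<lceil>t * m\<rceil> - 2) / m)))"

lemma ceiling_eq_iff_interval: "m > 0 \<Longrightarrow> \<lceil>s * real m\<rceil> = k \<longleftrightarrow> (of_int k - 1) / m < s \<and> s \<le> of_int k / m"
  by (simp add: ceiling_eq_iff field_simps)

lemma lag_avg_measurable [measurable]: "lag_avg m U \<in> borel_measurable borel"
proof -
  have "(\<lambda>t :: real. (\<lambda>k. if k \<le> 1 then 0 else m * (U ((of_int k - 1) / real m) - U ((of_int k - 2) / real m))) \<lceil>t * real m\<rceil>) \<in> borel_measurable borel"
    by (rule measurable_compose[of "\<lambda>t :: real. \<lceil>t * real m\<rceil>" borel "count_space UNIV"]) measurable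
  then show ?thesis by (simp add: lag_avg_def[abs_def])
qed

lemma integral_unit_time: "set_lebesgue_integral lborel {0..1} f = (\<integral>s. f s \<partial>unit_time)"
  for f :: "real \<Rightarrow> 'b::{banach, second_countable_topology}"
  by (simp add: unit_time_def set_lebesgue_integral_def integral_restrict_space)

lemma set_integral_unit_time:
  fixes f :: "real \<Rightarrow> 'b::{banach, second_countable_topology}"
  assumes "t \<in> {0..1}"
  shows "set_lebesgue_integral lborel {0..t} f = (\<integral>s. indicator {0..t} s *\<^sub>R f s \<partial>unit_time)"
  using assms by (simp add: unit_time_def set_lebesgue_integral_def integral_restrict_space)
    (auto intro!: Bochner_Integration.integral_cong simp: indicator_def)

lemma bounded_integrable_unit_time:
  fixes f :: "real \<Rightarrow> 'b::{banach, second_countable_topology}"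
  assumes "f \<in> borel_measurable unit_time" "\<And>t. t \<in> {0..1} \<Longrightarrow> norm (f t) \<le> C"
  shows "integrable unit_time f"
proof -
  show ?thesis using assms by (intro unit_time.integrable_const_bound[where B=C]) auto
qed

lemma integrable_indicator_unit_time:
  fixes f :: "real \<Rightarrow> 'b::{banach, second_countable_topology}"
  assumes f: "integrable unit_time f" and S: "S \<in> sets borel"
  shows "integrable unit_time (\<lambda>s. indicator S s *\<^sub>R f s)"
proof (rule Bochner_Integration.integrable_bound[OF f])
  show "(\<lambda>s. indicator S s *\<^sub>R f s) \<in> borel_measurable unit_time" using assms by measurable
qed (auto simp: indicator_def)

lemma interval_increment:
  fixes f :: "real \<Rightarrow> 'b::{banach, second_countable_topology}"
  assumes f: "integrable unit_time f" and U: "\<And>t. t \<in> {0..1} \<Longrightarrow> U t = set_lebesgue_integral lborel {0..t} f"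
    and ab: "0 \<le> a" "a \<le> b" "b \<le> 1"
  shows "U b - U a = (\<integral>s. indicator {a<..b} s *\<^sub>R f s \<partial>unit_time)"
proof -
  have i: "integrable unit_time (\<lambda>s. indicator {0..t} s *\<^sub>R f s)" for t
    using f by (rule integrable_indicator_unit_time) simp
  show ?thesis using ab
    by (simp add: U set_integral_unit_time Bochner_Integration.integral_diff[OF i i, symmetric])
      (auto intro!: Bochner_Integration.integral_cong simp: indicator_def)
qed

text \<open>The average is an integral of \<open>f\<close> against the kernel that is
  \<open>m\<close> when \<open>t\<close> lies in the cell following that of \<open>s\<close>, and 0
  otherwise. A point of the preceding cell is less than \<open>2 / m\<close> away from
  \<open>t\<close>, whence the radius in the third claim.\<close>

lemma lag_avg_bound:
  fixes f :: "real \<Rightarrow> real"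
  assumes f: "f \<in> borel_measurable unit_time" "\<And>t. t \<in> {0..1} \<Longrightarrow> \<bar>f t\<bar> \<le> C"
    and U: "\<And>t. t \<in> {0..1} \<Longrightarrow> U t = set_lebesgue_integral lborel {0..t} f"
    and m: "m > 0" and t: "t \<in> {0..1}"
  shows "ennreal \<bar>lag_avg m U t\<bar> \<le> (\<integral>\<^sup>+s. m * (if \<lceil>t * m\<rceil> = \<lceil>s * m\<rceil> + 1 then ennreal \<bar>f s\<bar> else 0) \<partial>unit_time)"
    and "\<bar>lag_avg m U t\<bar> \<le> C"
    and "(\<And>s. s \<in> {0..1} \<Longrightarrow> \<bar>s - t\<bar> \<le> 2 / m \<Longrightarrow> \<bar>f s - x\<bar> \<le> \<epsilon>) \<Longrightarrow> \<lceil>t * m\<rceil> > 1 \<Longrightarrow> \<bar>lag_avg m U t - x\<bar> \<le> \<epsilon>"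
proof -
  note f(1)[measurable]
  define k where "k = \<lceil>t * m\<rceil>"
  have km: "k \<le> int m" using t m by (auto simp: k_def ceiling_le_iff mult_left_le_one_le)
  have km': "real_of_int k \<le> real m" using km by linarith
  let ?a = "(of_int k - 2) / real m" and ?b = "(of_int k - 1) / real m"
  have fi: "integrable unit_time f" using f by (intro bounded_integrable_unit_time[where C=C]) auto
  have C0: "0 \<le> C" using f(2)[of 0] by auto
  have ind: "indicator {?a<..?b} s = (if k = \<lceil>s * m\<rceil> + 1 then 1 else 0 :: real)" for s
    using ceiling_eq_iff_interval[OF m, of s "k - 1"] by (auto simp: indicator_def diff_diff_eq)
  have case1: "lag_avg m U t = m * (\<integral>s. indicator {?a<..?b} s *\<^sub>R f s \<partial>unit_time)" and ab: "0 \<le> ?a" "?a \<le> ?b" "?b \<le> 1"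
    if "k > 1"
  proof -
    have "2 \<le> real_of_int k" using that by linarith
    then show ab: "0 \<le> ?a" "?a \<le> ?b" "?b \<le> 1" using m km' by (auto simp: field_simps)
    show "lag_avg m U t = m * (\<integral>s. indicator {?a<..?b} s *\<^sub>R f s \<partial>unit_time)"
      using that interval_increment[OF fi U ab] by (simp add: lag_avg_def k_def[symmetric])
  qed
  have bi: "integrable unit_time (\<lambda>s. indicator {?a<..?b} s *\<^sub>R f s)"
    using fi by (rule integrable_indicator_unit_time) simp
  have ii: "integrable unit_time (\<lambda>s. indicator {?a<..?b} s :: real)"
    using integrable_indicator_unit_time[of "\<lambda>_. 1 :: real" "{?a<..?b}"] by simp
  have leb: "(\<integral>s. indicator {?a<..?b} s \<partial>unit_time) = 1 / real m" if "k > 1"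
    unfolding integral_indicator_unit_time[OF ab[OF that]] by (simp add: diff_divide_distrib[symmetric])
  show 1: "ennreal \<bar>lag_avg m U t\<bar> \<le> (\<integral>\<^sup>+s. m * (if \<lceil>t * m\<rceil> = \<lceil>s * m\<rceil> + 1 then ennreal \<bar>f s\<bar> else 0) \<partial>unit_time)"
  proof (cases "k > 1")
    case True
    have "\<bar>lag_avg m U t\<bar> \<le> (\<integral>s. m * \<bar>indicator {?a<..?b} s *\<^sub>R f s\<bar> \<partial>unit_time)"
      using case1[OF True] integral_abs_bound[of unit_time "\<lambda>s. indicator {?a<..?b} s *\<^sub>R f s"] m
      by (simp add: abs_mult mult_left_mono)
    then have "ennreal \<bar>lag_avg m U t\<bar> \<le> ennreal (\<integral>s. m * \<bar>indicator {?a<..?b} s *\<^sub>R f s\<bar> \<partial>unit_time)"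
      by (rule ennreal_leI)
    also have "\<dots> = (\<integral>\<^sup>+s. ennreal (m * \<bar>indicator {?a<..?b} s *\<^sub>R f s\<bar>) \<partial>unit_time)"
      using bi by (intro nn_integral_eq_integral[symmetric]) auto
    also have "\<dots> = (\<integral>\<^sup>+s. m * (if \<lceil>t * m\<rceil> = \<lceil>s * m\<rceil> + 1 then ennreal \<bar>f s\<bar> else 0) \<partial>unit_time)"
      unfolding ind
      by (intro nn_integral_cong) (auto simp: k_def ennreal_mult ennreal_of_nat_eq_real_of_nat)
    finally show ?thesis .
  qed (simp add: lag_avg_def k_def[symmetric])
  have gen: "\<bar>lag_avg m U t - x\<bar> \<le> \<epsilon>"
    if h: "\<And>s. s \<in> {0..1} \<Longrightarrow> \<bar>s - t\<bar> \<le> 2 / m \<Longrightarrow> \<bar>f s - x\<bar> \<le> \<epsilon>" and k: "k > 1" for x \<epsilon>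
  proof -
    have e0: "0 \<le> \<epsilon>" using h[of t] t by fastforce
    \<comment> \<open>The constant \<open>x\<close> is its own average over the preceding cell,
      whose length is \<open>1 / m\<close>.\<close>
    have e: "lag_avg m U t - x = m * (\<integral>s. indicator {?a<..?b} s *\<^sub>R f s - indicator {?a<..?b} s * x \<partial>unit_time)"
      using bi ii leb[OF k] m case1[OF k] by (simp add: field_simps del: Bochner_Integration.integral_indicator)
    have "\<bar>lag_avg m U t - x\<bar> \<le> m * (\<integral>s. \<bar>indicator {?a<..?b} s *\<^sub>R f s - indicator {?a<..?b} s * x\<bar> \<partial>unit_time)"
      unfolding e by (simp add: abs_mult mult_left_mono integral_abs_bound)
    also have "\<dots> \<le> m * (\<integral>s. indicator {?a<..?b} s * \<epsilon> \<partial>unit_time)"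
    proof (intro mult_left_mono integral_mono)
      fix s :: real assume s: "s \<in> space unit_time"
      have "\<bar>s - t\<bar> \<le> 2 / m" if "s \<in> {?a<..?b}"
      proof -
        have "(of_int k - 1) / m < t" "t \<le> of_int k / m" using ceiling_eq_iff_interval[OF m, of t k] k_def by auto
        with that show ?thesis by (auto simp: diff_divide_distrib)
      qed
      then show "\<bar>indicator {?a<..?b} s *\<^sub>R f s - indicator {?a<..?b} s * x\<bar> \<le> indicator {?a<..?b} s * \<epsilon>"
        using h[of s] s e0 by (auto simp: indicator_def)
    qed (use bi ii in auto)
    also have "\<dots> = \<epsilon>" using leb[OF k] m by (simp del: Bochner_Integration.integral_indicator)
    finally show ?thesis .
  qed
  show "(\<And>s. s \<in> {0..1} \<Longrightarrow> \<bar>s - t\<bar> \<le> 2 / m \<Longrightarrow> \<bar>f s - x\<bar> \<le> \<epsilon>) \<Longrightarrow> \<lceil>t * m\<rceil> > 1 \<Longrightarrow> \<bar>lag_avg m U t - x\<bar> \<le> \<epsilon>"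
    using gen by (simp add: k_def)
  show "\<bar>lag_avg m U t\<bar> \<le> C"
    using gen[of 0 C] f(2) C0 by (cases "k > 1") (auto simp: lag_avg_def k_def)
qed

text \<open>By Fubini the kernel may be integrated over \<open>t\<close> first: a cell passes its
  mass on to the next cell only, which occupies at most length \<open>1 / m\<close> of the unit
  interval, so the factor \<open>m\<close> is absorbed.\<close>

lemma lag_avg_L1_contraction:
  fixes f :: "real \<Rightarrow> real"
  assumes f [measurable]: "f \<in> borel_measurable unit_time" and fC: "\<And>t. t \<in> {0..1} \<Longrightarrow> \<bar>f t\<bar> \<le> C"
    and U: "\<And>t. t \<in> {0..1} \<Longrightarrow> U t = set_lebesgue_integral lborel {0..t} f"
    and m: "m > 0"
  shows "(\<integral>\<^sup>+t. ennreal \<bar>lag_avg m U t\<bar> \<partial>unit_time) \<le> (\<integral>\<^sup>+t. ennreal \<bar>f t\<bar> \<partial>unit_time)"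
proof -
  interpret TT: pair_sigma_finite unit_time unit_time ..
  have [measurable]: "(\<lambda>s. \<lceil>s * real m\<rceil>) \<in> unit_time \<rightarrow>\<^sub>M count_space UNIV"
    by (rule measurable_unit_time_borel) measurable
  have "(\<integral>\<^sup>+t. ennreal \<bar>lag_avg m U t\<bar> \<partial>unit_time)
    \<le> (\<integral>\<^sup>+t. \<integral>\<^sup>+s. m * (if \<lceil>t * m\<rceil> = \<lceil>s * m\<rceil> + 1 then ennreal \<bar>f s\<bar> else 0) \<partial>unit_time \<partial>unit_time)"
    using lag_avg_bound(1)[OF f fC U m] by (intro nn_integral_mono) auto
  also have "\<dots> = (\<integral>\<^sup>+s. \<integral>\<^sup>+t. m * (if \<lceil>t * m\<rceil> = \<lceil>s * m\<rceil> + 1 then ennreal \<bar>f s\<bar> else 0) \<partial>unit_time \<partial>unit_time)"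
    by (rule TT.Fubini'[symmetric]) measurable
  also have "\<dots> \<le> (\<integral>\<^sup>+s. ennreal \<bar>f s\<bar> \<partial>unit_time)"
  proof (rule nn_integral_mono)
    fix s :: real
    let ?S = "{t \<in> {0..1}. \<lceil>t * real m\<rceil> = \<lceil>s * real m\<rceil> + 1}"
    have "(\<lambda>s. \<lceil>s * real m\<rceil>) -` {\<lceil>s * real m\<rceil> + 1} \<inter> space unit_time \<in> sets unit_time" by measurable
    then have S: "?S \<in> sets unit_time" by (simp add: vimage_def Int_def conj_commute)
    have "(\<integral>\<^sup>+t. m * (if \<lceil>t * m\<rceil> = \<lceil>s * m\<rceil> + 1 then ennreal \<bar>f s\<bar> else 0) \<partial>unit_time)
      = (\<integral>\<^sup>+t. (m * ennreal \<bar>f s\<bar>) * indicator ?S t \<partial>unit_time)"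
      by (intro nn_integral_cong) (auto simp: indicator_def)
    also have "\<dots> = (m * ennreal \<bar>f s\<bar>) * emeasure unit_time ?S"
      using S by (simp add: nn_integral_cmult_indicator)
    also have "emeasure unit_time ?S \<le> ennreal (1 / m)"
    proof -
      have "emeasure unit_time ?S = emeasure lborel ?S"
        by (subst unit_time_def, subst emeasure_restrict_space) auto
      also have "\<dots> \<le> emeasure lborel {of_int \<lceil>s * m\<rceil> / m<..(of_int \<lceil>s * m\<rceil> + 1) / real m}"
        by (rule emeasure_mono) (auto simp: ceiling_eq_iff_interval[OF m])
      also have "\<dots> = ennreal (1 / m)"
        using m by (subst emeasure_lborel_Ioc) (auto simp: field_simps diff_divide_distrib[symmetric])
      finally show ?thesis .
    qed
    also have "(m * ennreal \<bar>f s\<bar>) * ennreal (1 / m) = ennreal \<bar>f s\<bar>"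
      using m by (simp add: ennreal_of_nat_eq_real_of_nat ennreal_mult[symmetric])
    finally show "(\<integral>\<^sup>+t. m * (if \<lceil>t * m\<rceil> = \<lceil>s * m\<rceil> + 1 then ennreal \<bar>f s\<bar> else 0) \<partial>unit_time) \<le> ennreal \<bar>f s\<bar>"
      by (simp add: mult_left_mono)
  qed
  finally show ?thesis .
qed

text \<open>Lebesgue measurability provides continuous functions converging almost everywhere;
  truncation at \<open>C\<close> makes dominated convergence applicable.\<close>

lemma bounded_continuous_approx:
  fixes f :: "real \<Rightarrow> real"
  assumes f: "f \<in> borel_measurable unit_time" "\<And>t. t \<in> {0..1} \<Longrightarrow> \<bar>f t\<bar> \<le> C"
  obtains g where "\<And>n. continuous_on UNIV (g n)" "\<And>n t. \<bar>g n t\<bar> \<le> C"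
    "(\<lambda>n. \<integral>\<^sup>+t. ennreal \<bar>f t - g n t\<bar> \<partial>unit_time) \<longlonglongrightarrow> 0"
proof -
  note f(1)[measurable]
  have C0: "0 \<le> C" using f(2)[of 0] by auto
  let ?f = "\<lambda>t. indicator {0..1} t *\<^sub>R f t"
  have "f \<in> borel_measurable (restrict_space borel {0..1})"
    using f(1) measurable_cong_sets[OF sets_unit_time refl] by blast
  then have "?f \<in> borel_measurable borel"
    by (subst (asm) borel_measurable_restrict_space_iff) auto
  then have "?f measurable_on UNIV"
    by (intro lebesgue_measurable_imp_measurable_on_real) (auto simp: measurable_completion)
  then obtain N g where N: "negligible N" and g: "\<And>n. continuous_on UNIV (g n)"
    and lim: "\<And>t. t \<notin> N \<Longrightarrow> (\<lambda>n. g n t) \<longlonglongrightarrow> ?f t"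
    unfolding measurable_on_def by auto
  define h where "h n t = max (- C) (min C (g n t))" for n t
  have h: "continuous_on UNIV (h n)" "\<bar>h n t\<bar> \<le> C" for n t
    using g C0 unfolding h_def by (auto intro!: continuous_intros)
  have [measurable]: "h n \<in> borel_measurable unit_time" for n
    by (rule measurable_unit_time_borel, rule borel_measurable_continuous_onI, rule h)
  have ae: "AE t in unit_time. t \<notin> N"
  proof -
    have "AE t in lebesgue. t \<notin> N" using N by (simp add: negligible_iff_null_sets AE_not_in)
    then have "AE t in lborel. t \<notin> N" by (simp add: AE_completion_iff)
    then show ?thesis unfolding unit_time_def by (auto simp: AE_restrict_space_iff)
  qed
  have "(\<lambda>n. \<integral>\<^sup>+t. ennreal \<bar>f t - h n t\<bar> \<partial>unit_time) \<longlonglongrightarrow> (\<integral>\<^sup>+t. 0 \<partial>unit_time)"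
  proof (rule nn_integral_dominated_convergence[where w="\<lambda>_. ennreal (2 * C)"])
    show "AE t in unit_time. ennreal \<bar>f t - h n t\<bar> \<le> ennreal (2 * C)" for n
    proof (rule AE_I2)
      fix t assume "t \<in> space unit_time"
      then have "\<bar>f t\<bar> \<le> C" using f(2) by simp
      with h(2)[of n t] show "ennreal \<bar>f t - h n t\<bar> \<le> ennreal (2 * C)" by (intro ennreal_leI) linarith
    qed
    show "AE t in unit_time. (\<lambda>n. ennreal \<bar>f t - h n t\<bar>) \<longlonglongrightarrow> 0"
      using ae AE_space
    proof eventually_elim
      case (elim t)
      then have "\<bar>f t\<bar> \<le> C" "(\<lambda>n. g n t) \<longlonglongrightarrow> f t" using f(2) lim[of t] by auto
      then have "(\<lambda>n. h n t) \<longlonglongrightarrow> max (- C) (min C (f t))" unfolding h_def by (intro tendsto_intros)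
      then have "(\<lambda>n. h n t) \<longlonglongrightarrow> f t" using \<open>\<bar>f t\<bar> \<le> C\<close> by (simp add: abs_le_iff min_absorb2 max_absorb2)
      then have "(\<lambda>n. ennreal \<bar>f t - h n t\<bar>) \<longlonglongrightarrow> ennreal \<bar>f t - f t\<bar>" by (intro tendsto_intros)
      then show ?case by simp
    qed
  qed (auto simp: ennreal_mult_less_top unit_time.emeasure_space_1[simplified])
  with h show ?thesis by (intro that[of h]) auto
qed

text \<open>Since the averaging contracts L1 for every \<open>m\<close>, it converges for
  \<open>f\<close> as soon as it does for continuous functions, and for these it converges at every
  \<open>t > 0\<close>. The uniform bound upgrades L1 to L2.\<close>

lemma lag_avg_L2:
  fixes f :: "real \<Rightarrow> real"
  assumes f [measurable]: "f \<in> borel_measurable unit_time" and fC: "\<And>t. t \<in> {0..1} \<Longrightarrow> \<bar>f t\<bar> \<le> C"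
    and U: "\<And>t. t \<in> {0..1} \<Longrightarrow> U t = set_lebesgue_integral lborel {0..t} f"
  shows "(\<lambda>m. \<integral>\<^sup>+t. ennreal ((lag_avg (Suc m) U t - f t)\<^sup>2) \<partial>unit_time) \<longlonglongrightarrow> 0"
proof -
  have C0: "0 \<le> C" using fC[of 0] by auto
  have [measurable]: "lag_avg m V \<in> borel_measurable unit_time" for m V
    by (rule measurable_unit_time_borel) measurable
  obtain g where g: "\<And>n. continuous_on UNIV (g n)" "\<And>n t. \<bar>g n t\<bar> \<le> C"
    and lim: "(\<lambda>n. \<integral>\<^sup>+t. ennreal \<bar>f t - g n t\<bar> \<partial>unit_time) \<longlonglongrightarrow> 0"
    using bounded_continuous_approx[OF f fC] by blast
  have [measurable]: "g n \<in> borel_measurable unit_time" for n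
    by (rule measurable_unit_time_borel, rule borel_measurable_continuous_onI, rule g)
  define V where "V n t = set_lebesgue_integral lborel {0..t} (g n)" for n t
  have cont: "(\<lambda>m. \<integral>\<^sup>+t. ennreal \<bar>lag_avg (Suc m) (V n) t - g n t\<bar> \<partial>unit_time) \<longlonglongrightarrow> 0" for n
  proof -
    have "(\<lambda>m. \<integral>\<^sup>+t. ennreal \<bar>lag_avg (Suc m) (V n) t - g n t\<bar> \<partial>unit_time) \<longlonglongrightarrow> (\<integral>\<^sup>+t. 0 \<partial>unit_time)"
    proof (rule nn_integral_dominated_convergence[where w="\<lambda>_. ennreal (2 * C)"])
      show "AE t in unit_time. ennreal \<bar>lag_avg (Suc m) (V n) t - g n t\<bar> \<le> ennreal (2 * C)" for m
      proof (rule AE_I2)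
        fix t assume "t \<in> space unit_time"
        then have "\<bar>lag_avg (Suc m) (V n) t\<bar> \<le> C" using g(2) by (intro lag_avg_bound(2)[of "g n"]) (auto simp: V_def)
        with g(2)[of n t] show "ennreal \<bar>lag_avg (Suc m) (V n) t - g n t\<bar> \<le> ennreal (2 * C)" by (intro ennreal_leI) linarith
      qed
      show "AE t in unit_time. (\<lambda>m. ennreal \<bar>lag_avg (Suc m) (V n) t - g n t\<bar>) \<longlonglongrightarrow> 0"
        using AE_unit_time_pos
      proof eventually_elim
        case (elim t)
        then have t: "0 < t" "t \<in> {0..1}" by auto
        have "(\<lambda>m. \<bar>lag_avg (Suc m) (V n) t - g n t\<bar>) \<longlonglongrightarrow> 0"
        proof (rule LIMSEQ_I)
          fix r :: real assume "r > 0"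
          have "isCont (g n) t" using g(1)[of n] by (simp add: continuous_on_eq_continuous_at)
          then obtain d where d: "d > 0" "\<And>s. \<bar>s - t\<bar> < d \<Longrightarrow> \<bar>g n s - g n t\<bar> < r / 2"
            using \<open>r > 0\<close> unfolding continuous_at_eps_delta dist_real_def by (meson half_gt_zero)
          \<comment> \<open>Smallness against \<open>t\<close> puts \<open>t\<close> beyond the
            first cell with its default value 0; smallness against \<open>d / 2\<close> keeps the
            preceding cell where \<open>g n\<close> is close to \<open>g n t\<close>.\<close>
          obtain m0 where m0: "m0 > 0" "1 / real m0 < min t (d / 2)"
            using real_arch_inverse[of "min t (d / 2)"] t d(1) by (auto simp: field_simps)
          have "norm (\<bar>lag_avg (Suc m) (V n) t - g n t\<bar> - 0) < r" if "m \<ge> m0" for m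
          proof -
            have "1 / real (Suc m) \<le> 1 / real m0" using that m0 by (intro divide_left_mono) auto
            then have m: "1 / real (Suc m) < t" "2 / real (Suc m) < d" using m0 by auto
            then have "1 < t * real (Suc m)" by (simp add: field_simps)
            then have "\<lceil>t * real (Suc m)\<rceil> > 1" by (simp add: less_ceiling_iff)
            moreover have "\<bar>g n s - g n t\<bar> \<le> r / 2" if "\<bar>s - t\<bar> \<le> 2 / real (Suc m)" for s
              using d(2)[of s] that m by linarith
            ultimately have "\<bar>lag_avg (Suc m) (V n) t - g n t\<bar> \<le> r / 2"
              using t g(2) by (intro lag_avg_bound(3)[of "g n" C]) (auto simp: V_def)
            then show ?thesis using \<open>r > 0\<close> by simp
          qed
          then show "\<exists>no. \<forall>m\<ge>no. norm (\<bar>lag_avg (Suc m) (V n) t - g n t\<bar> - 0) < r" by blast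
        qed
        then show ?case using tendsto_ennrealI by fastforce
      qed
    qed (auto simp: ennreal_mult_less_top unit_time.emeasure_space_1[simplified])
    then show ?thesis by simp
  qed
  have L1: "(\<lambda>m. \<integral>\<^sup>+t. ennreal \<bar>lag_avg (Suc m) U t - f t\<bar> \<partial>unit_time) \<longlonglongrightarrow> 0"
  proof (rule order_tendstoI)
    fix e :: ennreal assume "0 < e"
    \<comment> \<open>The minimum with 1 is taken because \<open>e\<close> may be infinite.\<close>
    define d where "d = min e 1 / 3"
    have "0 < min e 1" unfolding min_less_iff_conj using \<open>0 < e\<close> by (metis zero_less_one)
    then have d0: "0 < d" unfolding d_def by (metis ennreal_zero_less_divide ennreal_numeral_less_top)
    have d3: "d + d + d \<le> e"
    proof -
      have "d + d + d = (1 + 1 + 1) * d" by (simp only: distrib_right mult_1)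
      also have "(1 + 1 + 1 :: ennreal) = 3" by simp
      also have "3 * d = min e 1"
        using ennreal_mult_divide_eq[of 3 "min e 1"] by (simp add: d_def ennreal_times_divide mult.commute)
      finally show ?thesis by simp
    qed
    have "\<forall>\<^sub>F n in sequentially. (\<integral>\<^sup>+t. ennreal \<bar>f t - g n t\<bar> \<partial>unit_time) < d" using order_tendstoD(2)[OF lim d0] .
    then obtain n where n: "(\<integral>\<^sup>+t. ennreal \<bar>f t - g n t\<bar> \<partial>unit_time) < d" by (auto simp: eventually_sequentially)
    show "\<forall>\<^sub>F m in sequentially. (\<integral>\<^sup>+t. ennreal \<bar>lag_avg (Suc m) U t - f t\<bar> \<partial>unit_time) < e"
      using order_tendstoD(2)[OF cont[of n] d0]
    proof eventually_elim
      case (elim m)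
      have fi: "integrable unit_time f" "integrable unit_time (g n)"
        using fC g(2) by (auto intro!: bounded_integrable_unit_time[where C=C])
      \<comment> \<open>On the unit interval \<open>D\<close> is a primitive of
        \<open>f - g n\<close>, and averaging is linear in the primitive, so the contraction applies
        to the difference.\<close>
      define D where "D t = (if t \<in> {0..1} then U t - V n t else 0)" for t
      have D: "lag_avg (Suc m) U t = lag_avg (Suc m) D t + lag_avg (Suc m) (V n) t" if t: "t \<in> {0..1}" for t
      proof -
        have "\<lceil>t * real (Suc m)\<rceil> \<le> int (Suc m)"
          using t by (auto simp: ceiling_le_iff mult_left_le_one_le)
        then have k: "real_of_int \<lceil>t * real (Suc m)\<rceil> \<le> real (Suc m)" by linarith
        have "real_of_int \<lceil>t * real (Suc m)\<rceil> \<ge> 2" if "\<not> \<lceil>t * real (Suc m)\<rceil> \<le> 1" using that by linarith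
        then show ?thesis using k unfolding lag_avg_def D_def
          by (auto simp: divide_le_eq_1 algebra_simps simp del: of_nat_Suc)
      qed
      have "(\<integral>\<^sup>+t. ennreal \<bar>lag_avg (Suc m) U t - f t\<bar> \<partial>unit_time)
        \<le> (\<integral>\<^sup>+t. (ennreal \<bar>lag_avg (Suc m) D t\<bar> + ennreal \<bar>lag_avg (Suc m) (V n) t - g n t\<bar>) + ennreal \<bar>f t - g n t\<bar> \<partial>unit_time)"
        by (intro nn_integral_mono) (auto simp: D ennreal_plus[symmetric] simp del: ennreal_plus intro!: ennreal_leI)
      also have "\<dots> = (\<integral>\<^sup>+t. ennreal \<bar>lag_avg (Suc m) D t\<bar> \<partial>unit_time)
        + (\<integral>\<^sup>+t. ennreal \<bar>lag_avg (Suc m) (V n) t - g n t\<bar> \<partial>unit_time) + (\<integral>\<^sup>+t. ennreal \<bar>f t - g n t\<bar> \<partial>unit_time)"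
        by (simp add: nn_integral_add)
      also have "\<dots> \<le> (\<integral>\<^sup>+t. ennreal \<bar>f t - g n t\<bar> \<partial>unit_time)
        + (\<integral>\<^sup>+t. ennreal \<bar>lag_avg (Suc m) (V n) t - g n t\<bar> \<partial>unit_time) + (\<integral>\<^sup>+t. ennreal \<bar>f t - g n t\<bar> \<partial>unit_time)"
      proof (intro add_mono order_refl lag_avg_L1_contraction[of "\<lambda>t. f t - g n t" "2 * C"])
        show "\<bar>f t - g n t\<bar> \<le> 2 * C" if "t \<in> {0..1}" for t using fC[OF that] g(2)[of n t] by linarith
        show "D t = set_lebesgue_integral lborel {0..t} (\<lambda>t. f t - g n t)" if t: "t \<in> {0..1}" for t
        proof -
          have "integrable unit_time (\<lambda>s. indicator {0..t} s *\<^sub>R h s)" if "integrable unit_time h" for h :: "real \<Rightarrow> real"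
            using that by (rule integrable_indicator_unit_time) simp
          from this[OF fi(1)] this[OF fi(2)] t show ?thesis
            by (simp add: D_def U V_def set_integral_unit_time right_diff_distrib)
        qed
      qed auto
      also have "\<dots> < d + d + d" using n elim by (intro add_strict_mono) auto
      finally show ?case using d3 by simp
    qed
  qed simp
  have "(\<lambda>m. ennreal (2 * C) * (\<integral>\<^sup>+t. ennreal \<bar>lag_avg (Suc m) U t - f t\<bar> \<partial>unit_time)) \<longlonglongrightarrow> ennreal (2 * C) * 0"
    by (intro ennreal_tendsto_cmult L1) simp
  then have "(\<lambda>m. ennreal (2 * C) * (\<integral>\<^sup>+t. ennreal \<bar>lag_avg (Suc m) U t - f t\<bar> \<partial>unit_time)) \<longlonglongrightarrow> 0" by simp
  then show ?thesis
  proof (rule tendsto_sandwich[rotated 2, OF tendsto_const])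
    show "\<forall>\<^sub>F m in sequentially. (\<integral>\<^sup>+t. ennreal ((lag_avg (Suc m) U t - f t)\<^sup>2) \<partial>unit_time)
      \<le> ennreal (2 * C) * (\<integral>\<^sup>+t. ennreal \<bar>lag_avg (Suc m) U t - f t\<bar> \<partial>unit_time)"
    proof (intro always_eventually allI)
      fix m
      have "(\<integral>\<^sup>+t. ennreal ((lag_avg (Suc m) U t - f t)\<^sup>2) \<partial>unit_time)
        \<le> (\<integral>\<^sup>+t. ennreal (2 * C) * ennreal \<bar>lag_avg (Suc m) U t - f t\<bar> \<partial>unit_time)"
      proof (rule nn_integral_mono)
        fix t assume "t \<in> space unit_time"
        then have t: "t \<in> {0..1}" by simp
        have "\<bar>lag_avg (Suc m) U t - f t\<bar> \<le> 2 * C"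
          using lag_avg_bound(2)[OF f fC U _ t, of "Suc m"] fC[OF t] by simp
        then have "\<bar>lag_avg (Suc m) U t - f t\<bar> * \<bar>lag_avg (Suc m) U t - f t\<bar> \<le> 2 * C * \<bar>lag_avg (Suc m) U t - f t\<bar>"
          by (rule mult_right_mono) simp
        then show "ennreal ((lag_avg (Suc m) U t - f t)\<^sup>2) \<le> ennreal (2 * C) * ennreal \<bar>lag_avg (Suc m) U t - f t\<bar>"
          using C0 by (simp add: ennreal_mult[symmetric] power2_eq_square)
      qed
      then show "(\<integral>\<^sup>+t. ennreal ((lag_avg (Suc m) U t - f t)\<^sup>2) \<partial>unit_time)
        \<le> ennreal (2 * C) * (\<integral>\<^sup>+t. ennreal \<bar>lag_avg (Suc m) U t - f t\<bar> \<partial>unit_time)"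
        by (simp add: nn_integral_cmult)
    qed
  qed simp
qed

subsection \<open>Adaptedness and completeness\<close>

lemma measurable_AE_complete:
  assumes M: "complete_measure M" and S: "subalgebra M F" and N: "null_sets M \<subseteq> sets F"
    and X: "X \<in> F \<rightarrow>\<^sub>M K" and Y: "\<And>w. w \<in> space M \<Longrightarrow> Y w \<in> space K" and ae: "AE w in M. X w = Y w"
  shows "Y \<in> F \<rightarrow>\<^sub>M K"
proof (rule measurableI)
  interpret complete_measure M by fact
  have sp: "space F = space M" using S by (simp add: subalgebra_def)
  show "Y w \<in> space K" if "w \<in> space F" for w using Y that sp by simp
  fix A assume A: "A \<in> sets K"
  let ?X = "X -` A \<inter> space F" and ?Y = "Y -` A \<inter> space F"
  have "{w \<in> space M. X w \<noteq> Y w} \<in> null_sets M" using ae by (simp add: AE_iff_null_sets)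
  then have "?X - ?Y \<in> null_sets M" "?Y - ?X \<in> null_sets M"
    using sp by (auto intro: complete2[rotated])
  then have "?X - (?X - ?Y) \<union> (?Y - ?X) \<in> sets F" using N measurable_sets[OF X A] by blast
  also have "?X - (?X - ?Y) \<union> (?Y - ?X) = ?Y" by auto
  finally show "?Y \<in> sets F" .
qed

text \<open>Joint measurability is available for \<open>M\<close> only, so Fubini alone does not
  make the integral \<open>F\<close>-measurable. The integral is compared with its conditional
  expectation instead: as the integrand is \<open>F\<close>-measurable at each fixed time, testing
  the integral against \<open>H\<close> or against the conditional expectation of \<open>H\<close>
  gives the same value. With \<open>H\<close> the sign of the difference, the difference vanishes
  almost surely, and \<open>F\<close> contains the null sets.\<close>

lemma adapted_time_integral:
  fixes g :: "'a \<Rightarrow> real \<Rightarrow> real"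
  assumes M: "prob_space M" "complete_measure M" and S: "subalgebra M F" and N: "null_sets M \<subseteq> sets F"
    and g [measurable]: "(\<lambda>(w, t). g w t) \<in> borel_measurable (M \<Otimes>\<^sub>M unit_time)"
    and gC: "\<And>w t. \<bar>g w t\<bar> \<le> C"
    and gF: "\<And>t. t \<in> {0..1} \<Longrightarrow> (\<lambda>w. g w t) \<in> borel_measurable F"
  shows "(\<lambda>w. \<integral>t. g w t \<partial>unit_time) \<in> borel_measurable F"
proof -
  interpret prob_space M by fact
  interpret MT: pair_prob_space M unit_time ..
  interpret F: finite_measure_subalgebra M F by standard (rule S)
  let ?Y = "\<lambda>w. \<integral>t. g w t \<partial>unit_time" and ?E = "real_cond_exp M F"
  have Y [measurable]: "?Y \<in> borel_measurable M" by (rule unit_time.borel_measurable_lebesgue_integral) (rule g)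
  have C0: "0 \<le> C" using gC order_trans[OF abs_ge_zero] by blast
  have YC: "\<bar>?Y w\<bar> \<le> C" if "w \<in> space M" for w
  proof -
    have [measurable]: "g w \<in> borel_measurable unit_time" using that by measurable
    have "integrable unit_time (g w)" using gC by (intro bounded_integrable_unit_time[where C=C]) auto
    then have "\<bar>?Y w\<bar> \<le> (\<integral>t. C \<partial>unit_time)"
      using gC by (intro order_trans[OF integral_abs_bound] integral_mono) auto
    then show ?thesis using unit_time.prob_space by simp
  qed
  have Yi: "integrable M ?Y" using YC by (intro integrable_const_bound[where B=C]) auto
  define H where "H w = sgn (?Y w - ?E ?Y w)" for w
  have H [measurable]: "H \<in> borel_measurable M" unfolding H_def by measurable
  have H1: "\<bar>H w\<bar> \<le> 1" for w unfolding H_def by (simp add: abs_sgn_eq)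
  have Hi: "integrable M H" using H1 by (intro integrable_const_bound[where B=1]) auto
  have Ei: "integrable M (?E H)" "integrable M (?E ?Y)"
    using F.real_cond_exp_int(1) Hi Yi by auto
  have YHi: "integrable M (\<lambda>w. ?Y w * h w)" if "integrable M h" for h
  proof (rule Bochner_Integration.integrable_bound)
    show "integrable M (\<lambda>w. C * h w)" using that by simp
    show "AE w in M. norm (?Y w * h w) \<le> norm (C * h w)"
      using YC C0 by (auto simp: abs_mult intro!: mult_right_mono)
  qed (use that in measurable)
  have swap: "(\<integral>w. ?Y w * h w \<partial>M) = (\<integral>t. \<integral>w. g w t * h w \<partial>M \<partial>unit_time)" if h: "integrable M h" for h
  proof -
    have [measurable]: "h \<in> borel_measurable M" using h by auto
    have "integrable (M \<Otimes>\<^sub>M unit_time) (\<lambda>(w, t). g w t * h w)"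
    proof (rule Bochner_Integration.integrable_bound)
      have "integrable (M \<Otimes>\<^sub>M unit_time) (\<lambda>x. h (fst x))"
      proof -
        have "integrable (distr (M \<Otimes>\<^sub>M unit_time) M fst) h"
          using h by (simp add: unit_time.distr_pair_fst)
        then show ?thesis by (rule integrable_distr[rotated]) measurable
      qed
      then show "integrable (M \<Otimes>\<^sub>M unit_time) (\<lambda>x. C * h (fst x))" by simp
      show "AE x in M \<Otimes>\<^sub>M unit_time. norm (case x of (w, t) \<Rightarrow> g w t * h w) \<le> norm (C * h (fst x))"
        using gC C0 by (intro AE_I2) (auto simp: abs_mult split_beta intro!: mult_right_mono)
    qed measurable
    then have "(\<integral>t. \<integral>w. g w t * h w \<partial>M \<partial>unit_time) = (\<integral>w. \<integral>t. g w t * h w \<partial>unit_time \<partial>M)"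
      by (rule MT.Fubini_integral)
    then show ?thesis by simp
  qed
  have gi: "integrable M (\<lambda>w. g w t * h w)" if "integrable M h" "t \<in> {0..1}" for h t
  proof (rule Bochner_Integration.integrable_bound)
    have [measurable]: "(\<lambda>w. g w t) \<in> borel_measurable M" using gF[OF that(2)] measurable_from_subalg[OF S] by blast
    have [measurable]: "h \<in> borel_measurable M" using that(1) by auto
    show "integrable M (\<lambda>w. C * h w)" using that by simp
    show "AE w in M. norm (g w t * h w) \<le> norm (C * h w)"
      using gC C0 by (auto simp: abs_mult intro!: mult_right_mono)
    show "(\<lambda>w. g w t * h w) \<in> borel_measurable M" by measurable
  qed
  have "(\<integral>w. ?Y w * H w \<partial>M) = (\<integral>t. \<integral>w. g w t * H w \<partial>M \<partial>unit_time)" by (rule swap[OF Hi])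
  also have "\<dots> = (\<integral>t. \<integral>w. g w t * ?E H w \<partial>M \<partial>unit_time)"
    using gF gi[OF Hi] by (intro Bochner_Integration.integral_cong refl F.real_cond_exp_intg(2)[symmetric]) auto
  also have "\<dots> = (\<integral>w. ?Y w * ?E H w \<partial>M)" by (rule swap[OF Ei(1), symmetric])
  also have "\<dots> = (\<integral>w. ?E ?Y w * ?E H w \<partial>M)"
    using F.real_cond_exp_intg(2)[of "?E H" ?Y] YHi[OF Ei(1)] by (simp add: mult.commute)
  also have "\<dots> = (\<integral>w. ?E ?Y w * H w \<partial>M)"
  proof (rule F.real_cond_exp_intg(2))
    show "integrable M (\<lambda>w. ?E ?Y w * H w)"
      by (rule Bochner_Integration.integrable_bound[OF Ei(2)]) (auto simp: abs_mult H1 mult_left_le)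
  qed measurable
  finally have eq: "(\<integral>w. ?Y w * H w \<partial>M) = (\<integral>w. ?E ?Y w * H w \<partial>M)" .
  have i2: "integrable M (\<lambda>w. ?E ?Y w * H w)"
    by (rule Bochner_Integration.integrable_bound[OF Ei(2)]) (auto simp: abs_mult H1 mult_left_le)
  have "(\<integral>w. \<bar>?Y w - ?E ?Y w\<bar> \<partial>M) = (\<integral>w. ?Y w * H w - ?E ?Y w * H w \<partial>M)"
    unfolding H_def by (intro Bochner_Integration.integral_cong) (auto simp: sgn_if)
  also have "\<dots> = 0" using eq YHi[OF Hi] i2 by simp
  finally have "AE w in M. \<bar>?Y w - ?E ?Y w\<bar> = 0"
    using Yi Ei(2) by (subst (asm) integral_nonneg_eq_0_iff_AE) auto
  then have "AE w in M. ?E ?Y w = ?Y w" by eventually_elim simp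
  then show ?thesis
    by (rule measurable_AE_complete[OF M(2) S N borel_measurable_cond_exp, rotated]) simp
qed

text \<open>The Riesz-Fischer argument: a rapidly Cauchy subsequence has summable increments almost
  everywhere and so converges, and Fatou's lemma controls the distance of the whole sequence to the
  limit.\<close>

lemma L2_complete:
  fixes J :: "nat \<Rightarrow> 'a \<Rightarrow> real"
  assumes [measurable]: "\<And>n. J n \<in> borel_measurable M" and M: "finite_measure M"
    and cauchy: "\<And>e. e > 0 \<Longrightarrow> \<exists>N. \<forall>k\<ge>N. \<forall>l\<ge>N. (\<integral>\<^sup>+w. ennreal ((J k w - J l w)\<^sup>2) \<partial>M) \<le> ennreal e"
  obtains I where "I \<in> borel_measurable M" "(\<lambda>n. \<integral>\<^sup>+w. ennreal ((J n w - I w)\<^sup>2) \<partial>M) \<longlonglongrightarrow> 0"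
proof -
  interpret finite_measure M by fact
  \<comment> \<open>The rate \<open>(1/4) ^ i\<close> still beats the factor \<open>2 ^ i\<close>
    that arises below in the passage from squares to absolute values.\<close>
  have "\<forall>i. \<exists>N. \<forall>k\<ge>N. \<forall>l\<ge>N. (\<integral>\<^sup>+w. ennreal ((J k w - J l w)\<^sup>2) \<partial>M) \<le> ennreal ((1/4) ^ i)"
    by (intro allI cauchy) simp
  from choice[OF this] obtain N where
    N: "\<And>i k l. N i \<le> k \<Longrightarrow> N i \<le> l \<Longrightarrow> (\<integral>\<^sup>+w. ennreal ((J k w - J l w)\<^sup>2) \<partial>M) \<le> ennreal ((1/4) ^ i)"
    by blast
  \<comment> \<open>Summing makes \<open>r k\<close> dominate every \<open>N i\<close> with
    \<open>i \<le> k\<close> at once.\<close>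
  define r where "r k = (\<Sum>i\<le>k. N i) + k" for k
  have r: "N i \<le> r k" if "i \<le> k" for i k
    using that member_le_sum[of i "{..k}" N] by (auto simp: r_def)
  have rk: "k \<le> r k" for k by (simp add: r_def)
  define I where "I w = lim (\<lambda>k. J (r k) w)" for w
  have [measurable]: "I \<in> borel_measurable M" unfolding I_def by measurable
  have "(\<integral>\<^sup>+w. (\<Sum>k. ennreal \<bar>J (r (Suc k)) w - J (r k) w\<bar>) \<partial>M)
    = (\<Sum>k. \<integral>\<^sup>+w. ennreal \<bar>J (r (Suc k)) w - J (r k) w\<bar> \<partial>M)"
    by (rule nn_integral_suminf) measurable
  also have "\<dots> \<le> (\<Sum>k. ennreal ((1 + measure M (space M)) * (1/2) ^ k))"
  proof (intro suminf_le summableI)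
    fix k
    have "\<bar>x\<bar> \<le> 2 ^ k * x\<^sup>2 + (1/2) ^ k" for x :: real
    proof -
      have "0 \<le> (2 ^ k * \<bar>x\<bar> - 1)\<^sup>2 + (2 ^ k * \<bar>x\<bar>)" by simp
      also have "\<dots> = 2 ^ k * (2 ^ k * x\<^sup>2 + (1/2) ^ k - \<bar>x\<bar>)"
        by (simp add: power2_eq_square algebra_simps power_one_over)
      finally have "2 ^ k * 0 \<le> 2 ^ k * (2 ^ k * x\<^sup>2 + (1/2) ^ k - \<bar>x\<bar>)" by simp
      moreover have "0 < (2 :: real) ^ k" by simp
      ultimately have "0 \<le> 2 ^ k * x\<^sup>2 + (1/2) ^ k - \<bar>x\<bar>" by (simp only: mult_le_cancel_left_pos)
      then show ?thesis by simp
    qed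
    then have "(\<integral>\<^sup>+w. ennreal \<bar>J (r (Suc k)) w - J (r k) w\<bar> \<partial>M)
      \<le> (\<integral>\<^sup>+w. ennreal (2 ^ k) * ennreal ((J (r (Suc k)) w - J (r k) w)\<^sup>2) + ennreal ((1/2) ^ k) \<partial>M)"
      by (intro nn_integral_mono) (simp add: ennreal_mult[symmetric] ennreal_plus[symmetric] ennreal_leI del: ennreal_plus)
    also have "\<dots> = ennreal (2 ^ k) * (\<integral>\<^sup>+w. ennreal ((J (r (Suc k)) w - J (r k) w)\<^sup>2) \<partial>M) + ennreal ((1/2) ^ k) * emeasure M (space M)"
      by (simp add: nn_integral_add nn_integral_cmult)
    also have "\<dots> \<le> ennreal (2 ^ k) * ennreal ((1/4) ^ k) + ennreal ((1/2) ^ k) * emeasure M (space M)"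
      by (intro add_mono mult_left_mono N r order_refl) auto
    also have "\<dots> = ennreal ((1 + measure M (space M)) * (1/2) ^ k)"
      by (simp add: emeasure_eq_measure ennreal_mult[symmetric] ennreal_plus[symmetric] power_mult_distrib[symmetric] algebra_simps del: ennreal_plus)
    finally show "(\<integral>\<^sup>+w. ennreal \<bar>J (r (Suc k)) w - J (r k) w\<bar> \<partial>M) \<le> ennreal ((1 + measure M (space M)) * (1/2) ^ k)" .
  qed
  also have "\<dots> < \<infinity>"
    by (subst suminf_ennreal2) (auto intro!: summable_mult summable_geometric)
  finally have "AE w in M. (\<Sum>k. ennreal \<bar>J (r (Suc k)) w - J (r k) w\<bar>) \<noteq> \<infinity>"
    by (intro nn_integral_noteq_infinite) auto
  then have conv: "AE w in M. (\<lambda>k. J (r k) w) \<longlonglongrightarrow> I w"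
  proof eventually_elim
    case (elim w)
    then have "summable (\<lambda>k. \<bar>J (r (Suc k)) w - J (r k) w\<bar>)"
      by (intro summable_suminf_not_top) auto
    then have "summable (\<lambda>k. J (r (Suc k)) w - J (r k) w)" by (rule summable_rabs_cancel)
    then have "convergent (\<lambda>n. \<Sum>k<n. J (r (Suc k)) w - J (r k) w)" by (simp add: summable_iff_convergent)
    then have "convergent (\<lambda>n. J (r n) w - J (r 0) w)" by (simp only: sum_lessThan_telescope[of "\<lambda>k. J (r k) w"])
    then have "convergent (\<lambda>n. J (r n) w - J (r 0) w + J (r 0) w)" by (intro convergent_add convergent_const)
    then show ?case unfolding I_def by (simp add: convergent_LIMSEQ_iff)
  qed
  have bound: "(\<integral>\<^sup>+w. ennreal ((J n w - I w)\<^sup>2) \<partial>M) \<le> ennreal ((1/4) ^ i)" if n: "n \<ge> N i" for n i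
  proof -
    have "(\<integral>\<^sup>+w. ennreal ((J n w - I w)\<^sup>2) \<partial>M) = (\<integral>\<^sup>+w. liminf (\<lambda>k. ennreal ((J n w - J (r k) w)\<^sup>2)) \<partial>M)"
    proof (rule nn_integral_cong_AE, use conv in eventually_elim)
      fix w assume "(\<lambda>k. J (r k) w) \<longlonglongrightarrow> I w"
      then have "(\<lambda>k. ennreal ((J n w - J (r k) w)\<^sup>2)) \<longlonglongrightarrow> ennreal ((J n w - I w)\<^sup>2)"
        by (intro tendsto_intros)
      then show "ennreal ((J n w - I w)\<^sup>2) = liminf (\<lambda>k. ennreal ((J n w - J (r k) w)\<^sup>2))"
        by (rule lim_imp_Liminf[OF sequentially_bot, symmetric])
    qed
    also have "\<dots> \<le> liminf (\<lambda>k. \<integral>\<^sup>+w. ennreal ((J n w - J (r k) w)\<^sup>2) \<partial>M)"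
      by (rule nn_integral_liminf) measurable
    also have "\<dots> \<le> ennreal ((1/4) ^ i)"
    proof (rule Liminf_le)
      show "\<forall>\<^sub>F k in sequentially. (\<integral>\<^sup>+w. ennreal ((J n w - J (r k) w)\<^sup>2) \<partial>M) \<le> ennreal ((1/4) ^ i)"
        using eventually_ge_at_top[of i] by eventually_elim (intro N n r)
    qed simp
    finally show ?thesis .
  qed
  have "(\<lambda>n. \<integral>\<^sup>+w. ennreal ((J n w - I w)\<^sup>2) \<partial>M) \<longlonglongrightarrow> 0"
  proof (rule order_tendstoI)
    fix e :: ennreal assume "0 < e"
    have "(\<lambda>i. ennreal ((1/4) ^ i)) \<longlonglongrightarrow> ennreal 0" by (intro tendsto_ennrealI LIMSEQ_power_zero) simp
    then have "\<forall>\<^sub>F i in sequentially. ennreal ((1/4) ^ i) < e" using \<open>0 < e\<close> by (simp add: order_tendstoD(2))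
    then obtain i where "ennreal ((1/4) ^ i) < e" by (auto simp: eventually_sequentially)
    with bound show "\<forall>\<^sub>F n in sequentially. (\<integral>\<^sup>+w. ennreal ((J n w - I w)\<^sup>2) \<partial>M) < e"
      unfolding eventually_sequentially by (meson le_less_trans)
  qed simp
  then show ?thesis by (intro that[of I]) auto
qed

section \<open>Completed natural filtrations and the Brownian motion \<open>\<beta>\<close>\<close>

lemma sets_natural_filtration:
  "sets (natural_filtration \<nu> X t) = sigma_sets (space \<nu>)
     ({(\<lambda>w. path_val (X w) s) -` A \<inter> space \<nu> | s A. s \<in> {0..t} \<and> A \<in> sets borel} \<union> null_sets \<nu>)"
  unfolding natural_filtration_def
  by (rule sets_measure_of) (auto dest: null_setsD2 sets.sets_into_space)

lemma space_natural_filtration [simp]: "space (natural_filtration \<nu> X t) = space \<nu>"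
  unfolding natural_filtration_def
  by (rule space_measure_of) (auto dest: null_setsD2 sets.sets_into_space)

lemma null_sets_natural_filtration: "null_sets \<nu> \<subseteq> sets (natural_filtration \<nu> X t)"
  unfolding sets_natural_filtration by (auto intro: sigma_sets.Basic)

lemma natural_filtration_mono: "s \<le> t \<Longrightarrow> sets (natural_filtration \<nu> X s) \<subseteq> sets (natural_filtration \<nu> X t)"
  unfolding sets_natural_filtration by (rule sigma_sets_mono') fastforce

lemma natural_filtration_adapted:
  assumes "s \<in> {0..t}"
  shows "(\<lambda>w. path_val (X w) s) \<in> borel_measurable (natural_filtration \<nu> X t)"
proof (rule measurableI)
  fix A :: "(real ^ 'a) set" assume "A \<in> sets borel"
  then show "(\<lambda>w. path_val (X w) s) -` A \<inter> space (natural_filtration \<nu> X t) \<in> sets (natural_filtration \<nu> X t)"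
    unfolding sets_natural_filtration space_natural_filtration using assms by (intro sigma_sets.Basic) blast
qed simp

lemma subalgebra_natural_filtration:
  assumes [measurable]: "X \<in> \<nu> \<rightarrow>\<^sub>M path_borel"
  shows "subalgebra \<nu> (natural_filtration \<nu> X t)"
  unfolding subalgebra_def sets_natural_filtration
proof (intro conjI sets.sigma_sets_subset Un_least subsetI)
  fix E assume "E \<in> {(\<lambda>w. path_val (X w) s) -` A \<inter> space \<nu> | s A. s \<in> {0..t} \<and> A \<in> sets borel}"
  then obtain s A where "E = (\<lambda>w. path_val (X w) s) -` A \<inter> space \<nu>" "A \<in> sets borel" by blast
  then show "E \<in> sets \<nu>" using measurable_sets[of "\<lambda>w. path_val (X w) s" \<nu> borel A] by simp
qed auto

locale path_brownian =
  fixes \<mu> \<nu> :: "'n::finite cpath measure" and \<beta> :: "'n cpath \<Rightarrow> 'n cpath"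
  assumes prob: "prob_space \<mu>"
    and sets: "sets \<mu> = sets path_borel"
    and nu: "\<nu> = completion \<mu>"
    and bm: "brownian_motion \<nu> \<beta>"
    and filt: "\<And>t. t \<in> {0..1} \<Longrightarrow> sets (natural_filtration \<nu> \<beta> t) = sets (coord_filtration \<nu> t)"
begin

abbreviation "\<F> \<equiv> coord_filtration \<nu>"
abbreviation "\<P> \<equiv> \<nu> \<Otimes>\<^sub>M unit_time"
abbreviation "sq_dist X Y \<equiv> \<integral>\<^sup>+ (w, t). ennreal ((norm (X w t - Y w t))\<^sup>2) \<partial>\<P>"

lemma space_nu [simp]: "space \<nu> = UNIV"
  using sets_eq_imp_space_eq[OF sets] by (simp add: nu)

lemma prob_nu: "prob_space \<nu>"
proof
  interpret prob_space \<mu> by (rule prob)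
  show "emeasure \<nu> (space \<nu>) = 1" using emeasure_space_1 by (simp add: nu)
qed

lemma complete_nu: "complete_measure \<nu>"
  unfolding nu by (rule completion.complete_measure_axioms)

sublocale prob_space \<nu> by (rule prob_nu)
sublocale complete_measure \<nu> by (rule complete_nu)

lemma id_measurable [measurable]: "(\<lambda>w. w) \<in> \<nu> \<rightarrow>\<^sub>M path_borel"
  unfolding nu by (rule measurable_completion) (simp add: measurable_cong_sets[OF sets refl])

lemma beta_measurable [measurable]: "\<beta> \<in> \<nu> \<rightarrow>\<^sub>M path_borel"
  using bm by (simp add: brownian_motion_def)

text \<open>\<open>brownian_motion\<close> provides independence only from the filtration of
  \<open>\<beta>\<close>; the coincidence of this filtration with that of the path turns it into
  independence from \<open>\<F>\<close>.\<close>

sublocale gauss_increments \<nu> \<F> "\<lambda>t w. path_val (\<beta> w) t"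
proof
  fix t :: real assume t: "t \<in> {0..1}"
  show "subalgebra \<nu> (\<F> t)" by (rule subalgebra_natural_filtration) measurable
  show "(\<lambda>w. path_val (\<beta> w) t) \<in> borel_measurable (\<F> t)"
    using natural_filtration_adapted[of t t \<beta> \<nu>] filt[OF t] t by (simp cong: measurable_cong_sets)
next
  fix s t :: real assume st: "0 \<le> s" "s \<le> t" "t \<le> 1"
  show "sets (\<F> s) \<subseteq> sets (\<F> t)" using st by (intro natural_filtration_mono)
next
  fix s t :: real and A and D :: "(real ^ 'n) set"
  assume st: "0 \<le> s" "s < t" "t \<le> 1" and A: "A \<in> sets (\<F> s)" and D: "D \<in> sets borel"
  let ?d = "\<lambda>w. path_val (\<beta> w) t - path_val (\<beta> w) s"
  have d: "distributed \<nu> lborel ?d (\<lambda>x. ennreal (\<Prod>i\<in>UNIV. normal_density 0 (sqrt (t - s)) (x $ i)))"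
    and i: "indep_set (sets (natural_filtration \<nu> \<beta> s)) (sets (vimage_algebra (space \<nu>) ?d borel))"
    using bm st unfolding brownian_motion_def by auto
  have e: "{w \<in> space \<nu>. ?d w \<in> D} = ?d -` D \<inter> space \<nu>" by auto
  have "emeasure (gauss_vec (t - s)) D = emeasure (distr \<nu> lborel ?d) D"
    using d by (simp add: distributed_def gauss_vec_def)
  also have "\<dots> = emeasure \<nu> (?d -` D \<inter> space \<nu>)"
    using D by (subst emeasure_distr) auto
  finally have g: "emeasure (gauss_vec (t - s)) D = emeasure \<nu> (?d -` D \<inter> space \<nu>)" .
  have "prob (A \<inter> (?d -` D \<inter> space \<nu>)) = prob A * prob (?d -` D \<inter> space \<nu>)"
    using A filt[of s] st in_vimage_algebra[OF D, of ?d "space \<nu>"] by (intro indep_setD[OF i]) auto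
  then show "emeasure \<nu> (A \<inter> {w \<in> space \<nu>. ?d w \<in> D}) = emeasure \<nu> A * emeasure (gauss_vec (t - s)) D"
    unfolding g e by (simp add: emeasure_eq_measure ennreal_mult)
qed

end

subsection \<open>Existence and uniqueness of the Ito integral\<close>

lemma borel_measurable_vecI:
  fixes f :: "'a \<Rightarrow> real ^ 'n::finite"
  assumes "\<And>i. (\<lambda>x. f x $ i) \<in> borel_measurable M" shows "f \<in> borel_measurable M"
  unfolding borel_measurable_euclidean_space[of f] using assms by (auto simp: Basis_vec_def inner_axis)

lemma norm_diff_square_le:
  fixes a b c :: "'a::real_normed_vector"
  shows "(norm (a - b))\<^sup>2 \<le> 2 * (norm (a - c))\<^sup>2 + 2 * (norm (b - c))\<^sup>2"
proof -
  have "norm (a - b) \<le> norm (a - c) + norm (b - c)"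
    using norm_triangle_ineq4[of "a - c" "b - c"] by simp
  then have "(norm (a - b))\<^sup>2 \<le> (norm (a - c) + norm (b - c))\<^sup>2" by (rule power_mono) simp
  moreover have "0 \<le> (norm (a - c) - norm (b - c))\<^sup>2" by simp
  ultimately show ?thesis by (simp add: power2_sum power2_diff)
qed

lemma norm_sum3_square_le:
  fixes a b c :: "'a::real_normed_vector"
  shows "(norm (a + b + c))\<^sup>2 \<le> 4 * ((norm a)\<^sup>2 + (norm b)\<^sup>2 + (norm c)\<^sup>2)"
proof -
  have "(norm (a + b + c))\<^sup>2 \<le> 2 * (norm (a + b))\<^sup>2 + 2 * (norm c)\<^sup>2"
    using norm_diff_square_le[of "a + b" "- c" 0] by simp
  also have "\<dots> \<le> 2 * (2 * (norm a)\<^sup>2 + 2 * (norm b)\<^sup>2) + 4 * (norm c)\<^sup>2"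
    using norm_diff_square_le[of a "- b" 0] by (intro add_mono mult_left_mono mult_right_mono) auto
  finally show ?thesis by simp
qed

text \<open>Turns bounds that hold almost everywhere into bounds that hold everywhere, as the
  results on averages and time integrals require, while changing a density bounded by
  \<open>C\<close> only on a null set.\<close>

definition clamp_to :: "real \<Rightarrow> real \<Rightarrow> real" where
  "clamp_to C x = max (- C) (min C x)"

lemma clamp_to_bound: "0 \<le> C \<Longrightarrow> \<bar>clamp_to C x\<bar> \<le> C" by (auto simp: clamp_to_def)
lemma clamp_to_id: "\<bar>x\<bar> \<le> C \<Longrightarrow> clamp_to C x = x" by (auto simp: clamp_to_def abs_le_iff)
lemma clamp_to_measurable [measurable]: "clamp_to C \<in> borel_measurable borel"
  unfolding clamp_to_def[abs_def] by measurable

lemma has_cm_density_component: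
  fixes h :: "'n::finite cpath"
  assumes h: "has_cm_density h \<gamma>" and C: "AE t in unit_time. norm (\<gamma> t) \<le> C"
  shows "(\<lambda>t. clamp_to C (\<gamma> t $ j)) \<in> borel_measurable unit_time"
    and "t \<in> {0..1} \<Longrightarrow> path_val h t $ j = set_lebesgue_integral lborel {0..t} (\<lambda>s. clamp_to C (\<gamma> s $ j))"
proof -
  have [measurable]: "\<gamma> \<in> borel_measurable unit_time" using h by (simp add: has_cm_density_def)
  show "(\<lambda>t. clamp_to C (\<gamma> t $ j)) \<in> borel_measurable unit_time" by measurable
  assume t: "t \<in> {0..1}"
  have i: "integrable unit_time (\<lambda>s. indicator {0..t} s *\<^sub>R \<gamma> s)"
  proof (rule unit_time.integrable_const_bound[where B=C])
    show "AE s in unit_time. norm (indicator {0..t} s *\<^sub>R \<gamma> s) \<le> C"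
      using C by eventually_elim (auto simp: indicator_def intro: order_trans[OF norm_ge_zero])
  qed measurable
  have "path_val h t $ j = (\<integral>s. indicator {0..t} s *\<^sub>R \<gamma> s \<partial>unit_time) $ j"
    using h t by (simp add: has_cm_density_def set_integral_unit_time)
  also have "\<dots> = (\<integral>s. (indicator {0..t} s *\<^sub>R \<gamma> s) $ j \<partial>unit_time)"
    by (rule integral_bounded_linear[OF bounded_linear_vec_nth i, symmetric])
  also have "\<dots> = (\<integral>s. indicator {0..t} s *\<^sub>R clamp_to C (\<gamma> s $ j) \<partial>unit_time)"
  proof (rule integral_cong_AE)
    show "AE s in unit_time. (indicator {0..t} s *\<^sub>R \<gamma> s) $ j = indicator {0..t} s *\<^sub>R clamp_to C (\<gamma> s $ j)"
      using C by eventually_elim (simp add: clamp_to_id order_trans[OF component_le_norm_cart])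
  qed measurable
  finally show "path_val h t $ j = set_lebesgue_integral lborel {0..t} (\<lambda>s. clamp_to C (\<gamma> s $ j))"
    using t by (simp add: set_integral_unit_time)
qed

text \<open>Exactly one cell contains \<open>t\<close>, and its index \<open>i0\<close> is one less
  than the ceiling of \<open>t * real (Suc m)\<close>; positivity of \<open>t\<close> is what rules
  out index -1.\<close>

lemma lag_avg_eq_sum:
  assumes t: "0 < t" "t \<le> 1"
  shows "(\<Sum>i<Suc m. indicator {real i / real (Suc m)<..real (Suc i) / real (Suc m)} t *\<^sub>R
      (if i = 0 then 0 else real (Suc m) * (U (real i / real (Suc m)) - U (real (i - 1) / real (Suc m)))))
    = lag_avg (Suc m) U t"
proof -
  let ?M = "real (Suc m)"
  define k where "k = \<lceil>t * ?M\<rceil>"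
  have k: "1 \<le> k" "k \<le> int (Suc m)"
  proof -
    have "0 < t * ?M" using t by simp
    then show "1 \<le> k" unfolding k_def by (simp add: int_one_le_iff_zero_less zero_less_ceiling)
    have "t * ?M \<le> ?M" using t mult_right_mono[of t 1 ?M] by simp
    then show "k \<le> int (Suc m)" unfolding k_def by (simp add: ceiling_le_iff)
  qed
  define i0 where "i0 = nat (k - 1)"
  have i0: "i0 < Suc m" "k = int i0 + 1" using k by (auto simp: i0_def)
  have ind: "indicator {real i / ?M<..real (Suc i) / ?M} t = (if i = i0 then 1 else 0 :: real)" for i
  proof -
    have "k = int i + 1 \<longleftrightarrow> real i / ?M < t \<and> t \<le> (real i + 1) / ?M"
      using ceiling_eq_iff_interval[of "Suc m" t "int i + 1"] unfolding k_def by (simp del: of_nat_Suc)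
    then have "i = i0 \<longleftrightarrow> real i / ?M < t \<and> t \<le> real (Suc i) / ?M"
      using i0(2) by (auto simp: add.commute)
    then show ?thesis by (simp only: indicator_def greaterThanAtMost_iff of_bool_def)
  qed
  have "(\<Sum>i<Suc m. indicator {real i / ?M<..real (Suc i) / ?M} t *\<^sub>R
      (if i = 0 then 0 else ?M * (U (real i / ?M) - U (real (i - 1) / ?M))))
    = (\<Sum>i<Suc m. if i = i0 then (if i = 0 then 0 else ?M * (U (real i / ?M) - U (real (i - 1) / ?M))) else 0)"
    unfolding ind by (intro sum.cong) auto
  also have "\<dots> = (if i0 = 0 then 0 else ?M * (U (real i0 / ?M) - U (real (i0 - 1) / ?M)))"
    using i0(1) by (subst sum.delta) auto
  also have "\<dots> = lag_avg (Suc m) U t"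
  proof (cases "i0 = 0")
    case False
    have r: "real_of_int k = real i0 + 1" "real (i0 - 1) = real i0 - 1" using i0(2) False by auto
    then show ?thesis unfolding lag_avg_def k_def[symmetric] using False i0(2) by (simp add: algebra_simps)
  next
    case True
    then show ?thesis unfolding lag_avg_def k_def[symmetric] i0(2) by simp
  qed
  finally show ?thesis .
qed

context path_brownian
begin

lemma simple_process_pre_ito:
  assumes "simple_process \<F> k \<tau> \<xi>"
  shows "pre_ito (simple_value k \<tau> \<xi>) (simple_integral \<beta> k \<tau> \<xi>)"
  using pre_ito_simple[of k \<tau> \<xi>] assms
  by (simp add: simple_process_def simple_value_def[abs_def] simple_integral_def[abs_def])

lemma adapted_density_good:
  assumes g: "adapted_density \<nu> u g" and C: "AE (w, t) in \<P>. norm (g w t) \<le> C"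
  shows "AE w in \<nu>. has_cm_density (u w) (g w) \<and> (AE t in unit_time. norm (g w t) \<le> C)"
proof -
  interpret MT: pair_prob_space \<nu> unit_time ..
  have "AE w in \<nu>. AE t in unit_time. norm (g w t) \<le> C" using MT.AE_pair[OF C] by simp
  with g show ?thesis by (simp add: adapted_density_def)
qed

text \<open>The value of \<open>u\<close> at \<open>t\<close> is the time integral of the density
  cut off at \<open>t\<close>, and the clamped density, so cut off, is
  \<open>\<F> t\<close>-measurable at each single time.\<close>

lemma drift_adapted:
  assumes g: "adapted_density \<nu> u g" and C: "AE (w, t) in \<P>. norm (g w t) \<le> C" and C0: "0 \<le> C"
    and t: "t \<in> {0..1}"
  shows "(\<lambda>w. path_val (u w) t) \<in> borel_measurable (\<F> t)"
proof (rule borel_measurable_vecI)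
  fix j
  have gm [measurable]: "(\<lambda>(w, t). g w t) \<in> borel_measurable \<P>"
    and gF: "\<And>t. t \<in> {0..1} \<Longrightarrow> (\<lambda>w. g w t) \<in> borel_measurable (\<F> t)"
    using g by (auto simp: adapted_density_def)
  have S: "subalgebra \<nu> (\<F> t)" using sub t by auto
  have "(\<lambda>w. \<integral>s. indicator {0..t} s * clamp_to C (g w s $ j) \<partial>unit_time) \<in> borel_measurable (\<F> t)"
  proof (rule adapted_time_integral[OF prob_nu complete_nu S null_sets_natural_filtration])
    show "\<bar>indicator {0..t} s * clamp_to C (g w s $ j)\<bar> \<le> C" for w s
      using clamp_to_bound[OF C0] C0 by (auto simp: indicator_def)
    fix s :: real assume s: "s \<in> {0..1}"
    show "(\<lambda>w. indicator {0..t} s * clamp_to C (g w s $ j)) \<in> borel_measurable (\<F> t)"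
    proof (cases "s \<le> t")
      case True
      have [measurable]: "(\<lambda>w. g w s) \<in> borel_measurable (\<F> t)"
        using measurable_F_mono[OF _ True _ gF[OF s]] s t by auto
      show ?thesis by measurable
    qed simp
  qed measurable
  then show "(\<lambda>w. path_val (u w) t $ j) \<in> borel_measurable (\<F> t)"
  proof (rule measurable_AE_complete[OF complete_nu S null_sets_natural_filtration])
    show "AE w in \<nu>. (\<integral>s. indicator {0..t} s * clamp_to C (g w s $ j) \<partial>unit_time) = path_val (u w) t $ j"
      using adapted_density_good[OF g C]
    proof eventually_elim
      case (elim w)
      then show ?case using has_cm_density_component(2)[of "u w" "g w" C t j] t by (simp add: set_integral_unit_time)
    qed
  qed simp
qed

text \<open>The approximants are difference quotients of the path \<open>u w\<close> over the
  previous cell, that is, lagged averages of the density. They use only values of \<open>u\<close>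
  up to the left end of the current cell, so adaptedness of \<open>u\<close> makes them
  admissible.\<close>

lemma adapted_simple_approx:
  assumes g: "adapted_density \<nu> u g" and C: "AE (w, t) in \<P>. norm (g w t) \<le> C" and C0: "0 \<le> C"
  obtains k \<tau> \<xi> where "\<And>m. simple_process \<F> (k m) (\<tau> m) (\<xi> m)"
    "(\<lambda>m. sq_dist (simple_value (k m) (\<tau> m) (\<xi> m)) g) \<longlonglongrightarrow> 0"
proof -
  interpret MT: pair_prob_space \<nu> unit_time ..
  have gm [measurable]: "(\<lambda>(w, t). g w t) \<in> borel_measurable \<P>"
    using g by (auto simp: adapted_density_def)
  define \<tau> where "\<tau> m i = real i / real (Suc m)" for m i
  let ?q = "\<lambda>m i w j. real (Suc m) * (path_val (u w) (real i / real (Suc m)) $ j - path_val (u w) (real (i - 1) / real (Suc m)) $ j)"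
  let ?d = "\<lambda>m i w j. if i = 0 then 0 else ?q m i w j"
  \<comment> \<open>Clamping bounds the coefficient for every \<open>w\<close>, as
    \<open>simple_process\<close> demands; for almost every \<open>w\<close> it changes
    nothing.\<close>
  define \<xi> where "\<xi> m i w = (\<chi> j. clamp_to C (?d m i w j))" for m i w
  have simple: "simple_process \<F> (Suc m) (\<tau> m) (\<xi> m)" for m
    unfolding simple_process_def
  proof (intro conjI allI impI)
    fix i
    show "i \<le> Suc m \<Longrightarrow> \<tau> m i \<in> {0..1}" "i < Suc m \<Longrightarrow> \<tau> m i \<le> \<tau> m (Suc i)"
      by (auto simp: \<tau>_def divide_right_mono)
    assume i: "i < Suc m"
    have p: "(\<lambda>w. path_val (u w) (real i' / real (Suc m))) \<in> borel_measurable (\<F> (\<tau> m i))" if "i' \<le> i" for i'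
      using that i by (intro measurable_F_mono[OF _ _ _ drift_adapted[OF g C C0]]) (auto simp: \<tau>_def divide_right_mono)
    have q: "(\<lambda>w. path_val (u w) (real i' / real (Suc m)) $ j) \<in> borel_measurable (\<F> (\<tau> m i))"
      if "i' \<le> i" for i' j by (rule borel_measurable_vec_nth[OF p[OF that]])
    show "\<xi> m i \<in> borel_measurable (\<F> (\<tau> m i))"
    proof (rule borel_measurable_vecI)
      fix j
      show "(\<lambda>w. \<xi> m i w $ j) \<in> borel_measurable (\<F> (\<tau> m i))"
        unfolding \<xi>_def vec_lambda_beta using q[of i j] q[of "i - 1" j]
        by (intro measurable_compose[OF _ clamp_to_measurable]) (cases "i = 0"; simp del: of_nat_Suc)
    qed
    have "norm (\<xi> m i w) \<le> (\<Sum>j\<in>(UNIV :: 'n set). C)" for w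
      by (rule order_trans[OF norm_le_l1_cart sum_mono]) (simp add: \<xi>_def clamp_to_bound[OF C0])
    then show "bounded (range (\<xi> m i))" by (auto simp: bounded_iff)
  qed
  let ?X = "\<lambda>m. simple_value (Suc m) (\<tau> m) (\<xi> m)"
  let ?L = "\<lambda>m w j. lag_avg (Suc m) (\<lambda>t. path_val (u w) t $ j)"
  let ?c = "\<lambda>w j t. clamp_to C (g w t $ j)"
  have Xm [measurable]: "(\<lambda>(w, t). ?X m w t) \<in> borel_measurable \<P>" for m
    using pre_ito_measurable(2)[OF simple_process_pre_ito[OF simple]] .
  have pathwise: "(\<integral>\<^sup>+t. ennreal ((norm (?X m w t - g w t))\<^sup>2) \<partial>unit_time)
      = (\<Sum>j\<in>UNIV. \<integral>\<^sup>+t. ennreal ((?L m w j t - ?c w j t)\<^sup>2) \<partial>unit_time)"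
    and lagb: "t \<in> {0..1} \<Longrightarrow> \<bar>?L m w j t\<bar> \<le> C"
    if w: "has_cm_density (u w) (g w)" "AE t in unit_time. norm (g w t) \<le> C" for w m t j
  proof -
    note comp = has_cm_density_component[OF w]
    show b: "\<bar>?L m w j t\<bar> \<le> C" if "t \<in> {0..1}" for t j
      using that comp clamp_to_bound[OF C0] by (intro lag_avg_bound(2)[of "?c w j"]) auto
    have [measurable]: "?L m w j \<in> borel_measurable unit_time" for j
      by (rule measurable_unit_time_borel) measurable
    note comp(1)[measurable]
    have "(\<integral>\<^sup>+t. ennreal ((norm (?X m w t - g w t))\<^sup>2) \<partial>unit_time)
      = (\<integral>\<^sup>+t. (\<Sum>j\<in>UNIV. ennreal ((?L m w j t - ?c w j t)\<^sup>2)) \<partial>unit_time)"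
    proof (rule nn_integral_cong_AE, use w(2) AE_unit_time_pos in eventually_elim)
      fix t assume t: "norm (g w t) \<le> C" "0 < t \<and> t \<le> 1"
      have X: "?X m w t $ j = ?L m w j t" for j
      proof -
        have c: "clamp_to C (?d m i w j) = ?d m i w j"
          if i: "i < Suc m" for i
        proof (cases "i = 0")
          case False
          \<comment> \<open>The difference quotient is the value of the lagged average at the right
            end of the cell, so it inherits the bound \<open>C\<close>.\<close>
          let ?t = "real (Suc i) / real (Suc m)"
          have cl: "\<lceil>?t * real (Suc m)\<rceil> = int i + 1" by (simp del: of_nat_Suc)
          have "?L m w j ?t = ?q m i w j"
            unfolding lag_avg_def cl using False by (simp add: of_nat_diff)
          moreover have "\<bar>?L m w j ?t\<bar> \<le> C" using i by (intro b) auto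
          ultimately show ?thesis using False by (simp add: clamp_to_id)
        qed (simp add: clamp_to_id C0)
        have "?X m w t $ j = (\<Sum>i<Suc m. indicator {\<tau> m i<..\<tau> m (Suc i)} t *\<^sub>R \<xi> m i w $ j)"
          by (simp add: simple_value_def del: sum.lessThan_Suc)
        also have "\<dots> = (\<Sum>i<Suc m. indicator {real i / real (Suc m)<..real (Suc i) / real (Suc m)} t *\<^sub>R ?d m i w j)"
          by (intro sum.cong refl) (simp only: \<tau>_def \<xi>_def vec_lambda_beta c lessThan_iff)
        also have "\<dots> = ?L m w j t" using t(2) by (intro lag_avg_eq_sum) auto
        finally show ?thesis .
      qed
      have gc: "g w t $ j = ?c w j t" for j
        using t(1) component_le_norm_cart[of "g w t" j] by (simp add: clamp_to_id)
      have "(norm (?X m w t - g w t))\<^sup>2 = (\<Sum>j\<in>UNIV. (?X m w t $ j - g w t $ j)\<^sup>2)"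
        unfolding power2_norm_eq_inner inner_vec_def by (simp add: power2_eq_square)
      also have "\<dots> = (\<Sum>j\<in>UNIV. (?L m w j t - ?c w j t)\<^sup>2)" by (simp add: X gc[symmetric])
      finally show "ennreal ((norm (?X m w t - g w t))\<^sup>2) = (\<Sum>j\<in>UNIV. ennreal ((?L m w j t - ?c w j t)\<^sup>2))"
        by simp
    qed
    also have "\<dots> = (\<Sum>j\<in>UNIV. \<integral>\<^sup>+t. ennreal ((?L m w j t - ?c w j t)\<^sup>2) \<partial>unit_time)"
      by (rule nn_integral_sum) measurable
    finally show "(\<integral>\<^sup>+t. ennreal ((norm (?X m w t - g w t))\<^sup>2) \<partial>unit_time)
      = (\<Sum>j\<in>UNIV. \<integral>\<^sup>+t. ennreal ((?L m w j t - ?c w j t)\<^sup>2) \<partial>unit_time)" .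
  qed
  have "(\<lambda>m. \<integral>\<^sup>+w. \<integral>\<^sup>+t. ennreal ((norm (?X m w t - g w t))\<^sup>2) \<partial>unit_time \<partial>\<nu>) \<longlonglongrightarrow> (\<integral>\<^sup>+w. 0 \<partial>\<nu>)"
  proof (rule nn_integral_dominated_convergence[where w="\<lambda>_. \<Sum>j\<in>(UNIV :: 'n set). ennreal ((2 * C)\<^sup>2)"])
    show "(\<lambda>w. \<integral>\<^sup>+t. ennreal ((norm (?X m w t - g w t))\<^sup>2) \<partial>unit_time) \<in> borel_measurable \<nu>" for m
      by measurable
    show "AE w in \<nu>. (\<integral>\<^sup>+t. ennreal ((norm (?X m w t - g w t))\<^sup>2) \<partial>unit_time) \<le> (\<Sum>j\<in>(UNIV :: 'n set). ennreal ((2 * C)\<^sup>2))" for m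
      using adapted_density_good[OF g C]
    proof eventually_elim
      case (elim w)
      have "(\<integral>\<^sup>+t. ennreal ((?L m w j t - ?c w j t)\<^sup>2) \<partial>unit_time) \<le> (\<integral>\<^sup>+t. ennreal ((2 * C)\<^sup>2) \<partial>unit_time)" for j
      proof (rule nn_integral_mono)
        fix t assume "t \<in> space unit_time"
        then have "\<bar>?L m w j t\<bar> \<le> C" "\<bar>?c w j t\<bar> \<le> C" using lagb elim clamp_to_bound[OF C0] by auto
        then have "\<bar>?L m w j t - ?c w j t\<bar> \<le> \<bar>2 * C\<bar>" by linarith
        then show "ennreal ((?L m w j t - ?c w j t)\<^sup>2) \<le> ennreal ((2 * C)\<^sup>2)"
          by (intro ennreal_leI) (simp only: abs_le_square_iff)
      qed
      then have "(\<integral>\<^sup>+t. ennreal ((?L m w j t - ?c w j t)\<^sup>2) \<partial>unit_time) \<le> ennreal ((2 * C)\<^sup>2)" for j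
        using unit_time.emeasure_space_1 by simp
      then show ?case unfolding pathwise[OF conjunct1[OF elim] conjunct2[OF elim]] by (intro sum_mono)
    qed
    show "AE w in \<nu>. (\<lambda>m. \<integral>\<^sup>+t. ennreal ((norm (?X m w t - g w t))\<^sup>2) \<partial>unit_time) \<longlonglongrightarrow> 0"
      using adapted_density_good[OF g C]
    proof eventually_elim
      case (elim w)
      have "(\<lambda>m. \<Sum>j\<in>UNIV. \<integral>\<^sup>+t. ennreal ((?L m w j t - ?c w j t)\<^sup>2) \<partial>unit_time) \<longlonglongrightarrow> (\<Sum>j\<in>(UNIV :: 'n set). 0)"
        using elim by (intro tendsto_sum lag_avg_L2[where C=C] has_cm_density_component clamp_to_bound C0) auto
      then show ?case using elim by (simp add: pathwise)
    qed
  qed (auto simp: emeasure_space_1[simplified] ennreal_mult_less_top ennreal_of_nat_eq_real_of_nat)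
  moreover have "(sq_dist (?X m) g)
    = (\<integral>\<^sup>+w. \<integral>\<^sup>+t. ennreal ((norm (?X m w t - g w t))\<^sup>2) \<partial>unit_time \<partial>\<nu>)" for m
    by (subst unit_time.nn_integral_fst[symmetric]) (auto simp: split_beta')
  ultimately show ?thesis using simple by (intro that[of "\<lambda>m. Suc m" \<tau> \<xi>]) simp_all
qed

text \<open>The isometry turns convergence of the simple processes into the Cauchy property of their
  integrals.\<close>

lemma has_ito_integral_exists:
  assumes g: "adapted_density \<nu> u g" and C: "AE (w, t) in \<P>. norm (g w t) \<le> C"
  shows "\<exists>I. has_ito_integral \<nu> \<F> \<beta> g I"
proof -
  have gm [measurable]: "(\<lambda>(w, t). g w t) \<in> borel_measurable \<P>"
    using g by (auto simp: adapted_density_def)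
  have "AE (w, t) in \<P>. norm (g w t) \<le> max C 0" using C by eventually_elim auto
  from adapted_simple_approx[OF g this] obtain k \<tau> \<xi>
    where s: "\<And>m. simple_process \<F> (k m) (\<tau> m) (\<xi> m)"
    and lim: "(\<lambda>m. sq_dist (simple_value (k m) (\<tau> m) (\<xi> m)) g) \<longlonglongrightarrow> 0"
    by auto
  let ?X = "\<lambda>m. simple_value (k m) (\<tau> m) (\<xi> m)" and ?J = "\<lambda>m. simple_integral \<beta> (k m) (\<tau> m) (\<xi> m)"
  let ?S = "\<lambda>m. sq_dist (?X m) g"
  have p: "pre_ito (?X m) (?J m)" for m by (rule simple_process_pre_ito[OF s])
  note [measurable] = pre_ito_measurable[OF p]
  have diff: "(\<integral>\<^sup>+w. ennreal ((?J a w - ?J b w)\<^sup>2) \<partial>\<nu>) \<le> 2 * ?S a + 2 * ?S b" for a b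
  proof -
    have "(\<integral>\<^sup>+w. ennreal ((?J a w - ?J b w)\<^sup>2) \<partial>\<nu>)
      = (sq_dist (?X a) (?X b))"
      by (rule ito_isometry[OF pre_ito_diff[OF p p]])
    also have "\<dots> \<le> (\<integral>\<^sup>+ (w, t). 2 * ennreal ((norm (?X a w t - g w t))\<^sup>2) + 2 * ennreal ((norm (?X b w t - g w t))\<^sup>2) \<partial>\<P>)"
    proof (rule nn_integral_mono)
      fix x
      have "ennreal ((norm (?X a (fst x) (snd x) - ?X b (fst x) (snd x)))\<^sup>2)
        \<le> ennreal (2 * (norm (?X a (fst x) (snd x) - g (fst x) (snd x)))\<^sup>2 + 2 * (norm (?X b (fst x) (snd x) - g (fst x) (snd x)))\<^sup>2)"
        by (rule ennreal_leI[OF norm_diff_square_le])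
      then show "(case x of (w, t) \<Rightarrow> ennreal ((norm (?X a w t - ?X b w t))\<^sup>2))
        \<le> (case x of (w, t) \<Rightarrow> 2 * ennreal ((norm (?X a w t - g w t))\<^sup>2) + 2 * ennreal ((norm (?X b w t - g w t))\<^sup>2))"
        by (simp add: split_beta ennreal_mult)
    qed
    also have "\<dots> = 2 * ?S a + 2 * ?S b"
      unfolding split_beta' by (subst nn_integral_add) (auto simp: nn_integral_cmult)
    finally show ?thesis .
  qed
  obtain I where I: "I \<in> borel_measurable \<nu>" "(\<lambda>n. \<integral>\<^sup>+w. ennreal ((?J n w - I w)\<^sup>2) \<partial>\<nu>) \<longlonglongrightarrow> 0"
  proof (rule L2_complete[of ?J \<nu>])
    show "finite_measure \<nu>" by standard (simp add: emeasure_space_1[simplified])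
    fix e :: real assume "e > 0"
    then have "\<forall>\<^sub>F m in sequentially. ?S m < ennreal (e / 4)" by (intro order_tendstoD(2)[OF lim]) simp
    then obtain N where N: "\<And>m. m \<ge> N \<Longrightarrow> ?S m < ennreal (e / 4)" by (auto simp: eventually_sequentially)
    have "(\<integral>\<^sup>+w. ennreal ((?J a w - ?J b w)\<^sup>2) \<partial>\<nu>) \<le> ennreal e" if "a \<ge> N" "b \<ge> N" for a b
    proof -
      have "2 * ?S a + 2 * ?S b \<le> 2 * ennreal (e / 4) + 2 * ennreal (e / 4)"
        using N[OF that(1)] N[OF that(2)] by (intro add_mono mult_left_mono) auto
      also have "\<dots> = ennreal (2 * (e / 4) + 2 * (e / 4))"
        using \<open>e > 0\<close> by (simp only: ennreal_plus ennreal_mult' ennreal_numeral)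
      finally show ?thesis using diff[of a b] by simp
    qed
    then show "\<exists>N. \<forall>k\<ge>N. \<forall>l\<ge>N. (\<integral>\<^sup>+w. ennreal ((?J k w - ?J l w)\<^sup>2) \<partial>\<nu>) \<le> ennreal e" by blast
  qed (auto intro: pre_ito_measurable[OF p])
  show ?thesis
    unfolding has_ito_integral_def using I s lim by blast
qed

text \<open>With \<open>X\<close> and \<open>J\<close> zero this is uniqueness of the integral; in
  general it tells how an elementary change of the integrand acts. The approximants of
  \<open>g\<close> and \<open>g'\<close> are unrelated, but the isometry applies to their difference
  minus \<open>X\<close>, which tends to zero in L2 because \<open>g'\<close> is
  \<open>g + X\<close>.\<close>

lemma ito_integral_perturb:
  assumes 1: "has_ito_integral \<nu> \<F> \<beta> g I" and 2: "has_ito_integral \<nu> \<F> \<beta> g' I'"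
    and p: "pre_ito X J"
    and gm [measurable]: "(\<lambda>(w, t). g w t) \<in> borel_measurable \<P>" "(\<lambda>(w, t). g' w t) \<in> borel_measurable \<P>"
    and eq: "AE (w, t) in \<P>. g' w t = g w t + X w t"
  shows "AE w in \<nu>. I' w = I w + J w"
proof -
  have [measurable]: "I \<in> borel_measurable \<nu>" "I' \<in> borel_measurable \<nu>" using 1 2 by (auto simp: has_ito_integral_def)
  note [measurable] = pre_ito_measurable[OF p]
  obtain k \<tau> \<xi> where s: "\<And>m. simple_process \<F> (k m) (\<tau> m) (\<xi> m)"
    and X1: "(\<lambda>m. sq_dist (simple_value (k m) (\<tau> m) (\<xi> m)) g) \<longlonglongrightarrow> 0"
    and J1: "(\<lambda>m. \<integral>\<^sup>+ w. ennreal ((simple_integral \<beta> (k m) (\<tau> m) (\<xi> m) w - I w)\<^sup>2) \<partial>\<nu>) \<longlonglongrightarrow> 0"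
    using 1 unfolding has_ito_integral_def by blast
  obtain k' \<tau>' \<xi>' where s': "\<And>m. simple_process \<F> (k' m) (\<tau>' m) (\<xi>' m)"
    and X2: "(\<lambda>m. sq_dist (simple_value (k' m) (\<tau>' m) (\<xi>' m)) g') \<longlonglongrightarrow> 0"
    and J2: "(\<lambda>m. \<integral>\<^sup>+ w. ennreal ((simple_integral \<beta> (k' m) (\<tau>' m) (\<xi>' m) w - I' w)\<^sup>2) \<partial>\<nu>) \<longlonglongrightarrow> 0"
    using 2 unfolding has_ito_integral_def by blast
  let ?X = "\<lambda>m. simple_value (k m) (\<tau> m) (\<xi> m)" and ?J = "\<lambda>m. simple_integral \<beta> (k m) (\<tau> m) (\<xi> m)"
  let ?X' = "\<lambda>m. simple_value (k' m) (\<tau>' m) (\<xi>' m)" and ?J' = "\<lambda>m. simple_integral \<beta> (k' m) (\<tau>' m) (\<xi>' m)"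
  have pX: "pre_ito (?X m) (?J m)" "pre_ito (?X' m) (?J' m)" for m using s s' by (auto intro: simple_process_pre_ito)
  note [measurable] = pre_ito_measurable[OF pX(1)] pre_ito_measurable[OF pX(2)]
  let ?a = "\<lambda>m. sq_dist (?X m) g"
  let ?a' = "\<lambda>m. sq_dist (?X' m) g'"
  let ?b = "\<lambda>m. \<integral>\<^sup>+ w. ennreal ((?J m w - I w)\<^sup>2) \<partial>\<nu>"
  let ?b' = "\<lambda>m. \<integral>\<^sup>+ w. ennreal ((?J' m w - I' w)\<^sup>2) \<partial>\<nu>"
  let ?c = "\<lambda>m. \<integral>\<^sup>+ w. ennreal ((?J' m w - ?J m w - J w)\<^sup>2) \<partial>\<nu>"
  have c: "?c m \<le> 2 * ?a' m + 2 * ?a m" for m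
  proof -
    have "?c m = (\<integral>\<^sup>+ (w, t). ennreal ((norm (?X' m w t - ?X m w t - X w t))\<^sup>2) \<partial>\<P>)"
      by (rule ito_isometry[OF pre_ito_diff[OF pre_ito_diff[OF pX(2) pX(1)] p]])
    also have "\<dots> \<le> (\<integral>\<^sup>+ (w, t). 2 * ennreal ((norm (?X' m w t - g' w t))\<^sup>2) + 2 * ennreal ((norm (?X m w t - g w t))\<^sup>2) \<partial>\<P>)"
    proof (rule nn_integral_mono_AE, use eq in eventually_elim)
      fix x assume "case x of (w, t) \<Rightarrow> g' w t = g w t + X w t"
      moreover obtain w t where x: "x = (w, t)" by (cases x)
      ultimately have e: "?X' m w t - ?X m w t - X w t = (?X' m w t - g' w t) - (?X m w t - g w t)" by simp
      have "ennreal ((norm (?X' m w t - ?X m w t - X w t))\<^sup>2)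
        \<le> ennreal (2 * (norm (?X' m w t - g' w t))\<^sup>2 + 2 * (norm (?X m w t - g w t))\<^sup>2)"
        unfolding e using norm_diff_square_le[of "?X' m w t - g' w t" "?X m w t - g w t" 0] by (intro ennreal_leI) simp
      then show "(case x of (w, t) \<Rightarrow> ennreal ((norm (?X' m w t - ?X m w t - X w t))\<^sup>2))
        \<le> (case x of (w, t) \<Rightarrow> 2 * ennreal ((norm (?X' m w t - g' w t))\<^sup>2) + 2 * ennreal ((norm (?X m w t - g w t))\<^sup>2))"
        by (simp add: x ennreal_mult)
    qed
    also have "\<dots> = 2 * ?a' m + 2 * ?a m"
      unfolding split_beta' by (subst nn_integral_add) (auto simp: nn_integral_cmult)
    finally show ?thesis .
  qed
  have le: "(\<integral>\<^sup>+w. ennreal ((I' w - I w - J w)\<^sup>2) \<partial>\<nu>) \<le> 4 * (?b' m + (2 * ?a' m + 2 * ?a m) + ?b m)" for m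
  proof -
    have "(\<integral>\<^sup>+w. ennreal ((I' w - I w - J w)\<^sup>2) \<partial>\<nu>)
      \<le> (\<integral>\<^sup>+w. 4 * (ennreal ((?J' m w - I' w)\<^sup>2) + ennreal ((?J' m w - ?J m w - J w)\<^sup>2) + ennreal ((?J m w - I w)\<^sup>2)) \<partial>\<nu>)"
    proof (rule nn_integral_mono)
      fix w
      have e: "- (?J' m w - I' w) + (?J' m w - ?J m w - J w) + (?J m w - I w) = I' w - I w - J w" by simp
      have "(I' w - I w - J w)\<^sup>2 \<le> 4 * ((?J' m w - I' w)\<^sup>2 + (?J' m w - ?J m w - J w)\<^sup>2 + (?J m w - I w)\<^sup>2)"
        using norm_sum3_square_le[of "- (?J' m w - I' w)" "?J' m w - ?J m w - J w" "?J m w - I w"]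
        unfolding e by (simp only: real_norm_def power2_abs power2_minus)
      then have "ennreal ((I' w - I w - J w)\<^sup>2) \<le> ennreal (4 * ((?J' m w - I' w)\<^sup>2 + (?J' m w - ?J m w - J w)\<^sup>2 + (?J m w - I w)\<^sup>2))"
        by (rule ennreal_leI)
      then show "ennreal ((I' w - I w - J w)\<^sup>2) \<le> 4 * (ennreal ((?J' m w - I' w)\<^sup>2) + ennreal ((?J' m w - ?J m w - J w)\<^sup>2) + ennreal ((?J m w - I w)\<^sup>2))"
        by (simp add: ennreal_mult)
    qed
    also have "\<dots> = 4 * (?b' m + ?c m + ?b m)" by (simp add: nn_integral_cmult nn_integral_add)
    also have "\<dots> \<le> 4 * (?b' m + (2 * ?a' m + 2 * ?a m) + ?b m)" by (intro mult_left_mono add_mono order_refl c) simp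
    finally show ?thesis .
  qed
  have "(\<lambda>m. 4 * (?b' m + (2 * ?a' m + 2 * ?a m) + ?b m)) \<longlonglongrightarrow> 4 * (0 + (2 * 0 + 2 * 0) + 0)"
    by (intro ennreal_tendsto_cmult tendsto_add J1 J2 X1 X2) auto
  then have "(\<integral>\<^sup>+w. ennreal ((I' w - I w - J w)\<^sup>2) \<partial>\<nu>) \<le> 4 * (0 + (2 * 0 + 2 * 0) + 0)"
    by (rule LIMSEQ_le_const) (use le in blast)
  then have "(\<integral>\<^sup>+w. ennreal ((I' w - I w - J w)\<^sup>2) \<partial>\<nu>) \<le> 0" by simp
  then have "AE w in \<nu>. ennreal ((I' w - I w - J w)\<^sup>2) = 0" by (subst (asm) le_zero_eq, subst (asm) nn_integral_0_iff_AE) auto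
  then show ?thesis by eventually_elim (simp add: ennreal_eq_0_iff)
qed

end

subsection \<open>Bounded drifts and their perturbations\<close>

text \<open>The positive and negative parts of \<open>f\<close> define finite measures on the line
  with the same mass on every half-line \<open>{x<..}\<close>, hence the same measure, and densities
  are unique almost everywhere.\<close>

lemma AE_zero_of_indefinite_integral:
  fixes f :: "real \<Rightarrow> real"
  assumes f: "integrable unit_time f"
    and z: "\<And>t. t \<in> {0..1} \<Longrightarrow> set_lebesgue_integral lborel {0..t} f = 0"
  shows "AE t in unit_time. f t = 0"
proof -
  have [measurable]: "f \<in> borel_measurable unit_time" using f by auto
  have int: "integrable unit_time (\<lambda>s. indicator S s * h s)" if h: "integrable unit_time h" and S: "S \<in> sets borel" for h :: "real \<Rightarrow> real" and S
    using integrable_indicator_unit_time[OF h S] by simp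
  let ?p = "\<lambda>t. max (f t) 0" and ?n = "\<lambda>t. max (- f t) 0"
  have pn: "integrable unit_time ?p" "integrable unit_time ?n" using f by auto
  have id [measurable]: "(\<lambda>t. t) \<in> unit_time \<rightarrow>\<^sub>M borel" by (rule measurable_unit_time_borel) simp
  define M where "M h = distr (density unit_time (\<lambda>t. ennreal (h t))) borel (\<lambda>t. t)" for h :: "real \<Rightarrow> real"
  have eM: "emeasure (M h) S = ennreal (\<integral>s. indicator S s * h s \<partial>unit_time)"
    if h: "integrable unit_time h" "\<And>t. 0 \<le> h t" and S: "S \<in> sets borel" for h S
  proof -
    have [measurable]: "h \<in> borel_measurable unit_time" using h by auto
    have S': "S \<inter> {0..1} \<in> sets unit_time" using S by (auto simp: sets_unit_time sets_restrict_space)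
    have "emeasure (M h) S = emeasure (density unit_time (\<lambda>t. ennreal (h t))) (S \<inter> {0..1})"
      unfolding M_def using S by (subst emeasure_distr) (auto simp: vimage_def Int_def)
    also have "\<dots> = (\<integral>\<^sup>+s. ennreal (h s) * indicator (S \<inter> {0..1}) s \<partial>unit_time)"
      using S' by (rule emeasure_density[rotated]) measurable
    also have "\<dots> = (\<integral>\<^sup>+s. ennreal (indicator S s * h s) \<partial>unit_time)"
      by (intro nn_integral_cong) (auto simp: indicator_def)
    also have "\<dots> = ennreal (\<integral>s. indicator S s * h s \<partial>unit_time)"
      using h S by (intro nn_integral_eq_integral int) auto
    finally show ?thesis .
  qed
  have tail: "(\<integral>s. indicator {x<..} s * f s \<partial>unit_time) = 0" for x
  proof -
    have full: "(\<integral>s. f s \<partial>unit_time) = 0" using z[of 1] by (simp add: integral_unit_time)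
    consider "x < 0" | "x \<in> {0..1}" | "1 < x" by fastforce
    then show ?thesis
    proof cases
      case 1
      then have "(\<integral>s. indicator {x<..} s * f s \<partial>unit_time) = (\<integral>s. f s \<partial>unit_time)"
        by (intro Bochner_Integration.integral_cong) auto
      with full show ?thesis by simp
    next
      case 2
      have "(\<integral>s. indicator {x<..} s * f s \<partial>unit_time) = (\<integral>s. f s - indicator {0..x} s * f s \<partial>unit_time)"
        using 2 by (intro Bochner_Integration.integral_cong) (auto simp: indicator_def)
      also have "\<dots> = 0" using full z[OF 2] int[OF f, of "{0..x}"] 2 f by (simp add: set_integral_unit_time)
      finally show ?thesis .
    next
      case 3
      then have "(\<integral>s. indicator {x<..} s * f s \<partial>unit_time) = (\<integral>s. 0 \<partial>unit_time)"
        by (intro Bochner_Integration.integral_cong) auto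
      then show ?thesis by simp
    qed
  qed
  have "M ?p = M ?n"
  proof (rule measure_eqI_lessThan)
    fix x :: real
    show "emeasure (M ?p) {x<..} < \<infinity>" using pn by (subst eM) auto
    have "(\<integral>s. indicator {x<..} s * ?p s \<partial>unit_time) - (\<integral>s. indicator {x<..} s * ?n s \<partial>unit_time)
      = (\<integral>s. indicator {x<..} s * ?p s - indicator {x<..} s * ?n s \<partial>unit_time)"
      using int[OF pn(1), of "{x<..}"] int[OF pn(2), of "{x<..}"] by simp
    also have "\<dots> = (\<integral>s. indicator {x<..} s * f s \<partial>unit_time)"
      by (intro Bochner_Integration.integral_cong) (auto simp: indicator_def max_def)
    finally have "(\<integral>s. indicator {x<..} s * ?p s \<partial>unit_time) = (\<integral>s. indicator {x<..} s * ?n s \<partial>unit_time)"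
      by (simp add: tail)
    then show "emeasure (M ?p) {x<..} = emeasure (M ?n) {x<..}"
      by (simp add: eM pn)
  qed (auto simp: M_def)
  then have eq: "emeasure (M ?p) S = emeasure (M ?n) S" for S by simp
  have "AE t in unit_time. ennreal (?p t) = ennreal (?n t)"
  proof (rule unit_time.density_unique_finite_measure)
    fix A assume "A \<in> sets unit_time"
    then obtain S where S: "S \<in> sets borel" "A = S \<inter> {0..1}" by (auto simp: sets_unit_time sets_restrict_space)
    have hM: "(\<integral>\<^sup>+t. ennreal (h t) * indicator A t \<partial>unit_time) = emeasure (M h) S"
      if h: "integrable unit_time h" "\<And>t. 0 \<le> h t" for h
    proof -
      have "(\<integral>\<^sup>+t. ennreal (h t) * indicator A t \<partial>unit_time) = (\<integral>\<^sup>+t. ennreal (indicator S t * h t) \<partial>unit_time)"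
        using S by (intro nn_integral_cong) (auto simp: indicator_def)
      also have "\<dots> = emeasure (M h) S"
        using h S by (subst eM) (auto intro!: nn_integral_eq_integral int)
      finally show ?thesis .
    qed
    show "(\<integral>\<^sup>+t. ennreal (?p t) * indicator A t \<partial>unit_time) = (\<integral>\<^sup>+t. ennreal (?n t) * indicator A t \<partial>unit_time)"
      unfolding hM[OF pn(1) max.cobounded2] hM[OF pn(2) max.cobounded2] by (rule eq)
  qed auto
  then show ?thesis by eventually_elim (auto simp: max_def split: if_splits)
qed

section \<open>Cameron-Martin densities: uniqueness and sums\<close>

lemma has_cm_density_integrable:
  assumes "has_cm_density h \<gamma>" shows "integrable unit_time \<gamma>"
proof (rule Bochner_Integration.integrable_bound)
  show "integrable unit_time (\<lambda>s. 1 + (norm (\<gamma> s))\<^sup>2)" "\<gamma> \<in> borel_measurable unit_time"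
    using assms by (auto simp: has_cm_density_def)
  have "x \<le> 1 + x\<^sup>2" for x :: real
  proof -
    have "2 * x \<le> x\<^sup>2 + 1" using zero_le_power2[of "x - 1"] by (simp add: power2_diff)
    moreover have "0 \<le> x\<^sup>2" by simp
    ultimately show ?thesis by linarith
  qed
  then show "AE s in unit_time. norm (\<gamma> s) \<le> norm (1 + (norm (\<gamma> s))\<^sup>2)" by (auto simp: abs_of_nonneg)
qed

lemma has_cm_density_unique:
  fixes \<gamma> \<gamma>' :: "real \<Rightarrow> real ^ 'n::finite"
  assumes h: "has_cm_density h \<gamma>" "has_cm_density h \<gamma>'"
  shows "AE t in unit_time. \<gamma> t = \<gamma>' t"
proof -
  note i = has_cm_density_integrable[OF h(1)] has_cm_density_integrable[OF h(2)]
  have ii: "integrable unit_time (\<lambda>s. indicator {0..t} s *\<^sub>R k s)" if "integrable unit_time k" for k :: "real \<Rightarrow> real ^ 'n" and t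
    using that by (rule integrable_indicator_unit_time) simp
  have "AE t in unit_time. (\<gamma> t - \<gamma>' t) $ j = 0" for j
  proof (rule AE_zero_of_indefinite_integral)
    show "integrable unit_time (\<lambda>t. (\<gamma> t - \<gamma>' t) $ j)"
      using i by (intro integrable_bounded_linear[OF bounded_linear_vec_nth]) auto
    fix t :: real assume t: "t \<in> {0..1}"
    have "set_lebesgue_integral lborel {0..t} (\<lambda>t. (\<gamma> t - \<gamma>' t) $ j)
      = (\<integral>s. (indicator {0..t} s *\<^sub>R \<gamma> s - indicator {0..t} s *\<^sub>R \<gamma>' s) $ j \<partial>unit_time)"
      using t by (simp add: set_integral_unit_time algebra_simps)
    also have "\<dots> = (\<integral>s. indicator {0..t} s *\<^sub>R \<gamma> s - indicator {0..t} s *\<^sub>R \<gamma>' s \<partial>unit_time) $ j"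
      using ii i by (intro integral_bounded_linear[OF bounded_linear_vec_nth]) auto
    also have "\<dots> = 0"
      using h t ii i by (simp add: has_cm_density_def set_integral_unit_time)
    finally show "set_lebesgue_integral lborel {0..t} (\<lambda>t. (\<gamma> t - \<gamma>' t) $ j) = 0" .
  qed
  then have "AE t in unit_time. \<forall>j\<in>UNIV. (\<gamma> t - \<gamma>' t) $ j = 0" by (subst AE_ball_countable) auto
  then show ?thesis by eventually_elim (simp add: vec_eq_iff)
qed

lemma has_cm_density_add:
  assumes h: "has_cm_density h g" "has_cm_density h' g'"
  shows "has_cm_density (h + h') (\<lambda>t. g t + g' t)"
proof -
  note i = has_cm_density_integrable[OF h(1)] has_cm_density_integrable[OF h(2)]
  have [measurable]: "g \<in> borel_measurable unit_time" "g' \<in> borel_measurable unit_time" using h by (auto simp: has_cm_density_def)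
  have ii: "integrable unit_time (\<lambda>s. indicator {0..t} s *\<^sub>R k s)" if "integrable unit_time k" for k :: "real \<Rightarrow> real ^ 'a" and t
    using that by (rule integrable_indicator_unit_time) simp
  have sq: "integrable unit_time (\<lambda>s. (norm (g s + g' s))\<^sup>2)"
  proof (rule Bochner_Integration.integrable_bound)
    show "integrable unit_time (\<lambda>s. 2 * (norm (g s))\<^sup>2 + 2 * (norm (g' s))\<^sup>2)" using h by (auto simp: has_cm_density_def)
    show "AE s in unit_time. norm ((norm (g s + g' s))\<^sup>2) \<le> norm (2 * (norm (g s))\<^sup>2 + 2 * (norm (g' s))\<^sup>2)"
      using norm_diff_square_le[of "g s" "- g' s" 0 for s] by (intro AE_I2) simp
  qed measurable
  show ?thesis
    unfolding has_cm_density_def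
  proof (intro conjI ballI sq)
    fix t :: real assume t: "t \<in> {0..1}"
    show "path_val (h + h') t = set_lebesgue_integral lborel {0..t} (\<lambda>t. g t + g' t)"
      using h t ii i by (simp add: has_cm_density_def plus_cpath.rep_eq set_integral_unit_time scaleR_add_right)
  qed measurable
qed

lemma has_cm_density_uminus:
  assumes h: "has_cm_density h g"
  shows "has_cm_density (- h) (\<lambda>t. - g t)"
  using assms by (auto simp: has_cm_density_def uminus_cpath.rep_eq set_lebesgue_integral_def)

lemma has_cm_density_zero: "has_cm_density 0 (\<lambda>t. 0)"
  by (auto simp: has_cm_density_def zero_cpath.rep_eq set_lebesgue_integral_def)

text \<open>For \<open>0 \<le> s \<le> r \<le> 1\<close> this is the path that moves with constant
  velocity \<open>a\<close> during \<open>(s, r]\<close> and rests at the other times of the unit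
  interval.\<close>

definition ramp :: "real \<Rightarrow> real \<Rightarrow> real ^ 'n::finite \<Rightarrow> 'n cpath" where
  "ramp s r a = Cpath (\<lambda>t. if t \<in> {0..1} then (min (max t s) r - s) *\<^sub>R a else 0)"

lemma path_val_ramp:
  "path_val (ramp s r a) t = (if t \<in> {0..1} then (min (max t s) r - s) *\<^sub>R a else 0)"
proof -
  let ?f = "\<lambda>t. if t \<in> {0..1} then (min (max t s) r - s) *\<^sub>R a else 0"
  have "continuous_on {0..1} (\<lambda>t. (min (max t s) r - s) *\<^sub>R a)" by (intro continuous_intros)
  then have "continuous_on {0..1} ?f" by (rule continuous_on_eq) simp
  then have "?f \<in> {f. continuous_on {0..1} f \<and> (\<forall>t. t \<notin> {0..1} \<longrightarrow> f t = 0)}" by auto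
  from Cpath_inverse[OF this] show ?thesis by (simp add: ramp_def)
qed

lemma has_cm_density_ramp:
  assumes "0 \<le> s" "s \<le> r" "r \<le> 1"
  shows "has_cm_density (ramp s r a) (\<lambda>t. indicator {s<..r} t *\<^sub>R a)"
  unfolding has_cm_density_def
proof (intro conjI ballI)
  show m: "(\<lambda>t. indicator {s<..r} t *\<^sub>R a) \<in> borel_measurable unit_time" by measurable
  show "integrable unit_time (\<lambda>t. (norm (indicator {s<..r} t *\<^sub>R a))\<^sup>2)"
  proof (rule unit_time.integrable_const_bound[where B="(norm a)\<^sup>2"])
    show "(\<lambda>t. (norm (indicator {s<..r} t *\<^sub>R a))\<^sup>2) \<in> borel_measurable unit_time" by measurable
  qed (auto simp: indicator_def)
  fix t :: real assume t: "t \<in> {0..1}"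
  have "set_lebesgue_integral lborel {0..t} (\<lambda>t. indicator {s<..r} t *\<^sub>R a) = (\<integral>x. indicator {s<..min (max t s) r} x *\<^sub>R a \<partial>lborel)"
    unfolding set_lebesgue_integral_def using assms
    by (intro Bochner_Integration.integral_cong) (auto simp: indicator_def)
  also have "\<dots> = (min (max t s) r - s) *\<^sub>R a" using assms by (subst integral_scaleR_left) auto
  finally show "path_val (ramp s r a) t = set_lebesgue_integral lborel {0..t} (\<lambda>t. indicator {s<..r} t *\<^sub>R a)"
    using t by (simp add: path_val_ramp)
qed

context path_brownian
begin

lemma AE_pair_unit_timeI:
  assumes "AE w in \<nu>. AE t in unit_time. g w t = (g' w t :: real ^ 'n)"
    and [measurable]: "(\<lambda>(w, t). g w t) \<in> borel_measurable \<P>" "(\<lambda>(w, t). g' w t) \<in> borel_measurable \<P>"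
  shows "AE (w, t) in \<P>. g w t = g' w t"
proof -
  interpret MT: pair_prob_space \<nu> unit_time ..
  have "AE x in \<P>. g (fst x) (snd x) - g' (fst x) (snd x) = 0"
  proof (rule MT.AE_pair_measure)
    show "{x \<in> space \<P>. g (fst x) (snd x) - g' (fst x) (snd x) = 0} \<in> sets \<P>"
      by measurable
  qed (use assms(1) in auto)
  then show ?thesis by eventually_elim (simp add: split_beta)
qed

lemma adapted_density_unique:
  assumes g: "adapted_density \<nu> u g" "adapted_density \<nu> u g'"
  shows "AE (w, t) in \<P>. g w t = g' w t"
proof (rule AE_pair_unit_timeI)
  have "AE w in \<nu>. has_cm_density (u w) (g w)" "AE w in \<nu>. has_cm_density (u w) (g' w)"
    using g by (auto simp: adapted_density_def)
  then show "AE w in \<nu>. AE t in unit_time. g w t = g' w t"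
    by eventually_elim (rule has_cm_density_unique)
qed (use g in \<open>auto simp: adapted_density_def\<close>)

text \<open>\<open>cm_dot\<close> is a choice among the adapted densities; by uniqueness any one of
  them determines it up to a null set of the product, so boundedness may be checked on whichever
  density is at hand.\<close>

lemma bounded_driftsI:
  assumes u: "u \<in> \<nu> \<rightarrow>\<^sub>M path_borel" "\<And>w. u w \<in> cameron_martin" "adapted_density \<nu> u g"
    and C: "AE (w, t) in \<P>. norm (g w t) \<le> C"
  shows "u \<in> bounded_drifts \<nu>" "AE (w, t) in \<P>. cm_dot \<nu> u w t = g w t"
proof -
  have "adapted_density \<nu> u (cm_dot \<nu> u)" unfolding cm_dot_def by (rule someI[of "adapted_density \<nu> u", OF u(3)])
  from adapted_density_unique[OF this u(3)]
  show eq: "AE (w, t) in \<P>. cm_dot \<nu> u w t = g w t" .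
  have "AE (w, t) in \<P>. norm (cm_dot \<nu> u w t) \<le> C"
    using eq C by eventually_elim auto
  with u show "u \<in> bounded_drifts \<nu>" unfolding bounded_drifts_def L0_adapted_def by blast
qed

text \<open>The last clause certifies that the chosen \<open>divergence\<close> really is an Ito
  integral, which rests on existence for bounded densities.\<close>

lemma bounded_driftsD:
  assumes u: "u \<in> bounded_drifts \<nu>"
  shows "u \<in> \<nu> \<rightarrow>\<^sub>M path_borel" "\<And>w. u w \<in> cameron_martin" "adapted_density \<nu> u (cm_dot \<nu> u)"
    "\<exists>C\<ge>0. AE (w, t) in \<P>. norm (cm_dot \<nu> u w t) \<le> C"
    "has_ito_integral \<nu> \<F> \<beta> (cm_dot \<nu> u) (divergence \<nu> \<beta> u)"
proof -
  show "u \<in> \<nu> \<rightarrow>\<^sub>M path_borel" "\<And>w. u w \<in> cameron_martin" using u by (auto simp: bounded_drifts_def L0_adapted_def)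
  show a: "adapted_density \<nu> u (cm_dot \<nu> u)"
    using u unfolding bounded_drifts_def L0_adapted_def cm_dot_def by (auto intro: someI[of "adapted_density \<nu> u"])
  obtain C where C: "AE (w, t) in \<P>. norm (cm_dot \<nu> u w t) \<le> C"
    using u by (auto simp: bounded_drifts_def)
  then have "AE (w, t) in \<P>. norm (cm_dot \<nu> u w t) \<le> max C 0" by eventually_elim auto
  then show "\<exists>C\<ge>0. AE (w, t) in \<P>. norm (cm_dot \<nu> u w t) \<le> C" by (intro exI[of _ "max C 0"]) simp
  show "has_ito_integral \<nu> \<F> \<beta> (cm_dot \<nu> u) (divergence \<nu> \<beta> u)"
    using has_ito_integral_exists[OF a C] unfolding divergence_def by (rule someI_ex)
qed

lemma cm_dot_measurable:
  "u \<in> bounded_drifts \<nu> \<Longrightarrow> (\<lambda>(w, t). cm_dot \<nu> u w t) \<in> borel_measurable \<P>"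
  using bounded_driftsD(3) by (auto simp: adapted_density_def)

lemma girsanov_weight_measurable:
  assumes u: "u \<in> bounded_drifts \<nu>"
  shows "girsanov_weight \<nu> \<beta> u \<in> borel_measurable \<nu>"
proof -
  have [measurable]: "divergence \<nu> \<beta> u \<in> borel_measurable \<nu>"
    using bounded_driftsD(5)[OF u] by (simp add: has_ito_integral_def)
  note cm_dot_measurable[OF u, measurable]
  show ?thesis unfolding girsanov_weight_def by measurable
qed

lemma girsanov_weight_pos: "0 < girsanov_weight \<nu> \<beta> u w"
  by (simp add: girsanov_weight_def)

lemma bounded_drift_adapted:
  "u \<in> bounded_drifts \<nu> \<Longrightarrow> t \<in> {0..1} \<Longrightarrow> (\<lambda>w. path_val (u w) t) \<in> borel_measurable (\<F> t)"
  using drift_adapted bounded_driftsD(3,4) by metis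

definition kick :: "('n cpath \<Rightarrow> 'n cpath) \<Rightarrow> 'n cpath set \<Rightarrow> real \<Rightarrow> real \<Rightarrow> real ^ 'n \<Rightarrow> 'n cpath \<Rightarrow> 'n cpath" where
  "kick u A s r a w = u w + (if w \<in> A then ramp s r a else 0)"

text \<open>Since \<open>A \<in> sets (\<F> s)\<close>, the added density is an elementary adapted
  integrand. On \<open>A\<close> the stochastic integral grows by \<open>a\<close> paired with the
  increment of \<open>\<beta>\<close>, and the energy by twice \<open>a\<close> paired with the
  increment of \<open>u\<close> plus a square term. After the factor 1/2 the two linear terms
  combine into the increment of \<open>\<beta> + u\<close>.\<close>

lemma kick:
  assumes u: "u \<in> bounded_drifts \<nu>" and sr: "0 \<le> s" "s < r" "r \<le> 1" and A: "A \<in> sets (\<F> s)"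
  shows kick_bounded_drifts: "kick u A s r a \<in> bounded_drifts \<nu>"
    and kick_weight: "AE w in \<nu>. girsanov_weight \<nu> \<beta> (kick u A s r a) w = girsanov_weight \<nu> \<beta> u w *
      (if w \<in> A then exp (- (a \<bullet> (path_val (\<beta> w + u w) r - path_val (\<beta> w + u w) s)) - (norm a)\<^sup>2 * (r - s) / 2) else 1)"
proof -
  interpret MT: pair_prob_space \<nu> unit_time ..
  let ?g = "cm_dot \<nu> u" and ?\<xi> = "\<lambda>w. indicator A w *\<^sub>R a" and ?k = "kick u A s r a"
  note uD = bounded_driftsD[OF u]
  obtain C where C: "AE (w, t) in \<P>. norm (?g w t) \<le> C" using uD(4) by blast
  have sr': "s \<in> {0..1}" "r \<in> {0..1}" using sr by auto
  have A\<nu>: "A \<in> sets \<nu>" using A sub[OF sr'(1)] by (auto simp: subalgebra_def)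
  have \<xi>F: "?\<xi> \<in> borel_measurable (\<F> s)" using A by simp
  have p: "pre_ito (step_process s r ?\<xi>) (step_integral s r ?\<xi>)"
    using sr \<xi>F by (intro pre_ito.elem) (auto simp: bounded_iff indicator_def intro!: exI[of _ "norm a"])
  note [measurable] = pre_ito_measurable(2)[OF p] cm_dot_measurable[OF u] uD(1)
  let ?h = "\<lambda>w t. ?g w t + step_process s r ?\<xi> w t"
  have dens: "has_cm_density (?k w) (?h w)" if "has_cm_density (u w) (?g w)" for w
  proof (cases "w \<in> A")
    case True
    then show ?thesis using has_cm_density_add[OF that has_cm_density_ramp[of s r a]] sr by (simp add: kick_def step_process_def)
  next
    case False
    then show ?thesis using has_cm_density_add[OF that has_cm_density_zero] by (simp add: kick_def step_process_def)
  qed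
  have ad: "adapted_density \<nu> ?k ?h"
    unfolding adapted_density_def
  proof (intro conjI ballI)
    show "(\<lambda>(w, t). ?h w t) \<in> borel_measurable \<P>" by measurable
    show "AE w in \<nu>. has_cm_density (?k w) (?h w)"
      using uD(3) unfolding adapted_density_def by (auto intro: dens elim: eventually_mono)
    fix t :: real assume t: "t \<in> {0..1}"
    have g: "(\<lambda>w. ?g w t) \<in> borel_measurable (\<F> t)" using uD(3) t by (auto simp: adapted_density_def)
    have "(\<lambda>w. step_process s r ?\<xi> w t) \<in> borel_measurable (\<F> t)"
    proof (cases "t \<in> {s<..r}")
      case True
      then have "?\<xi> \<in> borel_measurable (\<F> t)" using \<xi>F sr t by (intro measurable_F_mono[OF _ _ _ \<xi>F]) auto
      then show ?thesis unfolding step_process_def by measurable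
    qed (simp add: step_process_def)
    with g show "(\<lambda>w. ?h w t) \<in> borel_measurable (\<F> t)" by measurable
  qed
  have m: "?k \<in> \<nu> \<rightarrow>\<^sub>M path_borel" unfolding kick_def using A\<nu> by measurable
  have cm: "?k w \<in> cameron_martin" for w
  proof -
    obtain g where g: "has_cm_density (u w) g" using uD(2)[of w] by (auto simp: cameron_martin_def)
    show ?thesis
      using has_cm_density_add[OF g has_cm_density_ramp[of s r a]] has_cm_density_add[OF g has_cm_density_zero] sr
      by (auto simp: kick_def cameron_martin_def)
  qed
  have bd: "AE (w, t) in \<P>. norm (?h w t) \<le> C + norm a"
    using C
  proof eventually_elim
    case (elim x)
    obtain w t where x: "x = (w, t)" by (cases x)
    have "norm (step_process s r ?\<xi> w t) \<le> norm a" by (auto simp: step_process_def indicator_def)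
    then show ?case using elim norm_triangle_ineq[of "?g w t" "step_process s r ?\<xi> w t"] by (simp add: x)
  qed
  note k = bounded_driftsI[OF m cm ad bd]
  show "kick u A s r a \<in> bounded_drifts \<nu>" by (rule k(1))
  note kD = bounded_driftsD[OF k(1)]
  have div: "AE w in \<nu>. divergence \<nu> \<beta> ?k w = divergence \<nu> \<beta> u w + step_integral s r ?\<xi> w"
    by (rule ito_integral_perturb[OF uD(5) kD(5) p cm_dot_measurable[OF u] cm_dot_measurable[OF k(1)] k(2)])
  have dot: "AE w in \<nu>. AE t in unit_time. cm_dot \<nu> ?k w t = ?h w t"
    using MT.AE_pair[OF k(2)] by simp
  have cmk: "AE w in \<nu>. cm_dot \<nu> ?k w \<in> borel_measurable unit_time"
    using kD(3) by (auto simp: adapted_density_def has_cm_density_def elim: eventually_mono)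
  have cmu: "AE w in \<nu>. has_cm_density (u w) (?g w)" using uD(3) by (simp add: adapted_density_def)
  show "AE w in \<nu>. girsanov_weight \<nu> \<beta> ?k w = girsanov_weight \<nu> \<beta> u w *
      (if w \<in> A then exp (- (a \<bullet> (path_val (\<beta> w + u w) r - path_val (\<beta> w + u w) s)) - (norm a)\<^sup>2 * (r - s) / 2) else 1)"
    using div dot cmk cmu
  proof eventually_elim
    case (elim w)
    note gi = has_cm_density_integrable[OF elim(4)]
    have [measurable]: "?g w \<in> borel_measurable unit_time"
      using elim(4) by (auto simp: has_cm_density_def)
    note elim(3)[measurable]
    have sqi: "integrable unit_time (\<lambda>t. (norm (?g w t))\<^sup>2)" using elim(4) by (simp add: has_cm_density_def)
    have "(\<integral>t. (norm (cm_dot \<nu> ?k w t))\<^sup>2 \<partial>unit_time) = (\<integral>t. (norm (?h w t))\<^sup>2 \<partial>unit_time)"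
    proof (rule integral_cong_AE)
      show "(\<lambda>t. (norm (?h w t))\<^sup>2) \<in> borel_measurable unit_time" unfolding step_process_def by measurable
      show "AE t in unit_time. (norm (cm_dot \<nu> ?k w t))\<^sup>2 = (norm (?h w t))\<^sup>2" using elim(2) by eventually_elim simp
    qed measurable
    also have "\<dots> = (\<integral>t. (norm (?g w t))\<^sup>2 \<partial>unit_time) + (if w \<in> A then 2 * (a \<bullet> (path_val (u w) r - path_val (u w) s)) + (norm a)\<^sup>2 * (r - s) else 0)"
    proof (cases "w \<in> A")
      case True
      have e: "(norm (?h w t))\<^sup>2 = (norm (?g w t))\<^sup>2 + 2 * (a \<bullet> (indicator {s<..r} t *\<^sub>R ?g w t)) + (norm a)\<^sup>2 * indicator {s<..r} t" for t
        using True unfolding power2_norm_eq_inner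
        by (auto simp: step_process_def indicator_def inner_add_left inner_add_right inner_commute)
      have i1: "integrable unit_time (\<lambda>t. indicator {s<..r} t *\<^sub>R ?g w t)"
        using gi by (rule integrable_indicator_unit_time) simp
      have i2: "integrable unit_time (\<lambda>t. indicator {s<..r} t :: real)"
        using integrable_indicator_unit_time[of "\<lambda>_. 1 :: real" "{s<..r}"] by simp
      have "path_val (u w) r - path_val (u w) s = (\<integral>t. indicator {s<..r} t *\<^sub>R ?g w t \<partial>unit_time)"
        using elim(4) sr by (intro interval_increment gi) (auto simp: has_cm_density_def)
      moreover have "(\<integral>t. indicator {s<..r} t \<partial>unit_time) = r - s"
        using sr by (intro integral_indicator_unit_time) auto
      ultimately show ?thesis
        unfolding e using True sqi i1 i2
        by (simp del: Bochner_Integration.integral_indicator inner_scaleR_right)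
    qed (simp add: step_process_def)
    finally show ?case
      unfolding girsanov_weight_def elim(1)
      by (auto simp: step_integral_def plus_cpath.rep_eq exp_add[symmetric] inner_diff_right inner_add_right
          algebra_simps add_divide_distrib diff_divide_distrib)
  qed
qed

end

subsection \<open>Gaussian increments and the Markov property\<close>

lemma gauss_density_eq:
  fixes x :: "real ^ 'n::finite"
  assumes "\<delta> > 0"
  shows "(\<Prod>i\<in>UNIV. normal_density 0 (sqrt \<delta>) (x $ i)) = (1 / sqrt (2 * pi * \<delta>)) ^ CARD('n) * exp (- (norm x)\<^sup>2 / (2 * \<delta>))"
proof -
  have "(\<Prod>i\<in>(UNIV :: 'n set). normal_density 0 (sqrt \<delta>) (x $ i))
    = (\<Prod>i\<in>(UNIV :: 'n set). (1 / sqrt (2 * pi * \<delta>))) * (\<Prod>i\<in>(UNIV :: 'n set). exp (- (x $ i)\<^sup>2 / (2 * \<delta>)))"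
    using assms by (subst prod.distrib[symmetric]) (simp add: normal_density_def)
  also have "(\<Prod>i\<in>(UNIV :: 'n set). exp (- (x $ i)\<^sup>2 / (2 * \<delta>))) = exp (\<Sum>i\<in>(UNIV :: 'n set). - (x $ i)\<^sup>2 / (2 * \<delta>))"
    by (simp add: exp_sum)
  also have "(\<Sum>i\<in>(UNIV :: 'n set). - (x $ i)\<^sup>2 / (2 * \<delta>)) = - (norm x)\<^sup>2 / (2 * \<delta>)"
    unfolding power2_norm_eq_inner inner_vec_def
    by (simp add: power2_eq_square sum_negf sum_divide_distrib)
  finally show ?thesis by simp
qed

text \<open>Cameron-Martin quasi-invariance characterises the Gaussian law up to a factor: average the
  invariance over \<open>a\<close> with respect to the Gaussian law itself and exchange the integrals.\<close>

lemma gauss_vec_characterization: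
  fixes m :: "(real ^ 'n::finite) measure"
  assumes m: "finite_measure m" and sm [measurable_cong, simp]: "sets m = sets borel" and \<delta>: "\<delta> > 0"
    and inv: "\<And>a \<phi>. \<phi> \<in> borel_measurable borel \<Longrightarrow>
      (\<integral>\<^sup>+x. \<phi> x \<partial>m) = (\<integral>\<^sup>+x. ennreal (exp (- (a \<bullet> x) - (norm a)\<^sup>2 * \<delta> / 2)) * \<phi> (x + \<delta> *\<^sub>R a) \<partial>m)"
    and D [measurable]: "D \<in> sets borel"
  shows "emeasure m D = emeasure m UNIV * emeasure (gauss_vec \<delta>) D"
proof -
  interpret m: finite_measure m by fact
  interpret pair_sigma_finite lborel m
    by (intro pair_sigma_finite.intro m.sigma_finite_measure_axioms) (rule sigma_finite_lborel)
  have sp: "space m = UNIV" using sets_eq_imp_space_eq[OF sm] by simp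
  define K where "K = (1 / sqrt (2 * pi * \<delta>)) ^ CARD('n)"
  have K: "0 \<le> K" using \<delta> by (simp add: K_def)
  define p where "p x = K * exp (- (norm x)\<^sup>2 / (2 * \<delta>))" for x :: "real ^ 'n"
  have p0: "0 \<le> p x" for x using K by (simp add: p_def)
  have pm [measurable]: "p \<in> borel_measurable borel" unfolding p_def[abs_def] by measurable
  have G: "gauss_vec \<delta> = density lborel (\<lambda>x. ennreal (p x))"
    unfolding gauss_vec_def p_def K_def by (subst gauss_density_eq[OF \<delta>]) simp
  have p1: "(\<integral>\<^sup>+y. ennreal (p y) \<partial>lborel) = 1"
  proof -
    have "emeasure (gauss_vec \<delta> :: (real ^ 'n) measure) UNIV = 1"
      using prob_space.emeasure_space_1[OF prob_space_gauss_vec[OF \<delta>]] by simp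
    then show ?thesis unfolding G by (simp add: emeasure_density)
  qed
  \<comment> \<open>Invariance with test function 1 and \<open>a = - y / \<delta>\<close> yields the
    Laplace transform of \<open>m\<close>.\<close>
  have c: "(\<integral>\<^sup>+x. ennreal (exp ((x \<bullet> y) / \<delta>)) \<partial>m) = ennreal (exp ((norm y)\<^sup>2 / (2 * \<delta>))) * emeasure m UNIV" for y
  proof -
    have "emeasure m UNIV = (\<integral>\<^sup>+x. 1 \<partial>m)" using sp by simp
    also have "\<dots> = (\<integral>\<^sup>+x. ennreal (exp (- ((- (1 / \<delta>) *\<^sub>R y) \<bullet> x) - (norm (- (1 / \<delta>) *\<^sub>R y))\<^sup>2 * \<delta> / 2)) * 1 \<partial>m)"
      by (rule inv) simp
    also have "\<dots> = (\<integral>\<^sup>+x. ennreal (exp (- (norm y)\<^sup>2 / (2 * \<delta>))) * ennreal (exp ((x \<bullet> y) / \<delta>)) \<partial>m)"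
      using \<delta> by (intro nn_integral_cong)
        (simp add: ennreal_mult[symmetric] exp_add[symmetric] power_mult_distrib power2_eq_square inner_commute field_simps)
    also have "\<dots> = ennreal (exp (- (norm y)\<^sup>2 / (2 * \<delta>))) * (\<integral>\<^sup>+x. ennreal (exp ((x \<bullet> y) / \<delta>)) \<partial>m)"
      by (rule nn_integral_cmult) measurable
    finally have "ennreal (exp ((norm y)\<^sup>2 / (2 * \<delta>))) * emeasure m UNIV
      = (ennreal (exp ((norm y)\<^sup>2 / (2 * \<delta>))) * ennreal (exp (- (norm y)\<^sup>2 / (2 * \<delta>)))) * (\<integral>\<^sup>+x. ennreal (exp ((x \<bullet> y) / \<delta>)) \<partial>m)"
      by (simp add: mult.assoc)
    also have "ennreal (exp ((norm y)\<^sup>2 / (2 * \<delta>))) * ennreal (exp (- (norm y)\<^sup>2 / (2 * \<delta>))) = 1"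
      by (simp add: ennreal_mult[symmetric] exp_add[symmetric])
    finally show ?thesis by simp
  qed
  \<comment> \<open>Invariance for the indicator of \<open>D\<close> with
    \<open>a = y / \<delta>\<close>, so that the translation \<open>\<delta> *\<^sub>R a\<close> is
    \<open>y\<close> itself.\<close>
  let ?I = "\<lambda>y. (\<integral>\<^sup>+x. ennreal (exp (- (((1 / \<delta>) *\<^sub>R y) \<bullet> x) - (norm ((1 / \<delta>) *\<^sub>R y))\<^sup>2 * \<delta> / 2)) * indicator D (x + \<delta> *\<^sub>R ((1 / \<delta>) *\<^sub>R y)) \<partial>m)"
  let ?J = "\<lambda>x y. ennreal (p y * exp (- (y \<bullet> x) / \<delta> - (norm y)\<^sup>2 / (2 * \<delta>))) * indicator D (x + y)"
  \<comment> \<open>\<open>?J x y\<close> equals \<open>?K x (x + y)\<close>: after the translation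
    the indicator no longer involves \<open>x\<close>, which remains only in an exponential whose
    integral is given by \<open>c\<close>.\<close>
  let ?K = "\<lambda>x y. ennreal (K * exp (- (norm y)\<^sup>2 / \<delta>)) * ennreal (exp ((x \<bullet> y) / \<delta>)) * indicator D y"
  have "emeasure m D = (\<integral>\<^sup>+y. ennreal (p y) * (\<integral>\<^sup>+x. indicator D x \<partial>m) \<partial>lborel)"
    by (simp add: nn_integral_multc p1)
  also have "\<dots> = (\<integral>\<^sup>+y. ennreal (p y) * ?I y \<partial>lborel)"
    by (intro nn_integral_cong arg_cong2[where f="(*)"] refl inv) measurable
  also have "\<dots> = (\<integral>\<^sup>+y. (\<integral>\<^sup>+x. ?J x y \<partial>m) \<partial>lborel)"
  proof (rule nn_integral_cong)
    fix y :: "real ^ 'n"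
    have "ennreal (p y) * ?I y
      = (\<integral>\<^sup>+x. ennreal (p y) * (ennreal (exp (- (((1 / \<delta>) *\<^sub>R y) \<bullet> x) - (norm ((1 / \<delta>) *\<^sub>R y))\<^sup>2 * \<delta> / 2)) * indicator D (x + \<delta> *\<^sub>R ((1 / \<delta>) *\<^sub>R y))) \<partial>m)"
      by (rule nn_integral_cmult[symmetric]) measurable
    also have "\<dots> = (\<integral>\<^sup>+x. ?J x y \<partial>m)"
      using \<delta> p0 by (intro nn_integral_cong)
        (simp add: ennreal_mult mult.assoc power_mult_distrib power2_eq_square mult.commute[of 2 \<delta>])
    finally show "ennreal (p y) * ?I y
      = (\<integral>\<^sup>+x. ?J x y \<partial>m)" .
  qed
  also have "\<dots> = (\<integral>\<^sup>+x. (\<integral>\<^sup>+y. ?J x y \<partial>lborel) \<partial>m)"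
    by (rule Fubini'[symmetric]) measurable
  also have "\<dots> = (\<integral>\<^sup>+x. (\<integral>\<^sup>+y. ?K x y \<partial>lborel) \<partial>m)"
  proof (rule nn_integral_cong)
    fix x
    have "(\<integral>\<^sup>+y. ?K x y \<partial>lborel) = (\<integral>\<^sup>+y. ?K x y \<partial>distr lborel borel ((+) x))" by (simp add: lborel_distr_plus)
    also have "\<dots> = (\<integral>\<^sup>+y. ?K x (x + y) \<partial>lborel)" by (rule nn_integral_distr) measurable
    also have "\<dots> = (\<integral>\<^sup>+y. ?J x y \<partial>lborel)"
    proof (rule nn_integral_cong)
      fix y
      have "exp (- (norm (x + y))\<^sup>2 / \<delta>) * exp ((x \<bullet> (x + y)) / \<delta>)
        = exp (- (norm y)\<^sup>2 / (2 * \<delta>)) * exp (- (y \<bullet> x) / \<delta> - (norm y)\<^sup>2 / (2 * \<delta>))"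
        using \<delta> unfolding exp_add[symmetric] power2_norm_eq_inner
        by (simp add: inner_add_left inner_add_right inner_commute field_simps)
      then show "?K x (x + y) = ?J x y"
        using K by (simp add: p_def ennreal_mult[symmetric] mult.assoc)
    qed
    finally show "(\<integral>\<^sup>+y. ?J x y \<partial>lborel) = (\<integral>\<^sup>+y. ?K x y \<partial>lborel)"
      by simp
  qed
  also have "\<dots> = (\<integral>\<^sup>+y. (\<integral>\<^sup>+x. ?K x y \<partial>m) \<partial>lborel)"
    by (rule Fubini') measurable
  also have "\<dots> = (\<integral>\<^sup>+y. emeasure m UNIV * (ennreal (p y) * indicator D y) \<partial>lborel)"
  proof (rule nn_integral_cong)
    fix y :: "real ^ 'n"
    have "(\<integral>\<^sup>+x. ?K x y \<partial>m)
      = (\<integral>\<^sup>+x. (ennreal (K * exp (- (norm y)\<^sup>2 / \<delta>)) * indicator D y) * ennreal (exp ((x \<bullet> y) / \<delta>)) \<partial>m)"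
      by (simp add: mult_ac)
    also have "\<dots> = (ennreal (K * exp (- (norm y)\<^sup>2 / \<delta>)) * indicator D y) * (ennreal (exp ((norm y)\<^sup>2 / (2 * \<delta>))) * emeasure m UNIV)"
      by (subst nn_integral_cmult) (auto simp: c)
    also have "\<dots> = emeasure m UNIV * ((ennreal (K * exp (- (norm y)\<^sup>2 / \<delta>)) * ennreal (exp ((norm y)\<^sup>2 / (2 * \<delta>)))) * indicator D y)"
      by (simp add: mult_ac)
    also have "ennreal (K * exp (- (norm y)\<^sup>2 / \<delta>)) * ennreal (exp ((norm y)\<^sup>2 / (2 * \<delta>))) = ennreal (p y)"
      using K \<delta> by (simp add: ennreal_mult[symmetric] p_def mult.assoc exp_add[symmetric] field_simps)
    finally show "(\<integral>\<^sup>+x. ?K x y \<partial>m)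
      = emeasure m UNIV * (ennreal (p y) * indicator D y)" .
  qed
  also have "\<dots> = emeasure m UNIV * emeasure (gauss_vec \<delta>) D"
    by (simp add: nn_integral_cmult G emeasure_density)
  finally show ?thesis .
qed

context gauss_increments
begin

text \<open>The function \<open>G\<close> is chosen before \<open>X\<close>, so that a single
  \<open>G\<close> serves all weights measurable at time \<open>t\<close>. In the induction the
  earliest time is split off: the later factors become a function of \<open>B\<close> at that time,
  which is then averaged over the Gaussian increment since \<open>t\<close>.\<close>

lemma markov:
  fixes f :: "real \<Rightarrow> real ^ 'n \<Rightarrow> ennreal"
  assumes J: "finite J" "J \<subseteq> {t..1}" "0 \<le> t" "t \<le> 1" and f: "\<And>j. f j \<in> borel_measurable borel"
  shows "\<exists>G\<in>borel_measurable borel. \<forall>X\<in>borel_measurable (F t).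
    (\<integral>\<^sup>+w. X w * (\<Prod>j\<in>J. f j (B j w)) \<partial>M) = (\<integral>\<^sup>+w. X w * G (B t w) \<partial>M)"
  using J
proof (induction J arbitrary: t rule: finite_linorder_min_induct)
  case empty
  show ?case by (intro bexI[of _ "\<lambda>_. 1"]) auto
next
  case (insert b A)
  then have b: "t \<le> b" "0 \<le> b" "b \<le> 1" "b \<notin> A" "A \<subseteq> {..1}" by auto
  have "A \<subseteq> {b..1}" using insert.hyps(2) b(5) by (auto simp: less_imp_le)
  note b = b(1-3) this b(4)
  note f[measurable]
  obtain G where [measurable]: "G \<in> borel_measurable borel" and
    G: "\<And>X. X \<in> borel_measurable (F b) \<Longrightarrow> (\<integral>\<^sup>+w. X w * (\<Prod>j\<in>A. f j (B j w)) \<partial>M) = (\<integral>\<^sup>+w. X w * G (B b w) \<partial>M)"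
    using insert.IH[OF b(4,2,3)] by blast
  have step: "(\<integral>\<^sup>+w. X w * (\<Prod>j\<in>insert b A. f j (B j w)) \<partial>M) = (\<integral>\<^sup>+w. X w * (f b (B b w) * G (B b w)) \<partial>M)"
    if X: "X \<in> borel_measurable (F t)" for X :: "'a \<Rightarrow> ennreal"
  proof -
    have [measurable]: "X \<in> borel_measurable (F b)" using X b insert.prems by (intro measurable_F_mono[OF _ _ _ X]) auto
    have [measurable]: "B b \<in> borel_measurable (F b)" using b by (intro adapted) auto
    have "(\<integral>\<^sup>+w. X w * (\<Prod>j\<in>insert b A. f j (B j w)) \<partial>M) = (\<integral>\<^sup>+w. (X w * f b (B b w)) * (\<Prod>j\<in>A. f j (B j w)) \<partial>M)"
      using insert.hyps b by (simp add: mult.assoc)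
    also have "\<dots> = (\<integral>\<^sup>+w. (X w * f b (B b w)) * G (B b w) \<partial>M)" by (rule G) measurable
    finally show ?thesis by (simp add: mult.assoc)
  qed
  show ?case
  proof (cases "b = t")
    case True
    then show ?thesis using step by (intro bexI[of _ "\<lambda>x. f b x * G x"]) auto
  next
    case False
    then have tb: "0 \<le> t" "t < b" "b \<le> 1" using b insert.prems by auto
    interpret G: prob_space "gauss_vec (b - t) :: (real ^ 'n) measure" using tb by (intro prob_space_gauss_vec) simp
    let ?G = "\<lambda>x. \<integral>\<^sup>+y. f b (x + y) * G (x + y) \<partial>gauss_vec (b - t)"
    have [measurable]: "?G \<in> borel_measurable borel" by measurable
    show ?thesis
    proof (intro bexI[of _ ?G] ballI)
      fix X :: "'a \<Rightarrow> ennreal" assume X [measurable]: "X \<in> borel_measurable (F t)"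
      have [measurable]: "B t \<in> borel_measurable (F t)" using tb by (intro adapted) auto
      have "(\<integral>\<^sup>+w. X w * (f b (B b w) * G (B b w)) \<partial>M)
        = (\<integral>\<^sup>+w. X w * (f b (B t w + (B b w - B t w)) * G (B t w + (B b w - B t w))) \<partial>M)" by simp
      also have "\<dots> = (\<integral>\<^sup>+w. \<integral>\<^sup>+y. X w * (f b (B t w + y) * G (B t w + y)) \<partial>gauss_vec (b - t) \<partial>M)"
        by (rule nn_integral_incr[OF tb]) measurable
      also have "\<dots> = (\<integral>\<^sup>+w. X w * ?G (B t w) \<partial>M)"
        by (intro nn_integral_cong nn_integral_cmult) measurable
      finally show "(\<integral>\<^sup>+w. X w * (\<Prod>j\<in>insert b A. f j (B j w)) \<partial>M) = (\<integral>\<^sup>+w. X w * ?G (B t w) \<partial>M)"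
        using step[OF X] by simp
    qed simp
  qed
qed

text \<open>Null sets are left out: events of the process itself are kept apart from the completed
  filtration, and almost sure equality mediates between the two.\<close>

definition generators :: "real \<Rightarrow> 'a set set" where
  "generators t = {B s -` D \<inter> space M | s D. s \<in> {0..t} \<and> D \<in> sets borel}"

text \<open>If \<open>B\<close> generates \<open>F 1\<close>, then it generates \<open>F t\<close> for every \<open>t\<close>: the increments of \<open>B\<close> after \<open>t\<close> are
  independent of \<open>F t\<close>, so conditioning \<open>A \<in> F t\<close> on all of \<open>B\<close> amounts to conditioning on
  \<open>B\<close> up to \<open>t\<close>.\<close>

lemma adapted_generated:
  assumes t: "t \<in> {0..1}" and A: "A \<in> sets (F t)" and E: "E \<in> sigma_sets (space M) (generators 1)"
    and AE: "AE w in M. w \<in> A \<longleftrightarrow> w \<in> E"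
  shows "\<exists>E'\<in>sigma_sets (space M) (generators t). AE w in M. w \<in> A \<longleftrightarrow> w \<in> E'"
proof -
  define G where "G = sigma (space M) (generators t)"
  have gP: "generators s \<subseteq> Pow (space M)" for s by (auto simp: generators_def)
  have sG: "sets G = sigma_sets (space M) (generators t)" "space G = space M"
    unfolding G_def using gP by (auto simp: space_measure_of_conv)
  have Ft: "subalgebra M (F t)" and spF: "space (F t) = space M" using sub[OF t] by (auto simp: subalgebra_def)
  have Bm: "B s \<in> borel_measurable M" if "s \<in> {0..1}" for s using measurable_F_M[OF that adapted[OF that]] .
  have BG: "B s \<in> borel_measurable G" if "s \<in> {0..t}" for s
    using that by (intro measurableI) (auto simp: sG generators_def)
  have GF: "sets G \<subseteq> sets (F t)"
    unfolding sG
  proof (rule sets.sigma_sets_subset'[of _ "F t", unfolded spF])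
    show "generators t \<subseteq> sets (F t)"
    proof
      fix S assume "S \<in> generators t"
      then obtain s D where S: "S = B s -` D \<inter> space M" "s \<in> {0..t}" "D \<in> sets borel" by (auto simp: generators_def)
      have "B s \<in> borel_measurable (F t)" using S t by (intro measurable_F_mono[OF _ _ _ adapted]) auto
      from measurable_sets[OF this S(3)] show "S \<in> sets (F t)" using S(1) spF by simp
    qed
    show "space M \<in> sets (F t)" using sets.top[of "F t"] spF by simp
  qed
  have GM: "subalgebra M G" using GF Ft sG by (auto simp: subalgebra_def)
  interpret G: finite_measure_subalgebra M G by standard (rule GM)
  have GFm: "f \<in> borel_measurable (F t)" if "f \<in> borel_measurable G" for f :: "'a \<Rightarrow> ennreal"
    using that GF sG spF by (auto simp: measurable_def)
  have A\<^sub>M [measurable]: "A \<in> sets M" using A Ft by (auto simp: subalgebra_def)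
  \<comment> \<open>The conditional probability of \<open>A\<close> given the process up to
    \<open>t\<close>. Only the set where it is nonzero will matter, so it need not be identified
    with the indicator of \<open>A\<close>.\<close>
  define Z where "Z = nn_cond_exp M G (indicator A)"
  have ZG: "Z \<in> borel_measurable G" unfolding Z_def by measurable
  have ZM [measurable]: "Z \<in> borel_measurable M" unfolding Z_def by measurable
  have ce: "(\<integral>\<^sup>+w. f w * Z w \<partial>M) = (\<integral>\<^sup>+w. f w * indicator A w \<partial>M)" if "f \<in> borel_measurable G" for f
    unfolding Z_def using that by (rule G.nn_cond_exp_intg) measurable
  define Cyl where "Cyl = {{w \<in> space M. \<forall>j\<in>J. B j w \<in> D j} | J D. finite J \<and> J \<subseteq> {0..1} \<and> (\<forall>j. D j \<in> sets borel)}"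
  have CylP: "Cyl \<subseteq> Pow (space M)" by (auto simp: Cyl_def)
  have CylM: "Cyl \<subseteq> sets M"
  proof
    fix S assume "S \<in> Cyl"
    then obtain J D where S: "S = {w \<in> space M. \<forall>j\<in>J. B j w \<in> D j}" "finite J" "J \<subseteq> {0..1}" "\<And>j. D j \<in> sets borel"
      by (auto simp: Cyl_def)
    have "{w \<in> space M. B j w \<in> D j} \<in> sets M" if "j \<in> J" for j
      using measurable_sets[OF Bm S(4), of j j] that S(3) by (auto simp: vimage_def Int_def conj_commute)
    then show "S \<in> sets M" using S(2) unfolding S(1) by (intro sets.sets_Collect_finite_All) auto
  qed
  \<comment> \<open>The densities \<open>Z\<close> and indicator of \<open>A\<close> are compared
    through the measures they define on the cylinder sigma-algebra, whose generator is stable under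
    intersections.\<close>
  define N where "N h = distr (density M h) (sigma (space M) Cyl) (\<lambda>w. w)" for h :: "'a \<Rightarrow> ennreal"
  have sets_Cyl: "sets (sigma (space M) Cyl) = sigma_sets (space M) Cyl" using CylP by simp
  have CylM': "sigma_sets (space M) Cyl \<subseteq> sets M" using CylM by (rule sets.sigma_sets_subset)
  have eN: "emeasure (N h) S = (\<integral>\<^sup>+w. h w * indicator S w \<partial>M)" if "h \<in> borel_measurable M" "S \<in> sigma_sets (space M) Cyl" for h S
  proof -
    have "(\<lambda>w. w) \<in> density M h \<rightarrow>\<^sub>M sigma (space M) Cyl"
      using CylM' by (intro measurableI) (auto simp: sets_Cyl space_measure_of_conv Int_absorb2 dest: sets.sets_into_space)
    moreover have "S \<inter> space M = S" using sets.sets_into_space[of S M] that CylM' by auto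
    ultimately show ?thesis unfolding N_def using that CylM'
      by (subst emeasure_distr) (auto simp: sets_Cyl emeasure_density)
  qed
  have cyl: "(\<integral>\<^sup>+w. h w * indicator {w \<in> space M. \<forall>j\<in>J. B j w \<in> D j} w \<partial>M) = (\<integral>\<^sup>+w. h' w * indicator {w \<in> space M. \<forall>j\<in>J. B j w \<in> D j} w \<partial>M)"
    if J: "finite J" "J \<subseteq> {0..1}" and D: "\<And>j. D j \<in> sets borel" and hh: "h = Z" "h' = indicator A" for h h' and J :: "real set" and D
  proof -
    let ?f = "\<lambda>j x. indicator (D j) x :: ennreal"
    \<comment> \<open>Coordinates up to \<open>t\<close> form the \<open>G\<close>-measurable factor
      \<open>?P\<close>; those after \<open>t\<close> are replaced by \<open>H (B t w)\<close>,
      again \<open>G\<close>-measurable. The replacement is allowed because both \<open>Z\<close>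
      and the indicator of \<open>A\<close> are measurable at time \<open>t\<close>.\<close>
    let ?J1 = "J \<inter> {..t}" and ?J2 = "J \<inter> {t<..}"
    let ?P = "\<lambda>w. \<Prod>j\<in>?J1. ?f j (B j w)"
    have PG: "?P \<in> borel_measurable G"
      using J D by (intro borel_measurable_prod_ennreal measurable_compose[OF BG borel_measurable_indicator]) auto
    obtain H where H [measurable]: "H \<in> borel_measurable borel" and mk: "\<And>X. X \<in> borel_measurable (F t) \<Longrightarrow>
        (\<integral>\<^sup>+w. X w * (\<Prod>j\<in>?J2. ?f j (B j w)) \<partial>M) = (\<integral>\<^sup>+w. X w * H (B t w) \<partial>M)"
    proof -
      have "?J2 \<subseteq> {t..1}" using J by auto
      from markov[OF _ this, of ?f] J t D that show thesis by auto
    qed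
    have e: "(\<integral>\<^sup>+w. h w * indicator {w \<in> space M. \<forall>j\<in>J. B j w \<in> D j} w \<partial>M) = (\<integral>\<^sup>+w. (?P w * H (B t w)) * h w \<partial>M)"
      if h: "h \<in> borel_measurable (F t)" for h
    proof -
      have "(\<integral>\<^sup>+w. h w * indicator {w \<in> space M. \<forall>j\<in>J. B j w \<in> D j} w \<partial>M) = (\<integral>\<^sup>+w. (h w * ?P w) * (\<Prod>j\<in>?J2. ?f j (B j w)) \<partial>M)"
      proof (rule nn_integral_cong)
        fix w assume w: "w \<in> space M"
        have "J = ?J1 \<union> ?J2" "?J1 \<inter> ?J2 = {}" by auto
        then have "(\<Prod>j\<in>J. ?f j (B j w)) = ?P w * (\<Prod>j\<in>?J2. ?f j (B j w))"
          using J prod.union_disjoint[of ?J1 ?J2 "\<lambda>j. ?f j (B j w)"] by auto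
        moreover have "(\<Prod>j\<in>J. ?f j (B j w)) = indicator {w \<in> space M. \<forall>j\<in>J. B j w \<in> D j} w"
          using J(1) w by (auto simp: indicator_def prod_zero_iff)
        ultimately show "h w * indicator {w \<in> space M. \<forall>j\<in>J. B j w \<in> D j} w = h w * ?P w * (\<Prod>j\<in>?J2. ?f j (B j w))"
          by (simp add: mult.assoc)
      qed
      also have "\<dots> = (\<integral>\<^sup>+w. (h w * ?P w) * H (B t w) \<partial>M)"
        using h GFm[OF PG] by (intro mk) measurable
      finally show ?thesis by (simp add: mult_ac)
    qed
    have "(\<lambda>w. ?P w * H (B t w)) \<in> borel_measurable G"
      using PG measurable_compose[OF BG H, of t] t by simp
    from ce[OF this] show ?thesis
      unfolding hh using e[OF GFm[OF ZG]] e[of "indicator A"] A by simp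
  qed
  have "N Z = N (indicator A)"
  proof (rule measure_eqI_generator_eq[where E=Cyl and \<Omega>="space M" and A="\<lambda>_. space M"])
    show "Int_stable Cyl"
    proof (rule Int_stableI)
      fix S S' assume "S \<in> Cyl" "S' \<in> Cyl"
      then obtain J D J' D' where S: "S = {w \<in> space M. \<forall>j\<in>J. B j w \<in> D j}" "finite J" "J \<subseteq> {0..1}" "\<And>j. D j \<in> sets borel"
        and S': "S' = {w \<in> space M. \<forall>j\<in>J'. B j w \<in> D' j}" "finite J'" "J' \<subseteq> {0..1}" "\<And>j. D' j \<in> sets borel"
        unfolding Cyl_def by blast
      have "S \<inter> S' = {w \<in> space M. \<forall>j\<in>J \<union> J'. B j w \<in> (if j \<in> J then D j else UNIV) \<inter> (if j \<in> J' then D' j else UNIV)}"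
        unfolding S(1) S'(1) by auto
      then show "S \<inter> S' \<in> Cyl" unfolding Cyl_def using S S'
        by (intro CollectI exI[of _ "J \<union> J'"] exI[of _ "\<lambda>j. (if j \<in> J then D j else UNIV) \<inter> (if j \<in> J' then D' j else UNIV)"]) auto
    qed
    show "emeasure (N Z) X = emeasure (N (indicator A)) X" if X: "X \<in> Cyl" for X
    proof -
      obtain J D where "X = {w \<in> space M. \<forall>j\<in>J. B j w \<in> D j}" "finite J" "J \<subseteq> {0..1}" "\<And>j. D j \<in> sets borel"
        using X unfolding Cyl_def by blast
      with cyl[of J D Z "indicator A"] X show ?thesis by (simp add: eN sigma_sets.Basic)
    qed
    have "space M = {w \<in> space M. \<forall>j\<in>{}. B j w \<in> UNIV}" by simp
    then have "space M \<in> Cyl" unfolding Cyl_def by (intro CollectI exI[of _ "{}"] exI[of _ "\<lambda>_. UNIV"]) auto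
    then show "range (\<lambda>_ :: nat. space M) \<subseteq> Cyl" by auto
    have "emeasure (N Z) (space M) = emeasure M A"
      using eN[OF ZM sigma_sets_top] ce[of "\<lambda>_. 1"] by (simp cong: nn_integral_cong_simp)
    then show "emeasure (N Z) (space M) \<noteq> \<infinity>" for i :: nat by simp
  qed (use CylP in \<open>auto simp: N_def\<close>)
  then have eq: "(\<integral>\<^sup>+w. Z w * indicator S w \<partial>M) = (\<integral>\<^sup>+w. indicator A w * indicator S w \<partial>M)" if "S \<in> sigma_sets (space M) Cyl" for S
    using eN[OF ZM that] eN[of "indicator A", OF _ that] by simp
  have gC: "generators 1 \<subseteq> Cyl"
  proof
    fix S assume "S \<in> generators 1"
    then obtain s D where S: "S = B s -` D \<inter> space M" "s \<in> {0..1}" "D \<in> sets borel" by (auto simp: generators_def)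
    then have "S = {w \<in> space M. \<forall>j\<in>{s}. B j w \<in> D}" by auto
    with S(2,3) show "S \<in> Cyl" unfolding Cyl_def by (intro CollectI exI[of _ "{s}"] exI[of _ "\<lambda>_. D"]) auto
  qed
  have EC: "E \<in> sigma_sets (space M) Cyl" using sigma_sets_mono'[OF gC] E by blast
  then have EM: "E \<in> sets M" using CylM' by blast
  \<comment> \<open>Generation at time 1 enters here: testing with the complement of
    \<open>E\<close>, almost surely that of \<open>A\<close>, shows that \<open>Z\<close> vanishes
    outside \<open>A\<close>.\<close>
  have "(\<integral>\<^sup>+w. Z w * indicator (space M - E) w \<partial>M) = (\<integral>\<^sup>+w. indicator A w * indicator (space M - E) w \<partial>M)"
    by (rule eq[OF sigma_sets.Compl[OF EC]])
  also have "\<dots> = (\<integral>\<^sup>+w. 0 \<partial>M)"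
    using AE by (intro nn_integral_cong_AE) (auto simp: indicator_def elim: eventually_mono)
  finally have "AE w in M. Z w * indicator (space M - E) w = 0"
    using EM nn_integral_0_iff_AE[of "\<lambda>w. Z w * indicator (space M - E) w" M] by simp
  then have 1: "AE w in M. Z w \<noteq> 0 \<longrightarrow> w \<in> A"
    using AE AE_space by eventually_elim (auto simp: indicator_def split: if_splits)
  \<comment> \<open>The witness. Conversely, \<open>A\<close> has no mass where \<open>Z\<close> is
    zero, by the defining property of \<open>Z\<close>.\<close>
  let ?E = "{w \<in> space G. Z w \<noteq> 0}"
  have EG: "?E \<in> sets G" using ZG by measurable
  have "(\<lambda>w. indicator {w \<in> space G. Z w = 0} w :: ennreal) \<in> borel_measurable G" using ZG by measurable
  from ce[OF this] have "(\<integral>\<^sup>+w. indicator {w \<in> space G. Z w = 0} w * indicator A w \<partial>M) = (\<integral>\<^sup>+w. 0 \<partial>M)"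
    by (subst (asm) nn_integral_cong[of M _ "\<lambda>_. 0"]) (auto simp: indicator_def)
  moreover have "{w \<in> space G. Z w = 0} \<in> sets M" unfolding sG(2) by measurable
  ultimately have "AE w in M. indicator {w \<in> space G. Z w = 0} w * indicator A w = (0 :: ennreal)"
    using nn_integral_0_iff_AE[of "\<lambda>w. indicator {w \<in> space G. Z w = 0} w * indicator A w" M] by simp
  then have "AE w in M. w \<in> A \<longleftrightarrow> w \<in> ?E"
    using 1 AE_space by eventually_elim (auto simp: indicator_def sG split: if_splits)
  with EG show ?thesis unfolding sG(1) by blast
qed

end

subsection \<open>Shifts of the path\<close>

text \<open>Free of null sets and of any measure, so that it can be pulled back along different
  random paths such as \<open>\<beta>\<close> and \<open>\<beta> + u\<close>.\<close>

definition coord_sets :: "real \<Rightarrow> 'n::finite cpath set set" where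
  "coord_sets t = sigma_sets UNIV {(\<lambda>w. path_val w s) -` D | s D. s \<in> {0..t} \<and> D \<in> sets borel}"

lemma coord_sets_1: "coord_sets 1 = sets path_borel"
  unfolding coord_sets_def path_borel_def by (subst sets_measure_of) auto

lemma coord_sets_vimage:
  fixes X :: "'a \<Rightarrow> 'n::finite cpath"
  shows "{X -` E \<inter> \<Omega> | E. E \<in> coord_sets t}
    = sigma_sets \<Omega> {(\<lambda>w. path_val (X w) s) -` D \<inter> \<Omega> | s D. s \<in> {0..t} \<and> D \<in> sets borel}"
proof -
  have vimage_compose': "(\<lambda>w. path_val (X w) s) -` D = X -` ((\<lambda>w. path_val w s) -` D)" for s D
    by auto
  have "{X -` E \<inter> \<Omega> | E. E \<in> coord_sets t}
    = sigma_sets \<Omega> {X -` A \<inter> \<Omega> | A. A \<in> {(\<lambda>w. path_val w s) -` D | s D. s \<in> {0..t} \<and> D \<in> sets borel}}"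
    unfolding coord_sets_def by (rule sigma_sets_vimage_commute) simp
  also have "{X -` A \<inter> \<Omega> | A. A \<in> {(\<lambda>w. path_val w s) -` D | s D. s \<in> {0..t} \<and> D \<in> sets borel}}
    = {(\<lambda>w. path_val (X w) s) -` D \<inter> \<Omega> | s D. s \<in> {0..t} \<and> D \<in> sets borel}"
    unfolding vimage_compose' by blast
  finally show ?thesis .
qed

text \<open>Null sets are matched by the empty set, and the property survives complements and
  countable unions; completion thus adds nothing but null modifications of preimages under
  \<open>X\<close>.\<close>

lemma natural_filtration_approx:
  assumes "S \<in> sets (natural_filtration \<nu> X t)"
  shows "\<exists>E\<in>coord_sets t. AE w in \<nu>. w \<in> S \<longleftrightarrow> X w \<in> E"
  using assms unfolding sets_natural_filtration
proof (induction rule: sigma_sets.induct)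
  case (Basic S)
  then show ?case
  proof
    assume "S \<in> {(\<lambda>w. path_val (X w) s) -` A \<inter> space \<nu> | s A. s \<in> {0..t} \<and> A \<in> sets borel}"
    then obtain s A where S: "S = (\<lambda>w. path_val (X w) s) -` A \<inter> space \<nu>" "s \<in> {0..t}" "A \<in> sets borel" by blast
    then have "(\<lambda>w. path_val w s) -` A \<in> coord_sets t" unfolding coord_sets_def by (intro sigma_sets.Basic) blast
    then show ?thesis using S by (intro bexI) auto
  next
    assume "S \<in> null_sets \<nu>"
    then have "AE w in \<nu>. w \<notin> S" by (rule AE_not_in)
    then show ?thesis by (intro bexI[of _ "{}"]) (auto simp: coord_sets_def sigma_sets.Empty)
  qed
next
  case Empty
  show ?case by (intro bexI[of _ "{}"]) (auto simp: coord_sets_def sigma_sets.Empty)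
next
  case (Compl S)
  then obtain E where E: "E \<in> coord_sets t" "AE w in \<nu>. w \<in> S \<longleftrightarrow> X w \<in> E" by blast
  have "UNIV - E \<in> coord_sets t" using E(1) unfolding coord_sets_def by (rule sigma_sets.Compl)
  moreover have "AE w in \<nu>. w \<in> space \<nu> - S \<longleftrightarrow> X w \<in> UNIV - E"
    using E(2) AE_space by eventually_elim auto
  ultimately show ?case by blast
next
  case (Union S)
  then have "\<forall>i :: nat. \<exists>E. E \<in> coord_sets t \<and> (AE w in \<nu>. w \<in> S i \<longleftrightarrow> X w \<in> E)" by blast
  from choice[OF this] obtain E where E: "\<And>i. E i \<in> coord_sets t" "\<And>i. AE w in \<nu>. w \<in> S i \<longleftrightarrow> X w \<in> E i" by blast
  have "(\<Union>i. E i) \<in> coord_sets t" using E(1) unfolding coord_sets_def by (rule sigma_sets.Union)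
  moreover have "AE w in \<nu>. \<forall>i. w \<in> S i \<longleftrightarrow> X w \<in> E i" using E(2) by (simp add: AE_all_countable)
  then have "AE w in \<nu>. w \<in> (\<Union>i. S i) \<longleftrightarrow> X w \<in> (\<Union>i. E i)" by eventually_elim auto
  ultimately show ?case by blast
qed

section \<open>Maps that respect the null sets of the path space\<close>

context path_brownian
begin

lemma vimage_UNIV_sets: "X \<in> \<nu> \<rightarrow>\<^sub>M N \<Longrightarrow> E \<in> sets N \<Longrightarrow> X -` E \<in> sets \<nu>"
  using measurable_sets[of X \<nu> N E] by simp

lemma sets_nu_approx:
  assumes "E \<in> sets \<nu>"
  shows "\<exists>S\<in>sets path_borel. AE w in \<nu>. w \<in> E \<longleftrightarrow> w \<in> S"
proof -
  obtain S N N' where E: "E = S \<union> N" "N \<subseteq> N'" "N' \<in> null_sets \<mu>" "S \<in> sets \<mu>"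
    using assms unfolding nu by (rule sets_completionE)
  have "AE w in \<nu>. w \<notin> N'" unfolding nu using AE_not_in[OF E(3)] by (rule AE_completion)
  then have "AE w in \<nu>. w \<in> E \<longleftrightarrow> w \<in> S" by eventually_elim (use E in auto)
  then show ?thesis using E(4) sets by blast
qed

lemma natural_filtration_AE:
  assumes S: "S \<in> sets (natural_filtration \<nu> X t)" and ae: "AE w in \<nu>. w \<in> S \<longleftrightarrow> w \<in> E"
  shows "E \<in> sets (natural_filtration \<nu> X t)"
proof -
  have "S - E \<in> null_sets \<nu>" "E - S \<in> null_sets \<nu>"
    unfolding null_sets_iff_AE using ae by (auto elim: eventually_mono)
  then have "S - (S - E) \<union> (E - S) \<in> sets (natural_filtration \<nu> X t)"
    using S null_sets_natural_filtration by blast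
  also have "S - (S - E) \<union> (E - S) = E" by auto
  finally show ?thesis .
qed

text \<open>At time 1 the completed coordinate filtration exhausts \<open>\<nu>\<close>, and it
  agrees with that of \<open>\<beta>\<close>.\<close>

lemma sets_nu_eq: "sets \<nu> = sets (natural_filtration \<nu> \<beta> 1)"
proof
  show "sets (natural_filtration \<nu> \<beta> 1) \<subseteq> sets \<nu>"
    using subalgebra_natural_filtration[OF beta_measurable, of 1] by (simp add: subalgebra_def)
  have "sets \<nu> \<subseteq> sets (\<F> 1)"
  proof
    fix E assume E: "E \<in> sets \<nu>"
    obtain S where S: "S \<in> sets path_borel" "AE w in \<nu>. w \<in> E \<longleftrightarrow> w \<in> S" using sets_nu_approx[OF E] by blast
    have SS: "S \<in> sigma_sets UNIV {(\<lambda>w. path_val w s) -` D \<inter> UNIV | s D. s \<in> {0..1} \<and> D \<in> sets borel}"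
      using S(1) unfolding coord_sets_1[symmetric] coord_sets_def by simp
    have SF: "S \<in> sets (\<F> 1)"
      unfolding sets_natural_filtration space_nu by (rule subsetD[OF sigma_sets_mono' SS]) blast
    have "AE w in \<nu>. w \<in> S \<longleftrightarrow> w \<in> E" using S(2) by eventually_elim auto
    with SF show "E \<in> sets (\<F> 1)" by (rule natural_filtration_AE)
  qed
  then show "sets \<nu> \<subseteq> sets (natural_filtration \<nu> \<beta> 1)" using filt[of 1] by simp
qed

text \<open>The sense in which \<open>\<beta>\<close> determines the path. Two random paths that
  respect null sets and have almost surely the same image under \<open>\<beta>\<close> can therefore
  be identified event by event.\<close>

lemma beta_approx: "E \<in> sets \<nu> \<Longrightarrow> \<exists>S\<in>sets path_borel. AE w in \<nu>. w \<in> E \<longleftrightarrow> \<beta> w \<in> S"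
  unfolding sets_nu_eq coord_sets_1[symmetric] by (rule natural_filtration_approx)

text \<open>Measurability into \<open>path_borel\<close> falls short of measurability for the
  completed sigma-algebra. Sets of \<open>\<nu>\<close> differ from those of
  \<open>path_borel\<close> by null sets, so preservation of null sets closes the gap.\<close>

lemma null_preserving:
  assumes X: "X \<in> \<nu> \<rightarrow>\<^sub>M path_borel"
    and null: "\<And>N. N \<in> sets path_borel \<Longrightarrow> AE w in \<nu>. w \<notin> N \<Longrightarrow> AE w in \<nu>. X w \<notin> N"
  shows null_preserving_AE: "\<And>P. AE w in \<nu>. P w \<Longrightarrow> AE w in \<nu>. P (X w)"
    and null_preserving_measurable: "X \<in> \<nu> \<rightarrow>\<^sub>M \<nu>"
proof -
  show tr: "AE w in \<nu>. P (X w)" if "AE w in \<nu>. P w" for P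
  proof -
    have "AE w in \<mu>. P w" using that unfolding nu by (simp add: AE_completion_iff)
    then obtain N where N: "{w \<in> space \<mu>. \<not> P w} \<subseteq> N" "N \<in> null_sets \<mu>" by (auto elim!: AE_E simp: null_sets_def)
    have sp: "space \<mu> = UNIV" using sets_eq_imp_space_eq[OF sets] by simp
    have "AE w in \<nu>. w \<notin> N" unfolding nu using AE_not_in[OF N(2)] by (rule AE_completion)
    moreover have "N \<in> sets path_borel" using N(2) sets by auto
    ultimately have "AE w in \<nu>. X w \<notin> N" by (intro null)
    then show ?thesis by eventually_elim (use N sp in auto)
  qed
  show "X \<in> \<nu> \<rightarrow>\<^sub>M \<nu>"
  proof (rule measurableI)
    fix E assume "E \<in> sets \<nu>"
    then obtain S where S: "S \<in> sets path_borel" "AE w in \<nu>. w \<in> E \<longleftrightarrow> w \<in> S" using sets_nu_approx by blast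
    have "AE w in \<nu>. w \<in> X -` S \<longleftrightarrow> w \<in> X -` E" using tr[OF S(2)] by eventually_elim auto
    from in_sets_AE[OF this vimage_UNIV_sets[OF X S(1)]] show "X -` E \<inter> space \<nu> \<in> sets \<nu>" by simp
  qed simp
qed

end

section \<open>Consequences of the assumed laws of the maps \<open>W u\<close>\<close>

locale path_shift = path_brownian \<mu> \<nu> \<beta> for \<mu> \<nu> :: "'n::finite cpath measure" and \<beta> +
  fixes W :: "('n cpath \<Rightarrow> 'n cpath) \<Rightarrow> 'n cpath \<Rightarrow> 'n cpath"
  assumes meas: "\<And>u. u \<in> bounded_drifts \<nu> \<Longrightarrow> W u \<in> \<nu> \<rightarrow>\<^sub>M path_borel"
    and law: "\<And>u. u \<in> bounded_drifts \<nu> \<Longrightarrow>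
      distr (density \<nu> (\<lambda>w. ennreal (girsanov_weight \<nu> \<beta> u w))) path_borel (W u) = distr \<nu> path_borel (\<lambda>w. w)"
    and shift: "\<And>u. u \<in> bounded_drifts \<nu> \<Longrightarrow> AE w in \<nu>. \<beta> (W u w) = \<beta> w + u w"
begin

abbreviation "\<rho> u w \<equiv> ennreal (girsanov_weight \<nu> \<beta> u w)"

lemma rho_measurable: "u \<in> bounded_drifts \<nu> \<Longrightarrow> (\<lambda>w. \<rho> u w) \<in> borel_measurable \<nu>"
  using girsanov_weight_measurable by measurable

lemma law_nn_integral_path_borel:
  assumes u: "u \<in> bounded_drifts \<nu>" and f [measurable]: "f \<in> borel_measurable path_borel"
  shows "(\<integral>\<^sup>+w. \<rho> u w * f (W u w) \<partial>\<nu>) = (\<integral>\<^sup>+w. f w \<partial>\<nu>)"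
proof -
  note [measurable] = meas[OF u] rho_measurable[OF u]
  have "(\<integral>\<^sup>+w. \<rho> u w * f (W u w) \<partial>\<nu>) = (\<integral>\<^sup>+w. f w \<partial>distr (density \<nu> (\<rho> u)) path_borel (W u))"
    by (subst nn_integral_distr) (auto simp: nn_integral_density)
  also have "\<dots> = (\<integral>\<^sup>+w. f w \<partial>\<nu>)" unfolding law[OF u] by (subst nn_integral_distr) auto
  finally show ?thesis .
qed

text \<open>The assumed law gives the event zero weighted mass, and the weight is strictly
  positive.\<close>

lemma W_null:
  assumes u: "u \<in> bounded_drifts \<nu>" and N: "N \<in> sets path_borel" "AE w in \<nu>. w \<notin> N"
  shows "AE w in \<nu>. W u w \<notin> N"
proof -
  note [measurable] = meas[OF u] rho_measurable[OF u] N(1)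
  have "(\<integral>\<^sup>+w. \<rho> u w * indicator N (W u w) \<partial>\<nu>) = (\<integral>\<^sup>+w. indicator N w \<partial>\<nu>)"
    by (rule law_nn_integral_path_borel[OF u]) measurable
  also have "\<dots> = (\<integral>\<^sup>+w. 0 \<partial>\<nu>)"
    using N(2) by (intro nn_integral_cong_AE) (auto elim: eventually_mono)
  finally have "AE w in \<nu>. \<rho> u w * indicator N (W u w) = 0"
    using nn_integral_0_iff_AE[of "\<lambda>w. \<rho> u w * indicator N (W u w)" \<nu>] by simp
  then show ?thesis
  proof eventually_elim
    case (elim w)
    then show ?case using girsanov_weight_pos[of u w]
      by (auto simp: indicator_def ennreal_eq_0_iff split: if_splits)
  qed
qed

lemma W_AE: "u \<in> bounded_drifts \<nu> \<Longrightarrow> AE w in \<nu>. P w \<Longrightarrow> AE w in \<nu>. P (W u w)"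
  by (rule null_preserving_AE[OF meas W_null])

lemma W_measurable: "u \<in> bounded_drifts \<nu> \<Longrightarrow> W u \<in> \<nu> \<rightarrow>\<^sub>M \<nu>"
  by (rule null_preserving_measurable[OF meas W_null])

lemma law_nn_integral:
  assumes u: "u \<in> bounded_drifts \<nu>" and f: "f \<in> borel_measurable \<nu>"
  shows "(\<integral>\<^sup>+w. \<rho> u w * f (W u w) \<partial>\<nu>) = (\<integral>\<^sup>+w. f w \<partial>\<nu>)"
proof -
  obtain f' where f': "f' \<in> borel_measurable \<mu>" "AE w in \<mu>. f w = f' w"
    using completion_ex_borel_measurable f unfolding nu by blast
  have f'm: "f' \<in> borel_measurable path_borel" using f'(1) by (simp cong: measurable_cong_sets add: sets)
  have ae: "AE w in \<nu>. f w = f' w" using f'(2) unfolding nu by (rule AE_completion)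
  have "(\<integral>\<^sup>+w. \<rho> u w * f (W u w) \<partial>\<nu>) = (\<integral>\<^sup>+w. \<rho> u w * f' (W u w) \<partial>\<nu>)"
    using W_AE[OF u ae] by (intro nn_integral_cong_AE) (auto elim: eventually_mono)
  also have "\<dots> = (\<integral>\<^sup>+w. f' w \<partial>\<nu>)" by (rule law_nn_integral_path_borel[OF u f'm])
  also have "\<dots> = (\<integral>\<^sup>+w. f w \<partial>\<nu>)" using ae by (intro nn_integral_cong_AE) (auto elim: eventually_mono)
  finally show ?thesis .
qed

text \<open>A converse of \<open>W_AE\<close>: the weighted law of \<open>W u\<close> is
  \<open>\<nu>\<close> itself, so a measurable property that holds along \<open>W u\<close> holds at
  almost every path. This is what turns the left inverse into a right inverse.\<close>

lemma W_AE_reflect: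
  assumes u: "u \<in> bounded_drifts \<nu>" and P: "{w. P w} \<in> sets \<nu>" and ae: "AE w in \<nu>. P (W u w)"
  shows "AE w in \<nu>. P w"
proof -
  have "{w. \<not> P w} = space \<nu> - {w. P w}" by auto
  then have [measurable]: "{w. \<not> P w} \<in> sets \<nu>" using sets.compl_sets[OF P] by simp
  have "(\<integral>\<^sup>+w. indicator {w. \<not> P w} w \<partial>\<nu>) = (\<integral>\<^sup>+w. \<rho> u w * indicator {w. \<not> P w} (W u w) \<partial>\<nu>)"
    by (rule law_nn_integral[OF u, symmetric]) measurable
  also have "\<dots> = (\<integral>\<^sup>+w. 0 \<partial>\<nu>)"
    using ae by (intro nn_integral_cong_AE) (auto elim: eventually_mono)
  finally have "AE w in \<nu>. indicator {w. \<not> P w} w = (0 :: ennreal)"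
    using nn_integral_0_iff_AE[of "\<lambda>w. indicator {w. \<not> P w} w" \<nu>] by simp
  then show ?thesis by eventually_elim (auto simp: indicator_def split: if_splits)
qed

lemma rho_total: "u \<in> bounded_drifts \<nu> \<Longrightarrow> (\<integral>\<^sup>+w. \<rho> u w \<partial>\<nu>) = 1"
  using law_nn_integral[of u "\<lambda>_. 1"] emeasure_space_1 by simp

abbreviation "incr X s r w \<equiv> path_val (X w) r - path_val (X w) s"

text \<open>Along \<open>W u\<close> the process \<open>\<beta>\<close> becomes
  \<open>\<beta> + u\<close>, so the assumed law transfers the Gaussian law of the
  increment.\<close>

lemma shifted_increment_law:
  assumes u: "u \<in> bounded_drifts \<nu>" and sr: "0 \<le> s" "s < r" "r \<le> 1" and \<phi> [measurable]: "\<phi> \<in> borel_measurable borel"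
  shows "(\<integral>\<^sup>+w. \<rho> u w * \<phi> (incr (\<lambda>w. \<beta> w + u w) s r w) \<partial>\<nu>) = (\<integral>\<^sup>+y. \<phi> y \<partial>gauss_vec (r - s))"
proof -
  have "(\<integral>\<^sup>+w. \<rho> u w * \<phi> (incr (\<lambda>w. \<beta> w + u w) s r w) \<partial>\<nu>) = (\<integral>\<^sup>+w. \<rho> u w * \<phi> (incr \<beta> s r (W u w)) \<partial>\<nu>)"
    using shift[OF u] by (intro nn_integral_cong_AE) (auto elim: eventually_mono)
  also have "\<dots> = (\<integral>\<^sup>+w. \<phi> (incr \<beta> s r w) \<partial>\<nu>)"
    by (rule law_nn_integral[OF u, of "\<lambda>w. \<phi> (incr \<beta> s r w)"]) measurable
  also have "\<dots> = (\<integral>\<^sup>+w. \<integral>\<^sup>+y. \<phi> y \<partial>gauss_vec (r - s) \<partial>\<nu>)"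
    by (rule nn_integral_incr[OF sr, of "\<lambda>_. \<phi>"]) measurable
  also have "\<dots> = (\<integral>\<^sup>+y. \<phi> y \<partial>gauss_vec (r - s))" using emeasure_space_1 by simp
  finally show ?thesis .
qed

text \<open>Independence of the increment and \<open>A\<close> is read off by comparing the drift \<open>u\<close> with the drift that
  receives, on \<open>A\<close> only, the extra constant speed \<open>a\<close> between \<open>s\<close> and \<open>r\<close>.\<close>

lemma shifted_increment_indep:
  assumes u: "u \<in> bounded_drifts \<nu>" and sr: "0 \<le> s" "s < r" "r \<le> 1" and A: "A \<in> sets (\<F> s)"
    and D: "D \<in> sets borel"
  shows "(\<integral>\<^sup>+w. \<rho> u w * indicator A w * indicator D (incr (\<lambda>w. \<beta> w + u w) s r w) \<partial>\<nu>)
    = (\<integral>\<^sup>+w. \<rho> u w * indicator A w \<partial>\<nu>) * emeasure (gauss_vec (r - s)) D"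
proof -
  let ?B = "incr (\<lambda>w. \<beta> w + u w) s r" and ?\<delta> = "r - s"
  have "s \<in> {0..1}" using sr by auto
  then have [measurable]: "A \<in> sets \<nu>" using A sub by (auto simp: subalgebra_def)
  note [measurable] = rho_measurable[OF u] bounded_driftsD(1)[OF u]
  have B [measurable]: "?B \<in> borel_measurable \<nu>" by measurable
  \<comment> \<open>The law of the increment under the weighted measure restricted to
    \<open>A\<close>, to which the Gaussian characterisation will be applied.\<close>
  define m where "m = distr (density \<nu> (\<lambda>w. \<rho> u w * indicator A w)) borel ?B"
  have sm [measurable_cong, simp]: "sets m = sets borel" and spm: "space m = UNIV" by (simp_all add: m_def)
  have mi: "(\<integral>\<^sup>+x. \<phi> x \<partial>m) = (\<integral>\<^sup>+w. \<rho> u w * indicator A w * \<phi> (?B w) \<partial>\<nu>)" if [measurable]: "\<phi> \<in> borel_measurable borel" for \<phi>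
    unfolding m_def by (subst nn_integral_distr, measurable, subst nn_integral_density, auto)
  have mU: "emeasure m UNIV = (\<integral>\<^sup>+w. \<rho> u w * indicator A w \<partial>\<nu>)"
    using mi[of "\<lambda>_. 1"] spm by simp
  have "(\<integral>\<^sup>+w. \<rho> u w * indicator A w \<partial>\<nu>) \<le> (\<integral>\<^sup>+w. \<rho> u w \<partial>\<nu>)"
    by (intro nn_integral_mono) (auto simp: indicator_def)
  then have fin: "finite_measure m" using mU spm rho_total[OF u] by (intro finite_measureI) (auto simp: top_unique)
  have inv: "(\<integral>\<^sup>+x. \<phi> x \<partial>m) = (\<integral>\<^sup>+x. ennreal (exp (- (a \<bullet> x) - (norm a)\<^sup>2 * ?\<delta> / 2)) * \<phi> (x + ?\<delta> *\<^sub>R a) \<partial>m)"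
    if [measurable]: "\<phi> \<in> borel_measurable borel" for a \<phi>
  proof -
    let ?e = "\<lambda>x. ennreal (exp (- (a \<bullet> x) - (norm a)\<^sup>2 * ?\<delta> / 2))"
    let ?k = "kick u A s r a"
    \<comment> \<open>Quasi-invariance is phrased as an equality of two measures, so that it has to
      be verified on sets only.\<close>
    define m' where "m' = distr (density m ?e) borel (\<lambda>x. x + ?\<delta> *\<^sub>R a)"
    have k: "?k \<in> bounded_drifts \<nu>" by (rule kick_bounded_drifts[OF u sr A])
    have "m = m'"
    proof (rule measure_eqI)
      fix D assume "D \<in> sets m"
      then have D [measurable]: "D \<in> sets borel" by simp
      let ?i = "indicator D :: real ^ 'n \<Rightarrow> ennreal"
      have "(\<integral>\<^sup>+w. \<rho> u w * ?i (?B w) \<partial>\<nu>) = (\<integral>\<^sup>+w. \<rho> ?k w * ?i (incr (\<lambda>w. \<beta> w + ?k w) s r w) \<partial>\<nu>)"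
        using shifted_increment_law[OF u sr, of ?i] shifted_increment_law[OF k sr, of ?i] by simp
      \<comment> \<open>Off \<open>A\<close> the kicked drift and its weight agree with those of
        \<open>u\<close>; on \<open>A\<close> the increment is translated by
        \<open>?\<delta> *\<^sub>R a\<close> and the weight is multiplied by
        \<open>?e (?B w)\<close>.\<close>
      also have "\<dots> = (\<integral>\<^sup>+w. \<rho> u w * indicator (- A) w * ?i (?B w) + \<rho> u w * indicator A w * (?e (?B w) * ?i (?B w + ?\<delta> *\<^sub>R a)) \<partial>\<nu>)"
      proof (rule nn_integral_cong_AE, use kick_weight[OF u sr A, of a] in eventually_elim)
        case (elim w)
        show ?case
        proof (cases "w \<in> A")
          case True
          have "incr (\<lambda>w. \<beta> w + ?k w) s r w = ?B w + ?\<delta> *\<^sub>R a"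
            using True sr by (simp add: kick_def plus_cpath.rep_eq path_val_ramp algebra_simps)
          then show ?thesis using True elim girsanov_weight_pos[of u w]
            by (simp add: ennreal_mult mult.assoc less_imp_le)
        next
          case False
          then show ?thesis using elim by (simp add: kick_def)
        qed
      qed
      also have "\<dots> = (\<integral>\<^sup>+w. \<rho> u w * indicator (- A) w * ?i (?B w) \<partial>\<nu>) + (\<integral>\<^sup>+w. \<rho> u w * indicator A w * (?e (?B w) * ?i (?B w + ?\<delta> *\<^sub>R a)) \<partial>\<nu>)"
        by (rule nn_integral_add) measurable
      finally have 1: "(\<integral>\<^sup>+w. \<rho> u w * ?i (?B w) \<partial>\<nu>)
        = (\<integral>\<^sup>+w. \<rho> u w * indicator (- A) w * ?i (?B w) \<partial>\<nu>) + (\<integral>\<^sup>+w. \<rho> u w * indicator A w * (?e (?B w) * ?i (?B w + ?\<delta> *\<^sub>R a)) \<partial>\<nu>)" .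
      have 2: "(\<integral>\<^sup>+w. \<rho> u w * ?i (?B w) \<partial>\<nu>)
        = (\<integral>\<^sup>+w. \<rho> u w * indicator (- A) w * ?i (?B w) \<partial>\<nu>) + (\<integral>\<^sup>+w. \<rho> u w * indicator A w * ?i (?B w) \<partial>\<nu>)"
      proof -
        have "(\<integral>\<^sup>+w. \<rho> u w * ?i (?B w) \<partial>\<nu>) = (\<integral>\<^sup>+w. \<rho> u w * indicator (- A) w * ?i (?B w) + \<rho> u w * indicator A w * ?i (?B w) \<partial>\<nu>)"
          by (intro nn_integral_cong) (auto simp: indicator_def)
        also have "\<dots> = (\<integral>\<^sup>+w. \<rho> u w * indicator (- A) w * ?i (?B w) \<partial>\<nu>) + (\<integral>\<^sup>+w. \<rho> u w * indicator A w * ?i (?B w) \<partial>\<nu>)"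
          by (rule nn_integral_add) measurable
        finally show ?thesis .
      qed
      \<comment> \<open>Finiteness of the part off \<open>A\<close> allows it to be cancelled from
        both expressions.\<close>
      have "(\<integral>\<^sup>+w. \<rho> u w * indicator (- A) w * ?i (?B w) \<partial>\<nu>) \<le> (\<integral>\<^sup>+w. \<rho> u w \<partial>\<nu>)"
        by (intro nn_integral_mono) (auto simp: indicator_def)
      then have "(\<integral>\<^sup>+w. \<rho> u w * indicator (- A) w * ?i (?B w) \<partial>\<nu>) \<noteq> top"
        using rho_total[OF u] by (auto simp: top_unique)
      then have eq: "(\<integral>\<^sup>+w. \<rho> u w * indicator A w * ?i (?B w) \<partial>\<nu>) = (\<integral>\<^sup>+w. \<rho> u w * indicator A w * (?e (?B w) * ?i (?B w + ?\<delta> *\<^sub>R a)) \<partial>\<nu>)"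
        using 1 2 by (simp add: ennreal_add_left_cancel)
      have "emeasure m D = (\<integral>\<^sup>+x. ?i x \<partial>m)" by simp
      also have "\<dots> = (\<integral>\<^sup>+w. \<rho> u w * indicator A w * ?i (?B w) \<partial>\<nu>)" by (rule mi) measurable
      also have "\<dots> = (\<integral>\<^sup>+x. ?e x * ?i (x + ?\<delta> *\<^sub>R a) \<partial>m)"
        unfolding eq by (rule mi[of "\<lambda>x. ?e x * ?i (x + ?\<delta> *\<^sub>R a)", symmetric]) measurable
      also have "\<dots> = (\<integral>\<^sup>+x. ?i x \<partial>m')"
        unfolding m'_def by (subst nn_integral_distr, measurable, subst nn_integral_density, auto)
      also have "\<dots> = emeasure m' D" by (simp add: m'_def)
      finally show "emeasure m D = emeasure m' D" .
    qed (simp add: m'_def)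
    then have "(\<integral>\<^sup>+x. \<phi> x \<partial>m) = (\<integral>\<^sup>+x. \<phi> x \<partial>m')" by simp
    also have "\<dots> = (\<integral>\<^sup>+x. ?e x * \<phi> (x + ?\<delta> *\<^sub>R a) \<partial>m)"
      unfolding m'_def by (subst nn_integral_distr, measurable, subst nn_integral_density, auto)
    finally show ?thesis .
  qed
  have "(\<integral>\<^sup>+w. \<rho> u w * indicator A w * indicator D (?B w) \<partial>\<nu>) = emeasure m D"
    using mi[of "indicator D"] D by simp
  also have "\<dots> = emeasure m UNIV * emeasure (gauss_vec ?\<delta>) D"
    using sr by (intro gauss_vec_characterization[OF fin sm _ inv D]) auto
  finally show ?thesis unfolding mU .
qed

text \<open>Only the measure and the process change; the filtration stays that of the path, so
  \<open>adapted_generated\<close> becomes available under the weighted measure.\<close>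

lemma girsanov:
  assumes u: "u \<in> bounded_drifts \<nu>"
  shows "gauss_increments (density \<nu> (\<rho> u)) \<F> (\<lambda>t w. path_val (\<beta> w + u w) t)"
proof -
  note [measurable] = rho_measurable[OF u] bounded_driftsD(1)[OF u]
  have "prob_space (density \<nu> (\<rho> u))"
  proof
    have "emeasure (density \<nu> (\<rho> u)) (space \<nu>) = (\<integral>\<^sup>+w. \<rho> u w * indicator (space \<nu>) w \<partial>\<nu>)"
      by (rule emeasure_density) measurable
    then show "emeasure (density \<nu> (\<rho> u)) (space (density \<nu> (\<rho> u))) = 1" using rho_total[OF u] by simp
  qed
  then interpret Q: prob_space "density \<nu> (\<rho> u)" .
  show ?thesis
  proof
    fix t :: real assume t: "t \<in> {0..1}"
    show "subalgebra (density \<nu> (\<rho> u)) (\<F> t)" using sub[OF t] by (simp add: subalgebra_def)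
    show "(\<lambda>w. path_val (\<beta> w + u w) t) \<in> borel_measurable (\<F> t)"
      using adapted[OF t] bounded_drift_adapted[OF u t] by (simp add: plus_cpath.rep_eq)
  next
    fix s t :: real assume "0 \<le> s" "s \<le> t" "t \<le> 1"
    then show "sets (\<F> s) \<subseteq> sets (\<F> t)" by (rule mono)
  next
    fix s t :: real and A and D :: "(real ^ 'n) set"
    assume st: "0 \<le> s" "s < t" "t \<le> 1" and A: "A \<in> sets (\<F> s)" and D [measurable]: "D \<in> sets borel"
    let ?B = "incr (\<lambda>w. \<beta> w + u w) s t"
    have [measurable]: "A \<in> sets \<nu>" using A sub[of s] st by (auto simp: subalgebra_def)
    have BD: "{w. ?B w \<in> D} \<in> sets \<nu>"
      using vimage_UNIV_sets[of ?B borel D] by (simp add: vimage_def)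
    have "emeasure (density \<nu> (\<rho> u)) (A \<inter> {w \<in> space (density \<nu> (\<rho> u)). ?B w \<in> D})
      = (\<integral>\<^sup>+w. \<rho> u w * indicator (A \<inter> {w. ?B w \<in> D}) w \<partial>\<nu>)"
      using BD by (simp add: emeasure_density)
    also have "\<dots> = (\<integral>\<^sup>+w. \<rho> u w * indicator A w * indicator D (?B w) \<partial>\<nu>)"
      by (intro nn_integral_cong) (auto simp: indicator_def)
    also have "\<dots> = (\<integral>\<^sup>+w. \<rho> u w * indicator A w \<partial>\<nu>) * emeasure (gauss_vec (t - s)) D"
      by (rule shifted_increment_indep[OF u st A D])
    also have "(\<integral>\<^sup>+w. \<rho> u w * indicator A w \<partial>\<nu>) = emeasure (density \<nu> (\<rho> u)) A"
      by (simp add: emeasure_density)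
    finally show "emeasure (density \<nu> (\<rho> u)) (A \<inter> {w \<in> space (density \<nu> (\<rho> u)). ?B w \<in> D})
      = emeasure (density \<nu> (\<rho> u)) A * emeasure (gauss_vec (t - s)) D" .
  qed
qed

section \<open>The left inverse \<open>V\<close> and the inverse drift \<open>v\<close>\<close>

context
  fixes u V v :: "'n cpath \<Rightarrow> 'n cpath"
  assumes u: "u \<in> bounded_drifts \<nu>" and V: "V \<in> \<nu> \<rightarrow>\<^sub>M path_borel" and left_inv: "AE w in \<nu>. V (W u w) = w"
    and v: "v = (\<lambda>w. - u (V w))"
begin

text \<open>Read along \<open>W u\<close>, the claim becomes that almost every \<open>w\<close>
  avoids \<open>N\<close>, because \<open>V\<close> undoes \<open>W u\<close>.\<close>

lemma V_null:
  assumes N: "N \<in> sets path_borel" "AE w in \<nu>. w \<notin> N"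
  shows "AE w in \<nu>. V w \<notin> N"
proof (rule W_AE_reflect[OF u])
  have "V -` (UNIV - N) \<in> sets \<nu>" using V
    by (rule vimage_UNIV_sets) (use sets.compl_sets[OF N(1)] in simp)
  then show "{w. V w \<notin> N} \<in> sets \<nu>" by (simp add: vimage_def)
  show "AE w in \<nu>. V (W u w) \<notin> N" using left_inv N(2) by eventually_elim simp
qed

lemma V_AE: "AE w in \<nu>. P w \<Longrightarrow> AE w in \<nu>. P (V w)"
  by (rule null_preserving_AE[OF V V_null])

lemma V_measurable: "V \<in> \<nu> \<rightarrow>\<^sub>M \<nu>"
  by (rule null_preserving_measurable[OF V V_null])

text \<open>Along \<open>W u\<close> both memberships coincide, since \<open>V (W u w) = w\<close>
  almost surely. Working with single events makes the measurability required for reflection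
  evident.\<close>

lemma right_inv: "AE w in \<nu>. W u (V w) = w"
proof (rule AE_cpath_eqI)
  fix E :: "'n cpath set" assume E [measurable]: "E \<in> sets path_borel"
  note [measurable] = meas[OF u] V_measurable
  show "AE w in \<nu>. W u (V w) \<in> E \<longleftrightarrow> w \<in> E"
  proof (rule W_AE_reflect[OF u])
    have "Measurable.pred \<nu> (\<lambda>w. W u (V w) \<in> E \<longleftrightarrow> w \<in> E)" by measurable
    then show "{w. W u (V w) \<in> E \<longleftrightarrow> w \<in> E} \<in> sets \<nu>" by (simp add: pred_def)
    show "AE w in \<nu>. W u (V (W u w)) \<in> E \<longleftrightarrow> W u w \<in> E" using left_inv by eventually_elim simp
  qed
qed

text \<open>The relation \<open>shift\<close> evaluated at \<open>V w\<close>, where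
  \<open>W u (V w) = w\<close>, reads \<open>\<beta> w = \<beta> (V w) + u (V w)\<close>.\<close>

lemma beta_V: "AE w in \<nu>. \<beta> (V w) = \<beta> w + v w"
  using V_AE[OF shift[OF u]] right_inv by eventually_elim (simp add: v)

text \<open>Under the Girsanov measure, \<open>\<beta> + u = \<beta> \<circ> W u\<close> is a Brownian motion of the filtration of the path and, by left
  invertibility, generates everything at time 1; hence it generates the path adaptedly.\<close>

lemma V_adapted:
  assumes t: "t \<in> {0..1}"
  shows "V \<in> \<F> t \<rightarrow>\<^sub>M \<F> t"
proof (rule measurableI)
  fix A assume A: "A \<in> sets (\<F> t)"
  note [measurable] = rho_measurable[OF u]
  interpret Q: gauss_increments "density \<nu> (\<rho> u)" \<F> "\<lambda>t w. path_val (\<beta> w + u w) t"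
    by (rule girsanov[OF u])
  \<comment> \<open>The weight is positive, so both measures have the same null sets.\<close>
  have AEQ: "(AE w in density \<nu> (\<rho> u). P w) \<longleftrightarrow> (AE w in \<nu>. P w)" for P
    by (subst AE_density) (auto simp: girsanov_weight_pos)
  have gen: "sigma_sets UNIV (Q.generators t) = {(\<lambda>w. \<beta> w + u w) -` E | E. E \<in> coord_sets t}" for t
    using coord_sets_vimage[of "\<lambda>w. \<beta> w + u w" UNIV t] by (simp add: Q.generators_def)
  have A\<nu>: "A \<in> sets \<nu>" using A sub[OF t] by (auto simp: subalgebra_def)
  \<comment> \<open>The preimage of \<open>A\<close> under \<open>V\<close> is an event of
    \<open>\<beta>\<close>; composing with \<open>W u\<close> turns \<open>V\<close> into the
    identity and \<open>\<beta>\<close> into \<open>\<beta> + u\<close>, so \<open>A\<close> itself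
    is generated by \<open>\<beta> + u\<close> over the whole interval.\<close>
  obtain E where E: "E \<in> sets path_borel" "AE w in \<nu>. w \<in> V -` A \<longleftrightarrow> \<beta> w \<in> E"
    using beta_approx[OF vimage_UNIV_sets[OF V_measurable A\<nu>]] by blast
  have "AE w in \<nu>. w \<in> A \<longleftrightarrow> \<beta> w + u w \<in> E"
    using W_AE[OF u E(2)] left_inv shift[OF u] by eventually_elim simp
  then have "AE w in density \<nu> (\<rho> u). w \<in> A \<longleftrightarrow> w \<in> (\<lambda>w. \<beta> w + u w) -` E" by (simp add: AEQ)
  moreover have "(\<lambda>w. \<beta> w + u w) -` E \<in> sigma_sets (space (density \<nu> (\<rho> u))) (Q.generators 1)"
    using E(1) by (auto simp: gen coord_sets_1)
  ultimately obtain E' where "E' \<in> sigma_sets (space (density \<nu> (\<rho> u))) (Q.generators t)"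
    "AE w in density \<nu> (\<rho> u). w \<in> A \<longleftrightarrow> w \<in> E'"
    using Q.adapted_generated[OF t A] by blast
  then obtain S where S: "S \<in> coord_sets t" "AE w in \<nu>. w \<in> A \<longleftrightarrow> \<beta> w + u w \<in> S"
    by (auto simp: gen AEQ)
  \<comment> \<open>Composing with \<open>V\<close> runs the correspondence backwards:
    \<open>\<beta> + u\<close> becomes \<open>\<beta>\<close>, and only times up to \<open>t\<close>
    are involved.\<close>
  have ae: "AE w in \<nu>. w \<in> \<beta> -` S \<longleftrightarrow> w \<in> V -` A"
    using V_AE[OF S(2)] V_AE[OF shift[OF u]] right_inv by eventually_elim simp
  have "\<beta> -` S \<in> {\<beta> -` E \<inter> UNIV | E. E \<in> coord_sets t}" using S(1) by auto
  note SS = this[unfolded coord_sets_vimage]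
  have "\<beta> -` S \<in> sets (natural_filtration \<nu> \<beta> t)"
    unfolding sets_natural_filtration space_nu by (rule subsetD[OF sigma_sets_mono' SS]) blast
  then have SF: "\<beta> -` S \<in> sets (\<F> t)" using filt[OF t] by simp
  have "V -` A \<in> sets (\<F> t)"
    using ae by (intro natural_filtration_AE[OF SF]) simp
  then show "V -` A \<inter> space (\<F> t) \<in> sets (\<F> t)" by simp
qed simp

text \<open>Up to sign, the density is that of \<open>u\<close> composed with \<open>V\<close>. Its
  bound and its defining property survive because \<open>V\<close> respects null sets, its
  adaptedness because \<open>V\<close> is measurable from \<open>\<F> t\<close> to
  \<open>\<F> t\<close>.\<close>

lemma v_bounded_drifts: "v \<in> bounded_drifts \<nu>"
proof -
  interpret MT: pair_prob_space \<nu> unit_time ..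
  note uD = bounded_driftsD[OF u]
  note [measurable] = cm_dot_measurable[OF u] V_measurable uD(1)
  obtain C where C: "AE (w, t) in \<P>. norm (cm_dot \<nu> u w t) \<le> C" using uD(4) by blast
  let ?g = "\<lambda>w t. - cm_dot \<nu> u (V w) t"
  have gm [measurable]: "(\<lambda>(w, t). ?g w t) \<in> borel_measurable \<P>" by measurable
  show ?thesis
  proof (rule bounded_driftsI(1))
    show "v \<in> \<nu> \<rightarrow>\<^sub>M path_borel" unfolding v by measurable
    show "v w \<in> cameron_martin" for w
      using uD(2)[of "V w"] has_cm_density_uminus[of "u (V w)"] by (auto simp: v cameron_martin_def)
    show "adapted_density \<nu> v ?g"
      unfolding adapted_density_def
    proof (intro conjI ballI gm)
      fix t :: real assume t: "t \<in> {0..1}"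
      have "(\<lambda>w. cm_dot \<nu> u w t) \<in> borel_measurable (\<F> t)" using uD(3) t by (simp add: adapted_density_def)
      from measurable_compose[OF V_adapted[OF t] this] show "(\<lambda>w. ?g w t) \<in> borel_measurable (\<F> t)" by simp
    next
      have "AE w in \<nu>. has_cm_density (u w) (cm_dot \<nu> u w)" using uD(3) by (simp add: adapted_density_def)
      from V_AE[OF this] show "AE w in \<nu>. has_cm_density (v w) (?g w)"
        by eventually_elim (simp add: v has_cm_density_uminus)
    qed
    have "AE w in \<nu>. AE t in unit_time. norm (cm_dot \<nu> u w t) \<le> C" using MT.AE_pair[OF C] by simp
    from V_AE[OF this] have ae: "AE w in \<nu>. AE t in unit_time. norm (?g w t) \<le> C" by simp
    have "AE x in \<P>. norm (?g (fst x) (snd x)) \<le> C"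
    proof (rule MT.AE_pair_measure)
      show "{x \<in> space \<P>. norm (?g (fst x) (snd x)) \<le> C} \<in> sets \<P>" by measurable
    qed (use ae in simp)
    then show "AE (w, t) in \<P>. norm (?g w t) \<le> C" by (simp add: split_beta')
  qed
qed

text \<open>\<open>V\<close> and \<open>W v\<close> have the same image \<open>\<beta> + v\<close>
  under \<open>\<beta>\<close>, and events are decided by \<open>\<beta>\<close> up to null sets,
  which both maps respect.\<close>

lemma V_eq: "AE w in \<nu>. V w = W v w"
proof (rule AE_cpath_eqI)
  fix E :: "'n cpath set" assume E: "E \<in> sets path_borel"
  have "E \<in> sets \<nu>" using vimage_UNIV_sets[OF id_measurable E] by simp
  then obtain S where S: "AE w in \<nu>. w \<in> E \<longleftrightarrow> \<beta> w \<in> S" using beta_approx by blast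
  show "AE w in \<nu>. V w \<in> E \<longleftrightarrow> W v w \<in> E"
    using V_AE[OF S] W_AE[OF v_bounded_drifts S] beta_V shift[OF v_bounded_drifts] by eventually_elim simp
qed

text \<open>The assumed law for the drift \<open>v\<close> is applied to the event composed with
  \<open>W u\<close>; since \<open>W v\<close> is almost surely \<open>V\<close>, the composition
  \<open>W u (W v w)\<close> is \<open>w\<close>.\<close>

lemma distr_W_u: "distr \<nu> \<nu> (W u) = density \<nu> (\<rho> v)"
proof (rule measure_eqI)
  fix E assume "E \<in> sets (distr \<nu> \<nu> (W u))"
  then have E [measurable]: "E \<in> sets \<nu>" by simp
  note [measurable] = W_measurable[OF u] rho_measurable[OF v_bounded_drifts]
  have "emeasure (distr \<nu> \<nu> (W u)) E = (\<integral>\<^sup>+w. indicator E w \<partial>distr \<nu> \<nu> (W u))" by simp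
  also have "\<dots> = (\<integral>\<^sup>+w. indicator E (W u w) \<partial>\<nu>)" by (rule nn_integral_distr) measurable
  also have "\<dots> = (\<integral>\<^sup>+w. \<rho> v w * indicator E (W u (W v w)) \<partial>\<nu>)"
    by (rule law_nn_integral[OF v_bounded_drifts, of "\<lambda>w. indicator E (W u w)", symmetric]) measurable
  also have "\<dots> = (\<integral>\<^sup>+w. \<rho> v w * indicator E w \<partial>\<nu>)"
  proof (rule nn_integral_cong_AE, use V_eq right_inv in eventually_elim)
    case (elim w)
    then show ?case by simp
  qed
  also have "\<dots> = emeasure (density \<nu> (\<rho> v)) E" by (rule emeasure_density[symmetric]) measurable
  finally show "emeasure (distr \<nu> \<nu> (W u)) E = emeasure (density \<nu> (\<rho> v)) E" .
qed simp

text \<open>With roles exchanged, \<open>W v (W u w) = w\<close> almost surely, because the equality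
  of \<open>V\<close> and \<open>W v\<close> may be evaluated along \<open>W u\<close>.\<close>

lemma distr_W_v: "distr \<nu> \<nu> (W v) = density \<nu> (\<rho> u)"
proof (rule measure_eqI)
  fix E assume "E \<in> sets (distr \<nu> \<nu> (W v))"
  then have E [measurable]: "E \<in> sets \<nu>" by simp
  note [measurable] = W_measurable[OF v_bounded_drifts] rho_measurable[OF u]
  have "emeasure (distr \<nu> \<nu> (W v)) E = (\<integral>\<^sup>+w. indicator E w \<partial>distr \<nu> \<nu> (W v))" by simp
  also have "\<dots> = (\<integral>\<^sup>+w. indicator E (W v w) \<partial>\<nu>)" by (rule nn_integral_distr) measurable
  also have "\<dots> = (\<integral>\<^sup>+w. \<rho> u w * indicator E (W v (W u w)) \<partial>\<nu>)"
    by (rule law_nn_integral[OF u, of "\<lambda>w. indicator E (W v w)", symmetric]) measurable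
  also have "\<dots> = (\<integral>\<^sup>+w. \<rho> u w * indicator E w \<partial>\<nu>)"
  proof (rule nn_integral_cong_AE, use W_AE[OF u V_eq] left_inv in eventually_elim)
    case (elim w)
    then show ?case by simp
  qed
  also have "\<dots> = emeasure (density \<nu> (\<rho> u)) E" by (rule emeasure_density[symmetric]) measurable
  finally show "emeasure (distr \<nu> \<nu> (W v)) E = emeasure (density \<nu> (\<rho> u)) E" .
qed simp

end

end

theorem theorem1:
  fixes \<mu> \<nu> :: "'n::finite cpath measure"
    and \<beta> :: "'n cpath \<Rightarrow> 'n cpath"
    and W :: "('n cpath \<Rightarrow> 'n cpath) \<Rightarrow> 'n cpath \<Rightarrow> 'n cpath"
    and u v V :: "'n cpath \<Rightarrow> 'n cpath"
  assumes prob: "prob_space \<mu>"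
    and sets: "sets \<mu> = sets path_borel"
    and nu: "\<nu> = completion \<mu>"
    and bm: "brownian_motion \<nu> \<beta>"
    and meas: "\<And>u. u \<in> bounded_drifts \<nu> \<Longrightarrow> W u \<in> \<nu> \<rightarrow>\<^sub>M path_borel"
    and filt: "\<And>t. t \<in> {0..1} \<Longrightarrow> sets (natural_filtration \<nu> \<beta> t) = sets (coord_filtration \<nu> t)"
    and zero: "AE w in \<nu>. W (\<lambda>_. 0) w = w"
    and law: "\<And>u. u \<in> bounded_drifts \<nu> \<Longrightarrow>
           distr (density \<nu> (\<lambda>w. ennreal (girsanov_weight \<nu> \<beta> u w))) path_borel (W u)
             = distr \<nu> path_borel (\<lambda>w. w)"
    and shift: "\<And>u. u \<in> bounded_drifts \<nu> \<Longrightarrow> AE w in \<nu>. \<beta> (W u w) = \<beta> w + u w"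
    and flow: "\<And>u v. u \<in> bounded_drifts \<nu> \<Longrightarrow> v \<in> bounded_drifts \<nu> \<Longrightarrow>
           AE w in \<nu>. W u (W v w) = W (\<lambda>w'. v w' + u (W v w')) w"
    and u: "u \<in> bounded_drifts \<nu>"
    and V: "V \<in> \<nu> \<rightarrow>\<^sub>M path_borel"
    and left_inv: "AE w in \<nu>. V (W u w) = w"
    and v: "v = (\<lambda>w. - u (V w))"
  shows "(AE w in \<nu>. W u (V w) = w) \<and>
         v \<in> bounded_drifts \<nu> \<and>
         (AE w in \<nu>. V w = W v w) \<and>
         distr \<nu> \<nu> (W u) = density \<nu> (\<lambda>w. ennreal (girsanov_weight \<nu> \<beta> v w)) \<and>
         distr \<nu> \<nu> (W v) = density \<nu> (\<lambda>w. ennreal (girsanov_weight \<nu> \<beta> u w))"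
proof -
  interpret path_shift \<mu> \<nu> \<beta> W
    by (intro path_shift.intro path_brownian.intro path_shift_axioms.intro prob sets nu bm filt meas law shift)
  show ?thesis
    using right_inv[OF u V left_inv v] v_bounded_drifts[OF u V left_inv v] V_eq[OF u V left_inv v]
      distr_W_u[OF u V left_inv v] distr_W_v[OF u V left_inv v]
    by blast
qed

end
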